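(* Let $\alpha>0$, $\alpha\neq 1$. Let $T$ be a linear operator, with values in $A^2(U^\alpha)$, defined on the linear span of the normalized reproducing kernels $\{k_z: z\in U^\alpha\}$ of $A^2(U^\alpha)$. Assume that there exists an operator $T^*$ (linear, with values in $A^2(U^\alpha)$) defined on the same span such that $\langle Tk_z,k_w\rangle=\langle k_z,T^*k_w\rangle$ for all $z,w\in U^\alpha$. If, for some $p>4$, $$\sup_{z\in U^\alpha}\big\|V_{f_\alpha(z)}U_zTk_z\big\|_{L^p(U^\alpha)}<\infty\quad\text{and}\quad \sup_{z\in U^\alpha}\big\|V_{f_\alpha(z)}U_zT^*k_z\big\|_{L^p(U^\alpha)}<\infty,$$ then $T$ can be extended to a bounded operator on $A^2(U^\alpha)$.
   Context: $U^\alpha=\{z=(z_1,z_2)\in\mathbb C^2: |z_1|^{2/\alpha}+|z_2|^2<1\}$; $d\sigma$ is Lebesgue measure; $\langle\cdot,\cdot\rangle$ and $\|\cdot\|$ are the inner product and norm of $L^2(U^\alpha)=L^2(U^\alpha,d\sigma)$, and $L^p(U^\alpha)=L^p(U^\alpha,d\sigma)$. $A^2(U^\alpha)$ is the Bergman space, the closed subspace of holomorphic functions in $L^2(U^\alpha)$; $K_{U^\alpha}(w;\bar z)$ is its Bergman (reproducing) kernel, $K_z=K_{U^\alpha}(\cdot;\bar z)$, and $k_z=K_z/\|K_z\|$. $\mathbb D$ is the open unit disc in $\mathbb C$. For $b\in\mathbb D$ define $\varphi_b:U^\alpha\to U^\alpha$ by $$\varphi_b(w_1,w_2)=\Big(w_1\Big(\tfrac{\sqrt{1-|b|^2}}{1-\bar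 b w_2}\Big)^\alpha,\ \tfrac{b-w_2}{1-\bar b w_2}\Big)$$ (principal branch of the power). For $a\in\mathbb D$ define $\phi_a:U^\alpha\to U^\alpha$ by $\phi_a(w)=(\phi^{(1)}(w),\phi^{(2)}(w))$, where $$\phi^{(1)}(w)=\frac{a-w_1}{1-\bar a w_1},\qquad \phi^{(2)}(w)=w_2\,\frac{\sqrt{1-|a|^2}}{1-\bar a w_1}\sqrt{\frac{(1-|w_1|^2)(1-|\phi^{(1)}(w)|^{2/\alpha})}{(1-|w_1|^{2/\alpha})(1-|\phi^{(1)}(w)|^2)}}.$$ For $z=(z_1,z_2)\in U^\alpha$ put $f_\alpha(z)=z_1/(1-|z_2|^2)^{\alpha/2}\in\mathbb D$. $J$ denotes the holomorphic Jacobian determinant, i.e. the determinant of the matrix of derivatives $\partial/\partial w_j$ of the components (used also for the non-holomorphic map $\phi_a$, for which $J\phi_a=\frac{\partial\phi^{(1)}}{\partial w_1}\frac{\partial\phi^{(2)}}{\partial w_2}$). For functions $f$ on $U^\alpha$, $$U_zf(w)=f(\varphi_{z_2}(w))\,J\varphi_{z_2}(w)\quad(z=(z_1,z_2)\in U^\alpha),\qquad V_af(w)=f(\phi_a(w))\,J\phi_a(w)\quad(a\in\mathbb D).$$ *)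

theory Defs
  imports "HOL-Analysis.Analysis"
begin

type_synonym c2 = "complex \<times> complex"

definition U_dom :: "real \<Rightarrow> c2 set" where
  "U_dom \<alpha> = {(z1, z2). cmod z1 powr (2 / \<alpha>) + (cmod z2)\<^sup>2 < 1}"

(* Holomorphy in two variables: complex-linear Frechet derivative at every point of an open set. *)
definition holomorphic2_on :: "(c2 \<Rightarrow> complex) \<Rightarrow> c2 set \<Rightarrow> bool" where
  "holomorphic2_on f S \<longleftrightarrow>
    (\<forall>z\<in>S. \<exists>a b. (f has_derivative (\<lambda>h. a * fst h + b * snd h)) (at z))"

(* Functions on U_dom are represented by total functions. Elements of the Bergman space vanish
   off U_dom, so that HOL equality of elements is equality of functions on U_dom. *)
definition bergman_space :: "real \<Rightarrow> (c2 \<Rightarrow> complex) set" where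
  "bergman_space \<alpha> = {f. holomorphic2_on f (U_dom \<alpha>) \<and>
     set_integrable lborel (U_dom \<alpha>) (\<lambda>w. (cmod (f w))\<^sup>2) \<and> (\<forall>w. w \<notin> U_dom \<alpha> \<longrightarrow> f w = 0)}"

definition l2_inner :: "real \<Rightarrow> (c2 \<Rightarrow> complex) \<Rightarrow> (c2 \<Rightarrow> complex) \<Rightarrow> complex" where
  "l2_inner \<alpha> f g = (LINT w:U_dom \<alpha>|lborel. f w * cnj (g w))"

definition l2_norm :: "real \<Rightarrow> (c2 \<Rightarrow> complex) \<Rightarrow> real" where
  "l2_norm \<alpha> f = sqrt (LINT w:U_dom \<alpha>|lborel. (cmod (f w))\<^sup>2)"

(* L^p norm with values in [0, \<infinity>]; infinite exactly when f is not p-integrable. *)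
definition lp_norm :: "real \<Rightarrow> real \<Rightarrow> (c2 \<Rightarrow> complex) \<Rightarrow> ennreal" where
  "lp_norm \<alpha> p f =
    (let I = (\<integral>\<^sup>+w\<in>U_dom \<alpha>. ennreal (cmod (f w) powr p) \<partial>lborel)
     in if I = \<infinity> then \<infinity> else ennreal (enn2real I powr (1 / p)))"

definition bergman_kernel :: "real \<Rightarrow> c2 \<Rightarrow> c2 \<Rightarrow> complex" where
  "bergman_kernel \<alpha> z =
    (THE K. K \<in> bergman_space \<alpha> \<and> (\<forall>f\<in>bergman_space \<alpha>. l2_inner \<alpha> f K = f z))"

definition normalized_kernel :: "real \<Rightarrow> c2 \<Rightarrow> c2 \<Rightarrow> complex" where
  "normalized_kernel \<alpha> z =
    (\<lambda>w. bergman_kernel \<alpha> z w / of_real (l2_norm \<alpha> (bergman_kernel \<alpha> z)))"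

definition complex_span :: "(c2 \<Rightarrow> complex) set \<Rightarrow> (c2 \<Rightarrow> complex) set" where
  "complex_span S = {f. \<exists>A c. finite A \<and> A \<subseteq> S \<and> f = (\<lambda>w. \<Sum>g\<in>A. c g * g w)}"

definition kernel_span :: "real \<Rightarrow> (c2 \<Rightarrow> complex) set" where
  "kernel_span \<alpha> = complex_span (normalized_kernel \<alpha> ` U_dom \<alpha>)"

definition complex_linear_on ::
  "(c2 \<Rightarrow> complex) set \<Rightarrow> ((c2 \<Rightarrow> complex) \<Rightarrow> (c2 \<Rightarrow> complex)) \<Rightarrow> bool" where
  "complex_linear_on S T \<longleftrightarrow>
    (\<forall>f\<in>S. \<forall>g\<in>S. T (\<lambda>w. f w + g w) = (\<lambda>w. T f w + T g w)) \<and>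
    (\<forall>f\<in>S. \<forall>c. T (\<lambda>w. c * f w) = (\<lambda>w. c * T f w))"

definition bounded_operator_on_bergman ::
  "real \<Rightarrow> ((c2 \<Rightarrow> complex) \<Rightarrow> (c2 \<Rightarrow> complex)) \<Rightarrow> bool" where
  "bounded_operator_on_bergman \<alpha> S \<longleftrightarrow>
    S ` bergman_space \<alpha> \<subseteq> bergman_space \<alpha> \<and> complex_linear_on (bergman_space \<alpha>) S \<and>
    (\<exists>C. \<forall>f\<in>bergman_space \<alpha>. l2_norm \<alpha> (S f) \<le> C * l2_norm \<alpha> f)"

(* The Wirtinger derivative d/dz = (d/dx - i d/dy) / 2; it agrees with deriv where g is
   complex differentiable. *)
definition wirtinger_deriv :: "(complex \<Rightarrow> complex) \<Rightarrow> complex \<Rightarrow> complex" where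
  "wirtinger_deriv g z =
    (vector_derivative (\<lambda>t::real. g (z + of_real t)) (at 0)
      - \<i> * vector_derivative (\<lambda>t::real. g (z + \<i> * of_real t)) (at 0)) / 2"

(* The first component of disc_map below does not depend on w2, so there the second product
   is 0, also at points where the second component is not differentiable in w1. *)
definition jacobian :: "(c2 \<Rightarrow> c2) \<Rightarrow> c2 \<Rightarrow> complex" where
  "jacobian F w =
    wirtinger_deriv (\<lambda>x. fst (F (x, snd w))) (fst w) *
      wirtinger_deriv (\<lambda>y. snd (F (fst w, y))) (snd w)
    - wirtinger_deriv (\<lambda>y. fst (F (fst w, y))) (snd w) *
      wirtinger_deriv (\<lambda>x. snd (F (x, snd w))) (fst w)"

(* The automorphism written \<phi>_b with curly phi; complex powr is the principal branch. *)
definition aut_map :: "real \<Rightarrow> complex \<Rightarrow> c2 \<Rightarrow> c2" where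
  "aut_map \<alpha> b w =
    (fst w * (of_real (sqrt (1 - (cmod b)\<^sup>2)) / (1 - cnj b * snd w)) powr of_real \<alpha>,
     (b - snd w) / (1 - cnj b * snd w))"

definition mobius :: "complex \<Rightarrow> complex \<Rightarrow> complex" where
  "mobius a x = (a - x) / (1 - cnj a * x)"

(* The non-holomorphic self-map of U_dom, for a in the unit disc. *)
definition disc_map :: "real \<Rightarrow> complex \<Rightarrow> c2 \<Rightarrow> c2" where
  "disc_map \<alpha> a w =
    (mobius a (fst w),
     snd w * (of_real (sqrt (1 - (cmod a)\<^sup>2)) / (1 - cnj a * fst w)) *
       of_real (sqrt (((1 - (cmod (fst w))\<^sup>2) * (1 - cmod (mobius a (fst w)) powr (2 / \<alpha>))) /
         ((1 - cmod (fst w) powr (2 / \<alpha>)) * (1 - (cmod (mobius a (fst w)))\<^sup>2)))))"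

definition f_alpha :: "real \<Rightarrow> c2 \<Rightarrow> complex" where
  "f_alpha \<alpha> z = fst z / of_real ((1 - (cmod (snd z))\<^sup>2) powr (\<alpha> / 2))"

definition U_op :: "real \<Rightarrow> c2 \<Rightarrow> (c2 \<Rightarrow> complex) \<Rightarrow> c2 \<Rightarrow> complex" where
  "U_op \<alpha> z f w = f (aut_map \<alpha> (snd z) w) * jacobian (aut_map \<alpha> (snd z)) w"

definition V_op :: "real \<Rightarrow> complex \<Rightarrow> (c2 \<Rightarrow> complex) \<Rightarrow> c2 \<Rightarrow> complex" where
  "V_op \<alpha> a f w = f (disc_map \<alpha> a w) * jacobian (disc_map \<alpha> a) w"

end

theory Submission
  imports Defs "HOL-Complex_Analysis.Complex_Analysis"
begin

text \<open>
  Let \<open>K\<^sub>z\<close> be the reproducing kernel at \<open>z\<close>. The hypothesis on the adjoint says that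
  \<open>T K\<^sub>z(w)\<close> is the complex conjugate of \<open>T* K\<^sub>w(z)\<close>, so an extension of \<open>T\<close> has to be the integral
  operator \<open>S f(w) = \<integral> f(z) T K\<^sub>z(w) d\<sigma>(z)\<close>. Its boundedness on \<open>L\<^sup>2\<close> follows from the Schur test
  once there is a weight \<open>h > 0\<close> with \<open>\<integral> |T K\<^sub>z(w)| h(w) d\<sigma>(w) \<le> C h(z)\<close> for all \<open>z\<close>, and likewise
  for \<open>T*\<close>.

  The weight is \<open>h(w) = (1 - |w\<^sub>2|\<^sup>2)^(-(2+\<alpha>)/4) (1 - |f\<^sub>\<alpha>(w)|\<^sup>2)^(-3/4)\<close>, which is comparable to
  \<open>K\<^sub>w(w)^(1/4)\<close>. Fix \<open>z\<close> and put \<open>b = z\<^sub>2\<close>, \<open>a = f\<^sub>\<alpha>(z)\<close>. Substituting the automorphism \<open>w = \<phi>\<^sub>b(v)\<close>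
  replaces \<open>T k\<^sub>z\<close> by \<open>U\<^sub>z T k\<^sub>z\<close>. Substituting the disc map with parameter \<open>a\<close>
  shows that the hypothesis bounds the integral of \<open>|U\<^sub>z T k\<^sub>z|^p D^(p-2)\<close>, where the explicit
  weight \<open>D\<close> is bounded by a multiple of the Jacobian of the disc map. Holder's inequality then leaves an explicit
  integral with the conjugate exponent \<open>q\<close> (\<open>ex_weight_integral_bound\<close>). Integrated first over
  the discs \<open>v\<^sub>2 = const\<close>, it grows like a power of
  \<open>1 - |a|\<^sup>2 (1 - |v\<^sub>2|\<^sup>2)^\<alpha>\<close> with exponent \<open>-(4 - 9q/4)\<close>; the second integration
  gains one power of \<open>1 - |a|\<^sup>2\<close> provided \<open>4 - 9q/4 > 1\<close>, that is \<open>q < 4/3\<close> or \<open>p > 4\<close>. This gives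
  \<open>ex_test_estimate\<close>, and together with the norm bound for \<open>K\<^sub>z\<close> the hypothesis of the Schur test.

  The kernel exists because point evaluations are bounded: an automorphism moves \<open>z\<close> to
  \<open>(a, 0)\<close>, and around that point there is a polydisc inside the domain whose volume is comparable
  to \<open>(1 - |a|)\<^sup>3\<close>, so that the sub-mean value property applies. The resulting bound
  (\<open>ex_bergman_point_bound\<close>) has the right order; it also makes the Bergman space complete, which
  gives the Riesz representation theorem \<open>bergman_Riesz\<close> by minimisation, and it bounds the norm of
  \<open>K\<^sub>z\<close>. The Riesz theorem is used once more for the holomorphy of \<open>S f\<close>: the functional
  \<open>u \<mapsto> \<langle>u, S f\<rangle>\<close> is represented by some \<open>g\<close> in the Bergman space, and testing it with the kernels
  yields \<open>g = S f\<close> by Fubini's theorem.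

  Both families of maps are skew products of a Moebius transformation of one variable and a
  multiplication in the other one. Hence Fubini's theorem reduces their change of variables
  formulas to the plane, although the disc maps are not holomorphic.
\<close>

section \<open>Holomorphic changes of variables in the plane\<close>

text \<open>In \<open>real^2\<close> the substitution rule is available in terms of determinants; this identification
  carries it over to the complex plane.\<close>

lemma lborel_complex_vec:
  "(lborel :: complex measure) = distr lborel borel (\<lambda>v::real^2. Complex (v$1) (v$2))"
proof (rule lborel_eqI)
  have meas[measurable]: "(\<lambda>v::real^2. Complex (v$1) (v$2)) \<in> borel_measurable borel"
    by (intro borel_measurable_continuous_onI) (auto intro!: continuous_intros simp: complex_eq)
  fix l u :: complex assume le: "\<And>b. b \<in> Basis \<Longrightarrow> l \<bullet> b \<le> u \<bullet> b"
  have 1: "Re l \<le> Re u" "Im l \<le> Im u" using le[of 1] le[of \<i>] by (auto simp: Basis_complex_def)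
  have eq: "(\<lambda>v::real^2. Complex (v$1) (v$2)) -` box l u = box (vector [Re l, Im l]) (vector [Re u, Im u])"
    by (auto simp: box_def Basis_complex_def Basis_vec_def axis_def inner_vec_def forall_2 UNIV_2 cart_eq_inner_axis[symmetric])
  show "emeasure (distr lborel borel (\<lambda>v::real^2. Complex (v$1) (v$2))) (box l u) = (\<Prod>b\<in>Basis. (u - l) \<bullet> b)"
    using 1
    apply (subst emeasure_distr)
    apply (auto simp: eq)
    apply (subst emeasure_lborel_box)
    apply (auto simp: Basis_vec_def UNIV_2 Basis_complex_def inner_axis  axis_eq_axis)
    done
qed simp

lemma nn_integral_complex_vec:
  fixes F :: "complex \<Rightarrow> ennreal"
  assumes [measurable]: "F \<in> borel_measurable borel"
  shows "(\<integral>\<^sup>+x. F x \<partial>lborel) = (\<integral>\<^sup>+v. F (Complex (v$1) (v$2)) \<partial>(lborel::(real^2) measure))"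
proof -
  have meas[measurable]: "(\<lambda>v::real^2. Complex (v$1) (v$2)) \<in> borel_measurable borel"
    by (intro borel_measurable_continuous_onI) (auto intro!: continuous_intros simp: complex_eq)
  show ?thesis
    by (subst lborel_complex_vec) (simp add: nn_integral_distr)
qed

lemma lborel_complex_prod:
  "(lborel :: complex measure) = distr (lborel \<Otimes>\<^sub>M lborel) borel (\<lambda>(x,y). Complex x y)"
proof (rule lborel_eqI)
  have meas[measurable]: "(\<lambda>(x,y). Complex x y) \<in> borel_measurable (lborel \<Otimes>\<^sub>M lborel)"
    unfolding lborel_prod
    by (auto intro!: borel_measurable_continuous_onI continuous_intros simp: complex_eq case_prod_beta)
  fix l u :: complex assume le: "\<And>b. b \<in> Basis \<Longrightarrow> l \<bullet> b \<le> u \<bullet> b"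
  have 1: "Re l \<le> Re u" "Im l \<le> Im u" using le[of 1] le[of \<i>] by (auto simp: Basis_complex_def)
  have eq: "(\<lambda>(x,y). Complex x y) -` box l u = {Re l<..<Re u} \<times> {Im l<..<Im u}"
    by (auto simp: box_def Basis_complex_def)
  show "emeasure (distr (lborel \<Otimes>\<^sub>M lborel) borel (\<lambda>(x,y). Complex x y)) (box l u) = (\<Prod>b\<in>Basis. (u - l) \<bullet> b)"
    using 1
    apply (subst emeasure_distr)
      apply (auto simp: eq space_pair_measure lborel.emeasure_pair_measure_Times Basis_complex_def ennreal_mult)
    done
qed simp

lemma nn_integral_complex_prod:
  fixes F :: "complex \<Rightarrow> ennreal"
  assumes [measurable]: "F \<in> borel_measurable borel"
  shows "(\<integral>\<^sup>+z. F z \<partial>lborel) = (\<integral>\<^sup>+y. (\<integral>\<^sup>+x. F (Complex x y) \<partial>lborel) \<partial>lborel)"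
proof -
  have meas[measurable]: "(\<lambda>(x,y). Complex x y) \<in> borel_measurable (lborel \<Otimes>\<^sub>M lborel)"
    unfolding lborel_prod
    by (auto intro!: borel_measurable_continuous_onI continuous_intros simp: complex_eq case_prod_beta)
  have 1: "(\<integral>\<^sup>+z. F z \<partial>lborel) = (\<integral>\<^sup>+w. F ((\<lambda>(x,y). Complex x y) w) \<partial>(lborel \<Otimes>\<^sub>M lborel))"
    by (subst lborel_complex_prod) (simp add: nn_integral_distr)
  show ?thesis
    unfolding 1 by (subst lborel_pair.nn_integral_snd[symmetric]) auto
qed

text \<open>Multiplication by a complex number \<open>d\<close> is a real linear map of the plane whose determinant
  is \<open>|d|\<^sup>2\<close>; the boundedness of the image keeps the measures finite.\<close>

lemma emeasure_holomorphic_image: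
  fixes g :: "complex \<Rightarrow> complex"
  assumes S: "B \<in> sets borel" and der: "\<And>x. x \<in> B \<Longrightarrow> (g has_field_derivative d x) (at x)"
    and inj: "inj_on g B" and bdd: "bounded (g ` B)" and im: "g ` B \<in> sets borel"
    and [measurable]: "d \<in> borel_measurable borel"
  shows "emeasure lborel (g ` B) = (\<integral>\<^sup>+x. indicator B x * ennreal ((cmod (d x))\<^sup>2) \<partial>lborel)"
proof -
  define e where "e = (\<lambda>v::real^2. Complex (v$1) (v$2))"
  define e' where "e' = (\<lambda>z::complex. (\<chi> i. if i = 1 then Re z else Im z)::real^2)"
  have ee': "e (e' z) = z" for z by (simp add: e_def e'_def)
  have e'e: "e' (e v) = v" for v by (simp add: e_def e'_def vec_eq_iff forall_2)
  have meas[measurable]: "e \<in> borel_measurable borel" unfolding e_def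
    by (intro borel_measurable_continuous_onI) (auto intro!: continuous_intros simp: complex_eq)
  have e'_lin: "bounded_linear e'"
    by (rule linear_conv_bounded_linear[THEN iffD1])
       (auto simp: e'_def linear_iff vec_eq_iff)
  have e_lin: "bounded_linear e"
    by (rule linear_conv_bounded_linear[THEN iffD1])
       (auto simp: e_def linear_iff complex_eq_iff)
  note S[measurable] im[measurable]
  define V where "V = e -` B"
  have [measurable]: "V \<in> sets borel" unfolding V_def using measurable_sets[OF meas S] by simp
  define G where "G = e' \<circ> g \<circ> e"
  define G' where "G' = (\<lambda>v h. e' (d (e v) * e h))"
  have GV: "G ` V = e -` (g ` B)"
    apply (auto simp: G_def V_def ee' image_iff)
    by (metis e'e ee' vimageI)
  have [measurable]: "G ` V \<in> sets borel" unfolding GV using measurable_sets[OF meas im] by simp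
  have bV: "bounded (G ` V)"
  proof -
    have "e ` V = B" unfolding V_def by (intro surj_image_vimage_eq surjI[of e e'] ee')
    then have "G ` V = e' ` (g ` B)" unfolding G_def by (metis image_comp)
    then show ?thesis using bounded_linear_image[OF bdd e'_lin] by simp
  qed
  have lm: "G ` V \<in> lmeasurable"
    using bV by (intro bounded_set_imp_lmeasurable) (auto intro: sets_completionI_sets)
  have derG: "(G has_derivative G' v) (at v within V)" if "v \<in> V" for v
  proof -
    have "(g has_derivative (\<lambda>h. d (e v) * h)) (at (e v))"
      using der[of "e v"] that unfolding V_def has_field_derivative_def by simp
    moreover have "(e has_derivative e) (at v)" using e_lin by (rule bounded_linear_imp_has_derivative)
    ultimately have "(g \<circ> e has_derivative (\<lambda>h. d (e v) * h) \<circ> e) (at v)"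
      by (intro diff_chain_at) 
    moreover have "(e' has_derivative e') (at ((g \<circ> e) v))" using e'_lin by (rule bounded_linear_imp_has_derivative)
    ultimately have "(e' \<circ> (g \<circ> e) has_derivative e' \<circ> ((\<lambda>h. d (e v) * h) \<circ> e)) (at v)"
      by (rule diff_chain_at) 
    then show ?thesis unfolding G_def G'_def o_def by (rule has_derivative_at_withinI)
  qed
  have injG: "inj_on G V"
    using inj by (auto simp: inj_on_def G_def V_def) (metis e'e ee')
  have det: "\<bar>det (matrix (G' v))\<bar> = (cmod (d (e v)))\<^sup>2" for v
    unfolding cmod_power2 by (simp add: det_2 matrix_def G'_def e'_def e_def axis_def power2_eq_square)
  have "((\<lambda>x. \<bar>det (matrix (G' x))\<bar>) has_integral measure lebesgue (G ` V)) V"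
    by (rule has_measure_differentiable_image[THEN iffD1, OF _ derG injG])
       (auto simp: lm intro: sets_completionI_sets)
  then have "(\<integral>\<^sup>+x. indicator V x * ennreal \<bar>det (matrix (G' x))\<bar> \<partial>lborel) = measure lebesgue (G ` V)"
    using nn_integral_has_integral_lebesgue'[of V "\<lambda>x. \<bar>det (matrix (G' x))\<bar>"] by (simp add: mult.commute)
  moreover have "ennreal (measure lebesgue (G ` V)) = emeasure lebesgue (G ` V)"
    using lm by (simp add: emeasure_eq_measure2)
  moreover have "emeasure lebesgue (G ` V) = emeasure lborel (e -` (g ` B))"
    using GV \<open>G ` V \<in> sets borel\<close> by simp
  moreover have "emeasure lborel (g ` B) = emeasure lborel (e -` (g ` B))"
    by (subst lborel_complex_vec, subst emeasure_distr) (auto simp: e_def[symmetric])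
  moreover have "(\<integral>\<^sup>+x. indicator B x * ennreal ((cmod (d x))\<^sup>2) \<partial>lborel) =
    (\<integral>\<^sup>+v. indicator V v * ennreal ((cmod (d (e v)))\<^sup>2) \<partial>lborel)"
    unfolding V_def e_def by (subst nn_integral_complex_vec) (auto simp: indicator_def)
  ultimately show ?thesis by (simp add: det)
qed

text \<open>The formula for sets says that two measures agree on Borel sets; integrating against
  both of them gives the formula for functions.\<close>

lemma nn_integral_holomorphic_change_of_variables:
  fixes g :: "complex \<Rightarrow> complex" and F :: "complex \<Rightarrow> ennreal"
  assumes S: "open S" and hol: "g holomorphic_on S" and inj: "inj_on g S" and bdd: "bounded (g ` S)"
    and F[measurable]: "F \<in> borel_measurable borel"
  shows "(\<integral>\<^sup>+x\<in>g ` S. F x \<partial>lborel) =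
         (\<integral>\<^sup>+x\<in>S. F (g x) * ennreal ((cmod (deriv g x))\<^sup>2) \<partial>lborel)"
proof -
  have gS: "open (g ` S)" using open_mapping_thm3[OF hol S inj] .
  define g1 where "g1 = (\<lambda>x. if x \<in> S then g x else 0)"
  define d where "d = (\<lambda>x. if x \<in> S then deriv g x else 0)"
  have [measurable]: "S \<in> sets borel" "g ` S \<in> sets borel" using S gS by auto
  have g1[measurable]: "g1 \<in> borel_measurable borel" unfolding g1_def
    by (rule borel_measurable_continuous_on_if) (auto intro: holomorphic_on_imp_continuous_on[OF hol])
  have [measurable]: "d \<in> borel_measurable borel" unfolding d_def
    by (rule borel_measurable_continuous_on_if) (auto intro!: holomorphic_on_imp_continuous_on holomorphic_deriv hol S)
  have der: "(g has_field_derivative d x) (at x)" if "x \<in> S" for x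
    using holomorphic_derivI[OF hol S that] that by (simp add: d_def)
  have eq: "density lborel (indicator (g ` S)) =
     distr (density lborel (\<lambda>x. indicator S x * ennreal ((cmod (d x))\<^sup>2))) borel g1"
  proof (rule measure_eqI)
    fix A assume "A \<in> sets (density lborel (indicator (g ` S)))"
    then have A[measurable]: "A \<in> sets borel" by simp
    define B where "B = S \<inter> g1 -` A"
    have [measurable]: "B \<in> sets borel" unfolding B_def using measurable_sets[OF g1 A] by auto
    have gB: "g ` B = A \<inter> g ` S" by (auto simp: B_def g1_def)
    have "emeasure lborel (g ` B) = (\<integral>\<^sup>+x. indicator B x * ennreal ((cmod (d x))\<^sup>2) \<partial>lborel)"
      by (rule emeasure_holomorphic_image)
         (auto intro!: der inj_on_subset[OF inj] bounded_subset[OF bdd] simp: gB, auto simp: B_def)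
    moreover have "emeasure (density lborel (indicator (g ` S))) A = emeasure lborel (g ` B)"
      unfolding gB by (simp add: emeasure_density indicator_inter_arith[symmetric] Int_commute)
    moreover have [measurable]: "g1 -` A \<in> sets borel" using measurable_sets[OF g1 A] by simp
    moreover have "emeasure (distr (density lborel (\<lambda>x. indicator S x * ennreal ((cmod (d x))\<^sup>2))) borel g1) A =
       (\<integral>\<^sup>+x\<in>g1 -` A. indicator S x * ennreal ((cmod (d x))\<^sup>2) \<partial>lborel)"
      by (subst emeasure_distr) (auto simp: emeasure_density)
    moreover have "\<dots> = (\<integral>\<^sup>+x. indicator B x * ennreal ((cmod (d x))\<^sup>2) \<partial>lborel)"
      by (intro nn_integral_cong) (auto simp: B_def indicator_def)
    ultimately show "emeasure (density lborel (indicator (g ` S))) A =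
      emeasure (distr (density lborel (\<lambda>x. indicator S x * ennreal ((cmod (d x))\<^sup>2))) borel g1) A" by simp
  qed simp
  have "(\<integral>\<^sup>+x\<in>g ` S. F x \<partial>lborel) = (\<integral>\<^sup>+x. F x \<partial>density lborel (indicator (g ` S)))"
    by (subst nn_integral_density) (auto simp: mult.commute)
  also have "\<dots> = (\<integral>\<^sup>+x. indicator S x * ennreal ((cmod (d x))\<^sup>2) * F (g1 x) \<partial>lborel)"
    unfolding eq by (subst nn_integral_distr) (auto simp: nn_integral_density)
  also have "\<dots> = (\<integral>\<^sup>+x\<in>S. F (g x) * ennreal ((cmod (deriv g x))\<^sup>2) \<partial>lborel)"
    by (intro nn_integral_cong) (auto simp: d_def g1_def indicator_def mult.commute)
  finally show ?thesis .
qed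


lemma one_minus_cnj_mult_nonzero:
  fixes a x :: complex
  assumes "cmod a < 1" "cmod x < 1"
  shows "1 - cnj a * x \<noteq> 0"
proof
  assume "1 - cnj a * x = 0"
  then have "cmod (cnj a * x) = 1" by simp
  moreover have "cmod (cnj a * x) < 1" using mult_strict_mono[OF assms] by (simp add: norm_mult)
  ultimately show False by simp
qed

lemma Re_one_minus_cnj_mult_pos:
  fixes a x :: complex
  assumes "cmod a < 1" "cmod x < 1"
  shows "0 < Re (1 - cnj a * x)"
proof -
  have "Re (cnj a * x) \<le> cmod (cnj a * x)" by (rule complex_Re_le_cmod)
  also have "\<dots> < 1" using mult_strict_mono[OF assms] by (simp add: norm_mult)
  finally show ?thesis by simp
qed

lemma one_minus_norm_le_cmod:
  fixes a x :: complex
  assumes "cmod a \<le> 1"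
  shows "1 - cmod x \<le> cmod (1 - cnj a * x)"
proof -
  have "cmod (cnj a * x) \<le> 1 * cmod x" unfolding norm_mult using assms by (intro mult_right_mono) auto
  then show ?thesis using norm_triangle_ineq2[of 1 "cnj a * x"] by simp
qed

lemma one_minus_cmod_mobius:
  assumes "cmod a < 1" "cmod x < 1"
  shows "1 - (cmod (mobius a x))\<^sup>2 = (1 - (cmod a)\<^sup>2) * (1 - (cmod x)\<^sup>2) / (cmod (1 - cnj a * x))\<^sup>2"
proof -
  have nz: "cmod (1 - cnj a * x) \<noteq> 0" using one_minus_cnj_mult_nonzero[OF assms] by simp
  have "(cmod (1 - cnj a * x))\<^sup>2 - (cmod (a - x))\<^sup>2 = (1 - (cmod a)\<^sup>2) * (1 - (cmod x)\<^sup>2)"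
    unfolding cmod_power2 by (simp add: power2_eq_square algebra_simps)
  then show ?thesis using nz
    by (simp add: mobius_def norm_divide power_divide field_simps)
qed

lemma cmod_mobius_less_one:
  assumes "cmod a < 1" "cmod x < 1"
  shows "cmod (mobius a x) < 1"
proof -
  have "0 < (1 - (cmod a)\<^sup>2) * (1 - (cmod x)\<^sup>2) / (cmod (1 - cnj a * x))\<^sup>2"
    using assms one_minus_cnj_mult_nonzero[OF assms]
    by (intro divide_pos_pos mult_pos_pos) (auto simp: power_less_one_iff abs_square_less_1)
  then show ?thesis unfolding one_minus_cmod_mobius[OF assms, symmetric]
    by (simp add: abs_square_less_1)
qed

lemma one_minus_cnj_mult_mobius:
  assumes "cmod a < 1" "cmod x < 1"
  shows "1 - cnj a * mobius a x = of_real (1 - (cmod a)\<^sup>2) / (1 - cnj a * x)"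
proof -
  have nz: "1 - cnj a * x \<noteq> 0" using one_minus_cnj_mult_nonzero[OF assms] .
  have "of_real ((cmod a)\<^sup>2) = a * cnj a" by (simp only: complex_norm_square)
  then show ?thesis using nz by (simp add: mobius_def field_simps)
qed

lemma mobius_mobius:
  assumes "cmod a < 1" "cmod x < 1"
  shows "mobius a (mobius a x) = x"
proof -
  have nz: "1 - cnj a * x \<noteq> 0" using one_minus_cnj_mult_nonzero[OF assms] .
  have 0: "(cmod a)\<^sup>2 < 1" using assms by (simp add: abs_square_less_1)
  then have nz2: "1 - complex_of_real ((cmod a)\<^sup>2) \<noteq> 0" by (metis less_irrefl of_real_1 of_real_eq_iff right_minus_eq)
  have c: "of_real ((cmod a)\<^sup>2) = a * cnj a" by (simp only: complex_norm_square)
  have "a - mobius a x = x * (1 - of_real ((cmod a)\<^sup>2)) / (1 - cnj a * x)"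
    using nz unfolding c by (simp add: mobius_def field_simps)
  then show ?thesis
    unfolding mobius_def[of a "mobius a x"] one_minus_cnj_mult_mobius[OF assms]
    using nz nz2 by simp
qed

lemma mobius_has_field_derivative:
  assumes "cmod a < 1" "cmod x < 1"
  shows "(mobius a has_field_derivative - of_real (1 - (cmod a)\<^sup>2) / (1 - cnj a * x)\<^sup>2) (at x)"
proof -
  have nz: "1 - cnj a * x \<noteq> 0" using one_minus_cnj_mult_nonzero[OF assms] .
  have c: "of_real ((cmod a)\<^sup>2) = a * cnj a" by (simp only: complex_norm_square)
  have "((\<lambda>x. (a - x) / (1 - cnj a * x)) has_field_derivative - of_real (1 - (cmod a)\<^sup>2) / (1 - cnj a * x)\<^sup>2) (at x)"
    using nz
    apply (auto intro!: derivative_eq_intros)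
    apply (simp only: c[unfolded of_real_power])
    apply (simp add: power2_eq_square field_simps)
    done
  then show ?thesis by (simp add: mobius_def[abs_def])
qed

lemma deriv_mobius:
  assumes "cmod a < 1" "cmod x < 1"
  shows "deriv (mobius a) x = - of_real (1 - (cmod a)\<^sup>2) / (1 - cnj a * x)\<^sup>2"
  using mobius_has_field_derivative[OF assms] by (rule DERIV_imp_deriv)

lemma cmod_deriv_mobius:
  assumes "cmod a < 1" "cmod x < 1"
  shows "cmod (deriv (mobius a) x) = (1 - (cmod a)\<^sup>2) / (cmod (1 - cnj a * x))\<^sup>2"
proof -
  have "0 \<le> 1 - (cmod a)\<^sup>2" using assms by (simp add: abs_square_le_1)
  then have "cmod (of_real (1 - (cmod a)\<^sup>2)) = 1 - (cmod a)\<^sup>2" by (simp only: norm_of_real abs_of_nonneg)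
  then show ?thesis unfolding deriv_mobius[OF assms] norm_divide norm_minus_cancel norm_power by simp
qed

lemma mobius_image_disc:
  assumes "cmod a < 1"
  shows "mobius a ` ball 0 1 = ball 0 1"
proof -
  have "x \<in> mobius a ` ball 0 1" if "cmod x < 1" for x
    using mobius_mobius[OF assms that] cmod_mobius_less_one[OF assms that]
    by (metis image_eqI mem_ball_0)
  then show ?thesis using cmod_mobius_less_one[OF assms] by auto
qed

lemma mobius_holomorphic: 
  assumes "cmod a < 1" shows "mobius a holomorphic_on ball 0 1"
  using mobius_has_field_derivative[OF assms] by (intro holomorphic_onI) 
    (auto simp: field_differentiable_def intro: field_differentiable_at_within DERIV_subset)

text \<open>The Moebius transformation is an involution of the disc, and the Jacobian factor is the
  square of the modulus of its derivative.\<close>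

lemma nn_integral_mobius:
  assumes a: "cmod a < 1" and F: "F \<in> borel_measurable borel"
  shows "(\<integral>\<^sup>+x\<in>ball 0 1. F x \<partial>lborel) =
    (\<integral>\<^sup>+x\<in>ball 0 1. F (mobius a x) * ennreal ((1 - (cmod a)\<^sup>2)\<^sup>2 / (cmod (1 - cnj a * x)) ^ 4) \<partial>lborel)"
proof -
  have inj: "inj_on (mobius a) (ball 0 1)"
    by (rule inj_on_inverseI[of _ "mobius a"]) (use mobius_mobius[OF a] in auto)
  have "(\<integral>\<^sup>+x\<in>mobius a ` ball 0 1. F x \<partial>lborel) =
    (\<integral>\<^sup>+x\<in>ball 0 1. F (mobius a x) * ennreal ((cmod (deriv (mobius a) x))\<^sup>2) \<partial>lborel)"
    by (rule nn_integral_holomorphic_change_of_variables)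
       (auto simp: mobius_image_disc[OF a] F inj mobius_holomorphic[OF a])
  also have "\<dots> = (\<integral>\<^sup>+x\<in>ball 0 1. F (mobius a x) * ennreal ((1 - (cmod a)\<^sup>2)\<^sup>2 / (cmod (1 - cnj a * x)) ^ 4) \<partial>lborel)"
    by (intro nn_integral_cong) (auto simp: cmod_deriv_mobius[OF a] power_divide split: split_indicator simp flip: power_mult)
  finally show ?thesis unfolding mobius_image_disc[OF a] .
qed

lemma nn_integral_complex_scale:
  fixes m :: complex
  assumes m: "m \<noteq> 0" and F: "F \<in> borel_measurable borel"
  shows "(\<integral>\<^sup>+x\<in>ball 0 (cmod m * r). F x \<partial>lborel) =
    (\<integral>\<^sup>+x\<in>ball 0 r. F (m * x) * ennreal ((cmod m)\<^sup>2) \<partial>lborel)"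
proof -
  have im: "(*) m ` ball 0 r = ball 0 (cmod m * r)"
  proof (intro equalityI subsetI)
    fix x :: complex assume "x \<in> ball 0 (cmod m * r)"
    then have "x / m \<in> ball 0 r" using m by (simp add: norm_divide field_simps)
    moreover have "x = m * (x / m)" using m by simp
    ultimately show "x \<in> (*) m ` ball 0 r" by blast
  qed (use m in \<open>auto simp: norm_mult\<close>)
  have "deriv ((*) m) x = m" for x by (auto intro!: DERIV_imp_deriv derivative_eq_intros)
  moreover have "(\<integral>\<^sup>+x\<in>(*) m ` ball 0 r. F x \<partial>lborel) =
    (\<integral>\<^sup>+x\<in>ball 0 r. F (m * x) * ennreal ((cmod (deriv ((*) m) x))\<^sup>2) \<partial>lborel)"
    by (rule nn_integral_holomorphic_change_of_variables)
       (use m in \<open>auto simp: im F inj_on_def intro!: holomorphic_intros\<close>)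
  ultimately show ?thesis unfolding im by simp
qed

section \<open>The domain and its two families of maps\<close>

text \<open>This lemma and the next one make \<open>1 - x^\<gamma>\<close> comparable to \<open>1 - x\<close> on the unit interval. They
  replace \<open>1 - |x|^(2/\<alpha>)\<close> by \<open>1 - |x|\<^sup>2\<close> throughout.\<close>

lemma one_minus_powr_le:
  fixes x \<gamma> :: real
  assumes "0 \<le> x" "x \<le> 1" "0 < \<gamma>"
  shows "1 - x powr \<gamma> \<le> max 1 \<gamma> * (1 - x)"
proof (cases "\<gamma> \<le> 1")
  case True
  have "x powr 1 \<le> x powr \<gamma>" using assms True by (intro powr_mono') auto
  then show ?thesis using assms True by (simp add: max_def)
next
  case False
  show ?thesis
  proof (cases "x = 0")
    case True then show ?thesis using False by simp
  next
    case x: False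
    have "(x powr \<gamma>) powr (1/\<gamma>) * 1 powr (1 - 1/\<gamma>) \<le> 1/\<gamma> * (x powr \<gamma>) + (1 - 1/\<gamma>) * 1"
      by (rule Youngs_inequality_0) (use assms False x in auto)
    moreover have "(x powr \<gamma>) powr (1/\<gamma>) = x" using assms by (simp add: powr_powr)
    ultimately have "\<gamma> * x \<le> \<gamma> * (1/\<gamma> * (x powr \<gamma>) + (1 - 1/\<gamma>) * 1)"
      using False by (intro mult_left_mono) auto
    also have "\<dots> = x powr \<gamma> + \<gamma> - 1" using False by (simp add: algebra_simps)
    finally show ?thesis using False assms by (simp add: max_def algebra_simps)
  qed
qed

lemma one_minus_powr_ge:
  fixes x \<gamma> :: real
  assumes "0 \<le> x" "x \<le> 1" "0 < \<gamma>"
  shows "min 1 \<gamma> * (1 - x) \<le> 1 - x powr \<gamma>"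
proof (cases "\<gamma> \<le> 1")
  case False
  have "x powr \<gamma> \<le> x powr 1" using assms False by (intro powr_mono') auto
  then show ?thesis using assms False by (simp add: min_def)
next
  case True
  show ?thesis
  proof (cases "x = 0")
    case True then show ?thesis by simp
  next
    case x: False
    have "x powr \<gamma> * 1 powr (1 - \<gamma>) \<le> \<gamma> * x + (1 - \<gamma>) * 1"
      by (rule Youngs_inequality_0) (use assms True x in auto)
    then show ?thesis using True by (simp add: min_def algebra_simps)
  qed
qed

lemma powr_square: "0 \<le> x \<Longrightarrow> (x\<^sup>2) powr c = x powr (2 * c)" for x c :: real
  by (cases "x = 0") (simp_all add: powr_powr flip: powr_numeral)

lemma powr_less_one_iff:
  fixes x c :: real assumes "0 \<le> x" "0 < c" shows "x powr c < 1 \<longleftrightarrow> x < 1"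
  using powr_less_mono2[of c x 1] ge_one_powr_ge_zero[of x c] assms by force

text \<open>The domain is fibred over the unit disc in two ways. The disc maps respect the projection to the
  first coordinate, the automorphisms the projection to the second one.\<close>

lemma mem_U_dom_1:
  assumes "\<alpha> > 0"
  shows "(w1, w2) \<in> U_dom \<alpha> \<longleftrightarrow> cmod w1 < 1 \<and> cmod w2 < sqrt (1 - cmod w1 powr (2 / \<alpha>))"
proof -
  have 1: "cmod w1 powr (2/\<alpha>) < 1 \<longleftrightarrow> cmod w1 < 1"
    using assms by (intro powr_less_one_iff) auto
  have "(w1, w2) \<in> U_dom \<alpha> \<longleftrightarrow> (cmod w2)\<^sup>2 < 1 - cmod w1 powr (2 / \<alpha>)"
    by (auto simp: U_dom_def)
  also have "\<dots> \<longleftrightarrow> cmod w2 < sqrt (1 - cmod w1 powr (2 / \<alpha>))"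
    using real_sqrt_less_iff[of "(cmod w2)\<^sup>2" "1 - cmod w1 powr (2 / \<alpha>)"] by (simp del: real_sqrt_less_iff)
  finally show ?thesis
    using 1 real_sqrt_gt_0_iff[of "1 - cmod w1 powr (2 / \<alpha>)"] norm_ge_zero[of w2] by linarith
qed

lemma mem_U_dom_2:
  assumes "\<alpha> > 0"
  shows "(w1, w2) \<in> U_dom \<alpha> \<longleftrightarrow> cmod w2 < 1 \<and> cmod w1 < (1 - (cmod w2)\<^sup>2) powr (\<alpha>/2)"
proof -
  have 0: "(cmod w2)\<^sup>2 < 1 \<longleftrightarrow> cmod w2 < 1" by (simp add: abs_square_less_1)
  have 1: "(w1, w2) \<in> U_dom \<alpha> \<longleftrightarrow> cmod w1 powr (2 / \<alpha>) < 1 - (cmod w2)\<^sup>2"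
    by (auto simp: U_dom_def)
  have e: "(cmod w1 powr (2 / \<alpha>)) powr (\<alpha> / 2) = cmod w1" using assms by (simp add: powr_powr)
  have e2: "((1 - (cmod w2)\<^sup>2) powr (\<alpha> / 2)) powr (2 / \<alpha>) = 1 - (cmod w2)\<^sup>2" if "cmod w2 < 1"
    using assms that 0 by (simp add: powr_powr)
  show ?thesis
  proof (cases "cmod w2 < 1")
    case True
    have "cmod w1 powr (2 / \<alpha>) < 1 - (cmod w2)\<^sup>2 \<longleftrightarrow> cmod w1 < (1 - (cmod w2)\<^sup>2) powr (\<alpha>/2)"
      using powr_less_mono2[of "\<alpha>/2" "cmod w1 powr (2 / \<alpha>)" "1 - (cmod w2)\<^sup>2"]
        powr_less_mono2[of "2/\<alpha>" "cmod w1" "(1 - (cmod w2)\<^sup>2) powr (\<alpha>/2)"] assms e e2[OF True]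
      by auto
    then show ?thesis using 1 True by simp
  next
    case False
    then have "\<not> cmod w1 powr (2 / \<alpha>) < 1 - (cmod w2)\<^sup>2" using 0 
      by (smt (verit) powr_ge_zero)
    then show ?thesis using 1 False by simp
  qed
qed

lemma U_dom_bounds:
  assumes "\<alpha> > 0" "w \<in> U_dom \<alpha>"
  shows "cmod (fst w) < 1" "cmod (snd w) < 1"
  using assms mem_U_dom_1[of \<alpha> "fst w" "snd w"] mem_U_dom_2[of \<alpha> "fst w" "snd w"] by auto

lemma open_U_dom: assumes "\<alpha> > 0" shows "open (U_dom \<alpha>)"
proof -
  have "U_dom \<alpha> = {z. cmod (fst z) powr (2 / \<alpha>) + (cmod (snd z))\<^sup>2 < 1}"
    by (auto simp: U_dom_def)
  moreover have "continuous_on UNIV (\<lambda>z::c2. cmod (fst z) powr (2 / \<alpha>))"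
    using assms by (intro continuous_on_powr' continuous_intros) auto
  ultimately show ?thesis by (auto intro!: open_Collect_less continuous_intros)
qed

lemma U_dom_borel[measurable]: "\<alpha> > 0 \<Longrightarrow> U_dom \<alpha> \<in> sets borel"
  by (rule borel_open[OF open_U_dom])

lemma nn_integral_U_dom_1:
  fixes F :: "c2 \<Rightarrow> ennreal"
  assumes a: "\<alpha> > 0" and F[measurable]: "F \<in> borel_measurable borel"
  shows "(\<integral>\<^sup>+w\<in>U_dom \<alpha>. F w \<partial>lborel) =
    (\<integral>\<^sup>+w1. (\<integral>\<^sup>+w2\<in>ball 0 (sqrt (1 - cmod w1 powr (2/\<alpha>))). F (w1, w2) \<partial>lborel) *
       indicator (ball 0 1) w1 \<partial>lborel)"
proof -
  have m: "(\<lambda>w. F w * indicator (U_dom \<alpha>) w) \<in> borel_measurable (lborel \<Otimes>\<^sub>M lborel)"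
    unfolding lborel_prod using a by simp
  have "(\<integral>\<^sup>+w\<in>U_dom \<alpha>. F w \<partial>lborel) =
     (\<integral>\<^sup>+w1. (\<integral>\<^sup>+w2. F (w1, w2) * indicator (U_dom \<alpha>) (w1, w2) \<partial>lborel) \<partial>lborel)"
    unfolding lborel_prod[symmetric] by (rule lborel.nn_integral_fst[OF m, symmetric])
  also have "\<dots> = (\<integral>\<^sup>+w1. (\<integral>\<^sup>+w2\<in>ball 0 (sqrt (1 - cmod w1 powr (2/\<alpha>))). F (w1, w2) \<partial>lborel) *
       indicator (ball 0 1) w1 \<partial>lborel)"
  proof (intro nn_integral_cong)
    fix w1 :: complex
    show "(\<integral>\<^sup>+w2. F (w1, w2) * indicator (U_dom \<alpha>) (w1, w2) \<partial>lborel) =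
      (\<integral>\<^sup>+w2\<in>ball 0 (sqrt (1 - cmod w1 powr (2/\<alpha>))). F (w1, w2) \<partial>lborel) *
       indicator (ball 0 1) w1"
      by (cases "cmod w1 < 1") (auto intro!: nn_integral_cong simp: mem_U_dom_1[OF a] nn_integral_0_iff_AE split: split_indicator)
  qed
  finally show ?thesis .
qed

lemma nn_integral_U_dom_2:
  fixes F :: "c2 \<Rightarrow> ennreal"
  assumes a: "\<alpha> > 0" and F[measurable]: "F \<in> borel_measurable borel"
  shows "(\<integral>\<^sup>+w\<in>U_dom \<alpha>. F w \<partial>lborel) =
    (\<integral>\<^sup>+w2. (\<integral>\<^sup>+w1. F (w1, w2) * indicator (ball 0 ((1 - (cmod w2)\<^sup>2) powr (\<alpha>/2))) w1 \<partial>lborel) *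
       indicator (ball 0 1) w2 \<partial>lborel)"
proof -
  have m: "(\<lambda>w. F w * indicator (U_dom \<alpha>) w) \<in> borel_measurable (lborel \<Otimes>\<^sub>M lborel)"
    unfolding lborel_prod using a by simp
  have m2: "(\<lambda>(w1,w2). F (w1,w2) * indicator (U_dom \<alpha>) (w1,w2)) \<in> borel_measurable (lborel \<Otimes>\<^sub>M lborel)"
    using m by (simp add: case_prod_beta)
  have "(\<integral>\<^sup>+w\<in>U_dom \<alpha>. F w \<partial>lborel) =
     (\<integral>\<^sup>+w2. (\<integral>\<^sup>+w1. F (w1, w2) * indicator (U_dom \<alpha>) (w1, w2) \<partial>lborel) \<partial>lborel)"
    unfolding lborel_prod[symmetric] using lborel_pair.nn_integral_snd[OF m2] by (simp add: case_prod_unfold)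
  also have "\<dots> = (\<integral>\<^sup>+w2. (\<integral>\<^sup>+w1. F (w1, w2) * indicator (ball 0 ((1 - (cmod w2)\<^sup>2) powr (\<alpha>/2))) w1 \<partial>lborel) *
       indicator (ball 0 1) w2 \<partial>lborel)"
  proof (intro nn_integral_cong)
    fix w2 :: complex
    show "(\<integral>\<^sup>+w1. F (w1, w2) * indicator (U_dom \<alpha>) (w1, w2) \<partial>lborel) =
      (\<integral>\<^sup>+w1. F (w1, w2) * indicator (ball 0 ((1 - (cmod w2)\<^sup>2) powr (\<alpha>/2))) w1 \<partial>lborel) *
       indicator (ball 0 1) w2"
      by (cases "cmod w2 < 1") (auto intro!: nn_integral_cong simp: mem_U_dom_2[OF a] nn_integral_0_iff_AE split: split_indicator)
  qed
  finally show ?thesis .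
qed

text \<open>For a complex differentiable function the two real partial derivatives are \<open>d\<close> and \<open>\<i> d\<close>.\<close>

lemma wirtinger_deriv_eq:
  assumes "(g has_field_derivative d) (at z)"
  shows "wirtinger_deriv g z = d"
proof -
  have *: "vector_derivative (\<lambda>t::real. g (z + c * of_real t)) (at 0) = c * d" for c
  proof (rule vector_derivative_at)
    have "((\<lambda>t::real. z + c * of_real t) has_vector_derivative c) (at 0)"
      by (auto intro!: derivative_eq_intros simp: has_vector_derivative_def scaleR_conv_of_real mult.commute)
    from field_vector_diff_chain_at[OF this, of g d] assms
    show "((\<lambda>t::real. g (z + c * of_real t)) has_vector_derivative c * d) (at 0)"
      by (simp add: o_def)
  qed
  from *[of 1] *[of \<i>] show ?thesis unfolding wirtinger_deriv_def by simp
qed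

text \<open>Both maps of the domain apply a Moebius transformation to one coordinate and multiply the other
  one by a number depending on the former. These are the multipliers.\<close>

definition disc_factor :: "real \<Rightarrow> complex \<Rightarrow> complex \<Rightarrow> complex" where
  "disc_factor \<alpha> a x = (of_real (sqrt (1 - (cmod a)\<^sup>2)) / (1 - cnj a * x)) *
       of_real (sqrt (((1 - (cmod x)\<^sup>2) * (1 - cmod (mobius a x) powr (2 / \<alpha>))) /
         ((1 - cmod x powr (2 / \<alpha>)) * (1 - (cmod (mobius a x))\<^sup>2))))"

definition aut_factor :: "real \<Rightarrow> complex \<Rightarrow> complex \<Rightarrow> complex" where
  "aut_factor \<alpha> b y = (of_real (sqrt (1 - (cmod b)\<^sup>2)) / (1 - cnj b * y)) powr of_real \<alpha>"

lemma disc_map_eq: "disc_map \<alpha> a w = (mobius a (fst w), disc_factor \<alpha> a (fst w) * snd w)"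
  by (simp add: disc_map_def disc_factor_def)

lemma aut_map_eq: "aut_map \<alpha> b w = (aut_factor \<alpha> b (snd w) * fst w, mobius b (snd w))"
  by (simp add: aut_map_def aut_factor_def mobius_def)

text \<open>The first component depends on \<open>w\<^sub>1\<close> alone, so the Jacobian is the product of the diagonal
  entries; the other product vanishes whatever the Wirtinger derivative of the non-holomorphic
  multiplier is.\<close>

lemma jacobian_disc_map:
  assumes "cmod a < 1" "cmod (fst w) < 1"
  shows "jacobian (disc_map \<alpha> a) w = deriv (mobius a) (fst w) * disc_factor \<alpha> a (fst w)"
proof -
  have "wirtinger_deriv (mobius a) (fst w) = deriv (mobius a) (fst w)"
    using wirtinger_deriv_eq[OF mobius_has_field_derivative[OF assms]] deriv_mobius[OF assms] by simp
  moreover have "wirtinger_deriv (\<lambda>y. c * y) z = c" for c z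
    by (rule wirtinger_deriv_eq) (auto intro!: derivative_eq_intros)
  moreover have "wirtinger_deriv (\<lambda>y. c) z = 0" for c z
    by (rule wirtinger_deriv_eq) (auto intro!: derivative_eq_intros)
  ultimately show ?thesis unfolding jacobian_def disc_map_eq by simp
qed

lemma jacobian_aut_map:
  assumes "cmod b < 1" "cmod (snd w) < 1"
  shows "jacobian (aut_map \<alpha> b) w = aut_factor \<alpha> b (snd w) * deriv (mobius b) (snd w)"
proof -
  have "wirtinger_deriv (mobius b) (snd w) = deriv (mobius b) (snd w)"
    using wirtinger_deriv_eq[OF mobius_has_field_derivative[OF assms]] deriv_mobius[OF assms] by simp
  moreover have "wirtinger_deriv (\<lambda>y. c * y) z = c" for c z
    by (rule wirtinger_deriv_eq) (auto intro!: derivative_eq_intros)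
  moreover have "wirtinger_deriv (\<lambda>y. c) z = 0" for c z
    by (rule wirtinger_deriv_eq) (auto intro!: derivative_eq_intros)
  ultimately show ?thesis unfolding jacobian_def aut_map_eq by simp
qed

lemma cmod_aut_factor:
  assumes "cmod b < 1" "cmod y < 1"
  shows "cmod (aut_factor \<alpha> b y) = (1 - (cmod b)\<^sup>2) powr (\<alpha>/2) / cmod (1 - cnj b * y) powr \<alpha>"
proof -
  have pos: "0 < 1 - (cmod b)\<^sup>2" using assms by (simp add: abs_square_less_1)
  have nz: "1 - cnj b * y \<noteq> 0" using one_minus_cnj_mult_nonzero[OF assms] .
  have "cmod (aut_factor \<alpha> b y) = cmod (of_real (sqrt (1 - (cmod b)\<^sup>2)) / (1 - cnj b * y)) powr \<alpha>"
    unfolding aut_factor_def by (subst norm_powr_real_powr') (auto simp: Reals_of_real)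
  also have "\<dots> = (sqrt (1 - (cmod b)\<^sup>2) / cmod (1 - cnj b * y)) powr \<alpha>"
    using pos by (simp add: norm_divide del: of_real_diff)
  also have "\<dots> = (1 - (cmod b)\<^sup>2) powr (\<alpha>/2) / cmod (1 - cnj b * y) powr \<alpha>"
    using pos by (simp add: powr_divide powr_half_sqrt[symmetric] powr_powr)
  finally show ?thesis .
qed

text \<open>The multiplier maps the fibre over \<open>y\<close> onto the fibre over the image of \<open>y\<close>.\<close>

lemma cmod_aut_factor_radius:
  assumes "cmod b < 1" "cmod y < 1"
  shows "cmod (aut_factor \<alpha> b y) * (1 - (cmod y)\<^sup>2) powr (\<alpha>/2) = (1 - (cmod (mobius b y))\<^sup>2) powr (\<alpha>/2)"
proof -
  have pos: "0 < 1 - (cmod b)\<^sup>2" "0 < 1 - (cmod y)\<^sup>2" using assms by (simp_all add: abs_square_less_1)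
  have "cmod (1 - cnj b * y) > 0" using one_minus_cnj_mult_nonzero[OF assms] by simp
  then show ?thesis unfolding cmod_aut_factor[OF assms] one_minus_cmod_mobius[OF assms] using pos
    by (simp add: powr_divide powr_mult powr_square)
qed

text \<open>The square root in the disc map is chosen to make this true: it scales the fibre over \<open>x\<close>
  onto the fibre over the image of \<open>x\<close>.\<close>

lemma cmod_disc_factor_radius:
  assumes "\<alpha> > 0" "cmod a < 1" "cmod x < 1"
  shows "cmod (disc_factor \<alpha> a x) * sqrt (1 - cmod x powr (2/\<alpha>)) = sqrt (1 - cmod (mobius a x) powr (2/\<alpha>))"
    and "disc_factor \<alpha> a x \<noteq> 0"
proof -
  define A where "A = 1 - (cmod a)\<^sup>2"
  define X where "X = 1 - (cmod x)\<^sup>2"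
  define N where "N = cmod (1 - cnj a * x)"
  define P where "P = 1 - cmod (mobius a x) powr (2 / \<alpha>)"
  define Q where "Q = 1 - cmod x powr (2 / \<alpha>)"
  have pos: "0 < A" "0 < X" using assms by (simp_all add: abs_square_less_1 A_def X_def)
  have N: "N > 0" using one_minus_cnj_mult_nonzero[OF assms(2,3)] by (simp add: N_def)
  have PQ: "P > 0" "Q > 0" unfolding P_def Q_def
    using powr_less_one_iff[of "cmod x" "2/\<alpha>"] powr_less_one_iff[of "cmod (mobius a x)" "2/\<alpha>"] assms
      cmod_mobius_less_one[of a x] by auto
  have "cmod (disc_factor \<alpha> a x) = sqrt A / N * sqrt (X * P / (Q * (A * X / N\<^sup>2)))"
    unfolding disc_factor_def one_minus_cmod_mobius[OF assms(2,3)] norm_mult norm_divide norm_of_real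
      A_def[symmetric] X_def[symmetric] N_def[symmetric] P_def[symmetric] Q_def[symmetric]
    using pos PQ N by simp
  also have "\<dots> = sqrt (P / Q)"
    using pos PQ N by (simp add: real_sqrt_mult real_sqrt_divide)
  finally have *: "cmod (disc_factor \<alpha> a x) = sqrt (P / Q)" .
  show "cmod (disc_factor \<alpha> a x) * sqrt (1 - cmod x powr (2/\<alpha>)) = sqrt (1 - cmod (mobius a x) powr (2/\<alpha>))"
    unfolding * P_def[symmetric] Q_def[symmetric] using PQ by (simp add: real_sqrt_divide)
  show "disc_factor \<alpha> a x \<noteq> 0" using * PQ by auto
qed

lemma cmod_jacobian_aut_map:
  assumes "cmod b < 1" "cmod (snd w) < 1"
  shows "cmod (jacobian (aut_map \<alpha> b) w) = (1 - (cmod b)\<^sup>2) powr (1 + \<alpha>/2) / cmod (1 - cnj b * snd w) powr (2 + \<alpha>)"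
proof -
  have pos: "0 < 1 - (cmod b)\<^sup>2" using assms by (simp add: abs_square_less_1)
  have "cmod (1 - cnj b * snd w) > 0" using one_minus_cnj_mult_nonzero[OF assms] by simp
  then show ?thesis using pos
    unfolding jacobian_aut_map[OF assms] norm_mult cmod_aut_factor[OF assms] cmod_deriv_mobius[OF assms]
    by (simp add: powr_add mult.commute)
qed

lemma mobius_measurable[measurable]: "mobius a \<in> borel_measurable borel"
  unfolding mobius_def[abs_def] by simp

text \<open>A Moebius transformation in the base and, over each point, a multiplication that maps fibre
  onto fibre. By Tonelli's theorem only the two planar substitution rules are needed, and the
  dependence of the multiplier \<open>c\<close> on \<open>x\<close> may be merely measurable.\<close>

lemma nn_integral_skew_mobius:
  fixes F :: "complex \<Rightarrow> complex \<Rightarrow> ennreal" and R :: "complex \<Rightarrow> real"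
  assumes a: "cmod a < 1"
    and F[measurable]: "(\<lambda>w. F (fst w) (snd w)) \<in> borel_measurable (borel \<Otimes>\<^sub>M borel)"
    and [measurable]: "R \<in> borel_measurable borel"
    and c0: "\<And>x. cmod x < 1 \<Longrightarrow> c x \<noteq> 0"
    and cR: "\<And>x. cmod x < 1 \<Longrightarrow> cmod (c x) * R x = R (mobius a x)"
  shows "(\<integral>\<^sup>+x\<in>ball 0 1. (\<integral>\<^sup>+y\<in>ball 0 (R x). F x y \<partial>lborel) \<partial>lborel) =
    (\<integral>\<^sup>+x. (\<integral>\<^sup>+y\<in>ball 0 (R x). F (mobius a x) (c x * y) * ennreal ((cmod (c x))\<^sup>2 * (cmod (deriv (mobius a) x))\<^sup>2) \<partial>lborel) *
       indicator (ball 0 1) x \<partial>lborel)"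
proof -
  define G where "G = (\<lambda>x. \<integral>\<^sup>+y. F x y * indicator (ball 0 (R x)) y \<partial>lborel)"
  have Fx[measurable]: "F x \<in> borel_measurable borel" for x
    using measurable_compose[OF measurable_Pair1' F, of x] by simp
  have "G \<in> borel_measurable borel"
    unfolding G_def ball_def dist_norm mem_Collect_eq indicator_def by measurable
  then have "(\<integral>\<^sup>+x\<in>ball 0 1. G x \<partial>lborel) =
      (\<integral>\<^sup>+x\<in>ball 0 1. G (mobius a x) * ennreal ((1 - (cmod a)\<^sup>2)\<^sup>2 / (cmod (1 - cnj a * x)) ^ 4) \<partial>lborel)"
    by (rule nn_integral_mobius[OF a])
  also have "\<dots> = (\<integral>\<^sup>+x. (\<integral>\<^sup>+y\<in>ball 0 (R x). F (mobius a x) (c x * y) * ennreal ((cmod (c x))\<^sup>2 * (cmod (deriv (mobius a) x))\<^sup>2) \<partial>lborel) *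
       indicator (ball 0 1) x \<partial>lborel)"
  proof (intro nn_integral_cong)
    fix x :: complex
    let ?d = "ennreal ((1 - (cmod a)\<^sup>2)\<^sup>2 / (cmod (1 - cnj a * x)) ^ 4)"
    show "G (mobius a x) * ?d * indicator (ball 0 1) x =
      (\<integral>\<^sup>+y\<in>ball 0 (R x). F (mobius a x) (c x * y) * ennreal ((cmod (c x))\<^sup>2 * (cmod (deriv (mobius a) x))\<^sup>2) \<partial>lborel) *
        indicator (ball 0 1) x"
    proof (cases "cmod x < 1")
      case x: True
      have d: "ennreal ((cmod (c x))\<^sup>2 * (cmod (deriv (mobius a) x))\<^sup>2) = ennreal ((cmod (c x))\<^sup>2) * ?d"
        by (simp add: cmod_deriv_mobius[OF a x] power_divide flip: ennreal_mult power_mult)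
      have "G (mobius a x) = (\<integral>\<^sup>+y\<in>ball 0 (R x). F (mobius a x) (c x * y) * ennreal ((cmod (c x))\<^sup>2) \<partial>lborel)"
        unfolding G_def cR[OF x, symmetric] by (rule nn_integral_complex_scale[OF c0[OF x] Fx])
      moreover have "(\<integral>\<^sup>+y\<in>ball 0 (R x). F (mobius a x) (c x * y) * ennreal ((cmod (c x))\<^sup>2) \<partial>lborel) * ?d =
        (\<integral>\<^sup>+y. F (mobius a x) (c x * y) * ennreal ((cmod (c x))\<^sup>2) * indicator (ball 0 (R x)) y * ?d \<partial>lborel)"
        by (rule nn_integral_multc[symmetric]) (measurable, simp add: borel_open)
      ultimately show ?thesis unfolding d by (simp add: mult_ac)
    qed simp
  qed
  finally show ?thesis unfolding G_def .
qed

lemma aut_map_measurable[measurable]: "aut_map \<alpha> b \<in> borel_measurable borel"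
  and aut_factor_measurable[measurable]: "aut_factor \<alpha> b \<in> borel_measurable borel"
proof -
  show [measurable]: "aut_factor \<alpha> b \<in> borel_measurable borel"
    unfolding aut_factor_def[abs_def] by measurable
  show "aut_map \<alpha> b \<in> borel_measurable borel"
    unfolding aut_map_eq[abs_def] borel_prod[symmetric] by measurable
qed

lemma disc_map_measurable[measurable]: "disc_map \<alpha> a \<in> borel_measurable borel"
  and disc_factor_measurable[measurable]: "disc_factor \<alpha> a \<in> borel_measurable borel"
proof -
  show [measurable]: "disc_factor \<alpha> a \<in> borel_measurable borel"
    unfolding disc_factor_def[abs_def] by measurable
  show "disc_map \<alpha> a \<in> borel_measurable borel"
    unfolding disc_map_eq[abs_def] borel_prod[symmetric] by measurable
qed

lemma nn_integral_aut_map: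
  fixes F :: "c2 \<Rightarrow> ennreal"
  assumes \<alpha>: "\<alpha> > 0" and b: "cmod b < 1" and F[measurable]: "F \<in> borel_measurable borel"
  shows "(\<integral>\<^sup>+w\<in>U_dom \<alpha>. F w \<partial>lborel) =
    (\<integral>\<^sup>+w\<in>U_dom \<alpha>. F (aut_map \<alpha> b w) * ennreal ((cmod (jacobian (aut_map \<alpha> b) w))\<^sup>2) \<partial>lborel)"
proof -
  define R where "R = (\<lambda>y. (1 - (cmod y)\<^sup>2) powr (\<alpha>/2))"
  define J where "J = (\<lambda>w::c2. (cmod (aut_factor \<alpha> b (snd w)))\<^sup>2 * ((1 - (cmod b)\<^sup>2) / (cmod (1 - cnj b * snd w))\<^sup>2)\<^sup>2)"
  have mF: "F \<in> borel_measurable (borel \<Otimes>\<^sub>M borel)" unfolding borel_prod by measurable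
  have "J \<in> borel_measurable borel" unfolding J_def borel_prod[symmetric] by measurable
  note mJ = measurable_compose[OF this measurable_ennreal]
  have J: "J (x, y) = (cmod (aut_factor \<alpha> b y))\<^sup>2 * (cmod (deriv (mobius b) y))\<^sup>2" if "cmod y < 1" for x y
    using that by (simp add: J_def cmod_deriv_mobius[OF b])
  have "(\<integral>\<^sup>+w\<in>U_dom \<alpha>. F w \<partial>lborel) =
    (\<integral>\<^sup>+y\<in>ball 0 1. (\<integral>\<^sup>+x\<in>ball 0 (R y). F (x, y) \<partial>lborel) \<partial>lborel)"
    unfolding R_def by (rule nn_integral_U_dom_2[OF \<alpha> F])
  also have "\<dots> = (\<integral>\<^sup>+y. (\<integral>\<^sup>+x\<in>ball 0 (R y). F (aut_factor \<alpha> b y * x, mobius b y) * ennreal ((cmod (aut_factor \<alpha> b y))\<^sup>2 * (cmod (deriv (mobius b) y))\<^sup>2) \<partial>lborel) *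
       indicator (ball 0 1) y \<partial>lborel)"
  proof (rule nn_integral_skew_mobius[OF b, of "\<lambda>y x. F (x, y)"])
    show "(\<lambda>w. F (snd w, fst w)) \<in> borel_measurable (borel \<Otimes>\<^sub>M borel)"
      using measurable_pair_swap[OF mF] by (simp add: case_prod_unfold)
    show "aut_factor \<alpha> b y \<noteq> 0" if "cmod y < 1" for y
      using one_minus_cnj_mult_nonzero[OF b that] b by (auto simp: aut_factor_def abs_square_eq_1)
    show "cmod (aut_factor \<alpha> b y) * R y = R (mobius b y)" if "cmod y < 1" for y
      unfolding R_def by (rule cmod_aut_factor_radius[OF b that])
  qed (simp add: R_def)
  also have "\<dots> = (\<integral>\<^sup>+y\<in>ball 0 1. (\<integral>\<^sup>+x\<in>ball 0 (R y). F (aut_map \<alpha> b (x, y)) * ennreal (J (x, y)) \<partial>lborel) \<partial>lborel)"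
    by (intro nn_integral_cong) (auto simp: aut_map_eq J split: split_indicator)
  also have "\<dots> = (\<integral>\<^sup>+w\<in>U_dom \<alpha>. (F (aut_map \<alpha> b w) * ennreal (J w)) \<partial>lborel)"
    unfolding R_def by (intro nn_integral_U_dom_2[OF \<alpha>, symmetric] borel_measurable_times_ennreal mJ) measurable
  also have "\<dots> = (\<integral>\<^sup>+w\<in>U_dom \<alpha>. F (aut_map \<alpha> b w) * ennreal ((cmod (jacobian (aut_map \<alpha> b) w))\<^sup>2) \<partial>lborel)"
    by (intro nn_integral_cong) (use U_dom_bounds[OF \<alpha>] in \<open>auto simp: J_def jacobian_aut_map[OF b] norm_mult power_mult_distrib power_divide mult_ac cmod_deriv_mobius[OF b] split: split_indicator\<close>)
  finally show ?thesis .
qed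

lemma nn_integral_disc_map:
  fixes F :: "c2 \<Rightarrow> ennreal"
  assumes \<alpha>: "\<alpha> > 0" and a: "cmod a < 1" and F[measurable]: "F \<in> borel_measurable borel"
  shows "(\<integral>\<^sup>+w\<in>U_dom \<alpha>. F w \<partial>lborel) =
    (\<integral>\<^sup>+w\<in>U_dom \<alpha>. F (disc_map \<alpha> a w) * ennreal ((cmod (jacobian (disc_map \<alpha> a) w))\<^sup>2) \<partial>lborel)"
proof -
  define R where "R = (\<lambda>x. sqrt (1 - cmod x powr (2/\<alpha>)))"
  define J where "J = (\<lambda>w::c2. (cmod (disc_factor \<alpha> a (fst w)))\<^sup>2 * ((1 - (cmod a)\<^sup>2) / (cmod (1 - cnj a * fst w))\<^sup>2)\<^sup>2)"
  have mF: "F \<in> borel_measurable (borel \<Otimes>\<^sub>M borel)" unfolding borel_prod by measurable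
  have "J \<in> borel_measurable borel" unfolding J_def borel_prod[symmetric] by measurable
  note mJ = measurable_compose[OF this measurable_ennreal]
  have J: "J (x, y) = (cmod (disc_factor \<alpha> a x))\<^sup>2 * (cmod (deriv (mobius a) x))\<^sup>2" if "cmod x < 1" for x y
    using that by (simp add: J_def cmod_deriv_mobius[OF a])
  have "(\<integral>\<^sup>+w\<in>U_dom \<alpha>. F w \<partial>lborel) =
    (\<integral>\<^sup>+x\<in>ball 0 1. (\<integral>\<^sup>+y\<in>ball 0 (R x). F (x, y) \<partial>lborel) \<partial>lborel)"
    unfolding R_def by (rule nn_integral_U_dom_1[OF \<alpha> F])
  also have "\<dots> = (\<integral>\<^sup>+x. (\<integral>\<^sup>+y\<in>ball 0 (R x). F (mobius a x, disc_factor \<alpha> a x * y) * ennreal ((cmod (disc_factor \<alpha> a x))\<^sup>2 * (cmod (deriv (mobius a) x))\<^sup>2) \<partial>lborel) *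
       indicator (ball 0 1) x \<partial>lborel)"
    by (rule nn_integral_skew_mobius[OF a, of "\<lambda>x y. F (x, y)"])
       (use mF cmod_disc_factor_radius[OF \<alpha> a] in \<open>auto simp: R_def\<close>)
  also have "\<dots> = (\<integral>\<^sup>+x\<in>ball 0 1. (\<integral>\<^sup>+y\<in>ball 0 (R x). F (disc_map \<alpha> a (x, y)) * ennreal (J (x, y)) \<partial>lborel) \<partial>lborel)"
    by (intro nn_integral_cong) (auto simp: disc_map_eq J split: split_indicator)
  also have "\<dots> = (\<integral>\<^sup>+w\<in>U_dom \<alpha>. (F (disc_map \<alpha> a w) * ennreal (J w)) \<partial>lborel)"
    unfolding R_def by (intro nn_integral_U_dom_1[OF \<alpha>, symmetric] borel_measurable_times_ennreal mJ) measurable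
  also have "\<dots> = (\<integral>\<^sup>+w\<in>U_dom \<alpha>. F (disc_map \<alpha> a w) * ennreal ((cmod (jacobian (disc_map \<alpha> a) w))\<^sup>2) \<partial>lborel)"
    by (intro nn_integral_cong) (use U_dom_bounds[OF \<alpha>] in \<open>auto simp: J_def jacobian_disc_map[OF a] norm_mult power_mult_distrib power_divide mult_ac cmod_deriv_mobius[OF a] split: split_indicator\<close>)
  finally show ?thesis .
qed

section \<open>Point evaluations on the Bergman space\<close>

text \<open>Cauchy's formula on the circle through \<open>x\<close>, parametrised so that it starts at \<open>x\<close>: this is the
  unit circle for the function \<open>u \<mapsto> F(u x)\<close>.\<close>

lemma cmod_center_le_circle_mean:
  assumes F: "F holomorphic_on ball 0 r" and x: "x \<in> ball 0 r"
  shows "ennreal (cmod (F 0)) \<le> (\<integral>\<^sup>+t\<in>{0..1::real}. ennreal (cmod (F (exp (2 * of_real pi * \<i> * of_real t) * x))) \<partial>lborel)"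
proof -
  define e where "e = (\<lambda>t::real. exp (2 * of_real pi * \<i> * of_real t))"
  have ne: "cmod (e t) = 1" for t by (simp add: e_def)
  have ne0: "e t \<noteq> 0" for t by (simp add: e_def)
  have cp: "circlepath 0 1 t = e t" for t by (simp add: circlepath e_def)
  have vd: "vector_derivative (circlepath 0 1) (at t within {0..1}) = 2 * of_real pi * \<i> * e t" if "t \<in> {0..1}" for t
    using that vector_derivative_circlepath01[of t 0 1] by (simp add: e_def)
  have sub: "cball 0 1 \<subseteq> (\<lambda>u. u * x) -` ball 0 r"
  proof
    fix u :: complex assume "u \<in> cball 0 1"
    then have "cmod (u * x) \<le> 1 * cmod x" unfolding norm_mult by (intro mult_right_mono) auto
    then show "u \<in> (\<lambda>u. u * x) -` ball 0 r" using x by simp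
  qed
  have "(F \<circ> (\<lambda>u. u * x)) holomorphic_on cball 0 1"
    by (rule holomorphic_on_compose_gen[OF _ F]) (use sub in \<open>auto intro!: holomorphic_intros\<close>)
  then have "((\<lambda>u. (F \<circ> (\<lambda>u. u * x)) u/(u-0)) has_contour_integral (2 * of_real pi * \<i> * (F \<circ> (\<lambda>u. u * x)) 0)) (circlepath 0 1)"
    by (intro Cauchy_integral_circlepath_simple) (auto simp del: o_apply)
  then have "((\<lambda>t. (2 * of_real pi * \<i>) * F (e t * x)) has_integral (2 * of_real pi * \<i> * F (0 * x))) {0..1}"
    unfolding has_contour_integral_def o_def
    by (rule has_integral_eq[rotated]) (simp add: vd cp ne0)
  then have "((\<lambda>t. inverse (2 * of_real pi * \<i>) * ((2 * of_real pi * \<i>) * F (e t * x))) has_integral inverse (2 * of_real pi * \<i>) * (2 * of_real pi * \<i> * F (0 * x))) {0..1}"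
    by (rule has_integral_mult_right)
  then have I: "((\<lambda>t. F (e t * x)) has_integral F 0) {0..1}" by (simp add: field_simps)
  have cF: "continuous_on {0..1} (\<lambda>t. F (e t * x))"
  proof (rule continuous_on_compose2[OF holomorphic_on_imp_continuous_on[OF F]])
    show "continuous_on {0..1} (\<lambda>t. e t * x)" unfolding e_def by (intro continuous_intros)
  qed (use x ne in \<open>auto simp: norm_mult\<close>)
  have J: "((\<lambda>t. cmod (F (e t * x))) has_integral integral {0..1} (\<lambda>t. cmod (F (e t * x)))) {0..1}"
    by (intro integrable_integral integrable_continuous_interval continuous_on_norm cF)
  have "cmod (F 0) \<le> integral {0..1} (\<lambda>t. cmod (F (e t * x)))"
    using integral_norm_bound_integral[of "\<lambda>t. F (e t * x)" "{0..1}" "\<lambda>t. cmod (F (e t * x))"] I J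
    by (auto simp: has_integral_integrable_integral)
  also have "ennreal (integral {0..1} (\<lambda>t. cmod (F (e t * x)))) = (\<integral>\<^sup>+t\<in>{0..1::real}. ennreal (cmod (F (e t * x))) \<partial>lborel)"
    by (rule nn_integral_has_integral_lebesgue'[OF _ J, symmetric]) auto
  finally show ?thesis unfolding e_def by (simp add: ennreal_leI)
qed

text \<open>The integral over the disc does not change under rotations;
  averaging over all rotations and exchanging the integrals replaces \<open>|F|\<close> at each point by its mean
  over a circle, which is at least \<open>|F(0)|\<close>.\<close>

lemma sub_mean_value_0:
  assumes F: "F holomorphic_on ball 0 r" and r: "r > 0"
  shows "ennreal (cmod (F 0)) * ennreal (pi * r\<^sup>2) \<le> (\<integral>\<^sup>+x\<in>ball 0 r. ennreal (cmod (F x)) \<partial>lborel)"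
proof -
  \<comment> \<open>Extended by zero, the function is Borel measurable on the whole plane.\<close>
  define G where "G = (\<lambda>x. ennreal (cmod (if x \<in> ball 0 r then F x else 0)))"
  define e where "e = (\<lambda>t::real. exp (2 * of_real pi * \<i> * of_real t))"
  have [measurable]: "e \<in> borel_measurable borel" unfolding e_def
    by (intro borel_measurable_continuous_onI continuous_intros)
  have ne: "cmod (e t) = 1" for t by (simp add: e_def)
  have ne0: "e t \<noteq> 0" for t by (simp add: e_def)
  have [measurable]: "(\<lambda>x. if x \<in> ball 0 r then F x else 0) \<in> borel_measurable borel"
    by (rule borel_measurable_continuous_on_if) (auto intro: holomorphic_on_imp_continuous_on[OF F] simp: borel_open)
  have G[measurable]: "G \<in> borel_measurable borel" unfolding G_def by measurable
  have Gz: "G x * indicator (ball 0 r) x = G x" for x by (auto simp: G_def)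
  have rot: "(\<integral>\<^sup>+x. G (e t * x) \<partial>lborel) = (\<integral>\<^sup>+x. G x \<partial>lborel)" for t
  proof -
    have "G (e t * x) * ennreal ((cmod (e t))\<^sup>2) * indicator (ball 0 r) x = G (e t * x)" for x
      by (auto simp: G_def ne norm_mult)
    then show ?thesis
      using nn_integral_complex_scale[OF ne0 G, of t r] by (simp add: Gz ne)
  qed
  have "ennreal (cmod (F 0)) * ennreal (pi * r\<^sup>2) = (\<integral>\<^sup>+x\<in>ball 0 r. ennreal (cmod (F 0)) \<partial>(lborel::complex measure))"
    using r by (subst nn_integral_cmult_indicator) (auto simp: emeasure_ball unit_ball_vol_2 borel_open)
  also have "\<dots> \<le> (\<integral>\<^sup>+x. (\<integral>\<^sup>+t\<in>{0..1::real}. G (e t * x) \<partial>lborel) \<partial>lborel)"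
  proof (rule nn_integral_mono)
    fix x :: complex
    show "ennreal (cmod (F 0)) * indicator (ball 0 r) x \<le> (\<integral>\<^sup>+t\<in>{0..1::real}. G (e t * x) \<partial>lborel)"
    proof (cases "x \<in> ball 0 r")
      case True
      then have "e t * x \<in> ball 0 r" for t by (simp add: norm_mult ne)
      then have "G (e t * x) = ennreal (cmod (F (e t * x)))" for t by (simp add: G_def)
      then show ?thesis using cmod_center_le_circle_mean[OF F True] True by (simp add: e_def)
    qed auto
  qed
  also have "\<dots> = (\<integral>\<^sup>+t. (\<integral>\<^sup>+x. G (e t * x) * indicator {0..1::real} t \<partial>lborel) \<partial>lborel)"
    by (rule lborel_pair.Fubini'[symmetric]) measurable
  also have "\<dots> = (\<integral>\<^sup>+t\<in>{0..1::real}. (\<integral>\<^sup>+x. G x \<partial>lborel) \<partial>lborel)"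
    by (subst nn_integral_multc) (auto simp: rot)
  also have "\<dots> = (\<integral>\<^sup>+x. G x \<partial>lborel)" by (simp add: nn_integral_cmult)
  also have "\<dots> = (\<integral>\<^sup>+x\<in>ball 0 r. ennreal (cmod (F x)) \<partial>lborel)"
    by (intro nn_integral_cong) (auto simp: G_def)
  finally show ?thesis .
qed

lemma sub_mean_value:
  assumes F: "F holomorphic_on ball c r" and r: "r > 0"
  shows "ennreal (cmod (F c)) * ennreal (pi * r\<^sup>2) \<le> (\<integral>\<^sup>+x\<in>ball c r. ennreal (cmod (F x)) \<partial>lborel)"
proof -
  have im: "(+) c ` ball 0 r = ball c r" by (simp add: image_add_ball)
  have h: "(F \<circ> (+) c) holomorphic_on ball 0 r"
    by (rule holomorphic_on_compose) (auto intro!: holomorphic_intros F simp: im)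
  have [measurable]: "(\<lambda>x. if x \<in> ball c r then F x else 0) \<in> borel_measurable borel"
    by (rule borel_measurable_continuous_on_if) (auto intro: holomorphic_on_imp_continuous_on[OF F] simp: borel_open)
  have d: "deriv ((+) c) x = 1" for x by (auto intro!: DERIV_imp_deriv derivative_eq_intros)
  have "ennreal (cmod (F c)) * ennreal (pi * r\<^sup>2) \<le> (\<integral>\<^sup>+x\<in>ball 0 r. ennreal (cmod (F (c + x))) \<partial>lborel)"
    using sub_mean_value_0[OF h r] by simp
  also have "\<dots> = (\<integral>\<^sup>+x\<in>ball 0 r. ennreal (cmod (if (c + x) \<in> ball c r then F (c + x) else 0)) * ennreal ((cmod (deriv ((+) c) x))\<^sup>2) \<partial>lborel)"
    by (intro nn_integral_cong) (auto simp: d indicator_def dist_norm)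
  also have "\<dots> = (\<integral>\<^sup>+x\<in>(+) c ` ball 0 r. ennreal (cmod (if x \<in> ball c r then F x else 0)) \<partial>lborel)"
    by (rule nn_integral_holomorphic_change_of_variables[symmetric])
       (use \<open>(\<lambda>x. if x \<in> ball c r then F x else 0) \<in> borel_measurable borel\<close> in \<open>auto intro!: holomorphic_intros measurable_compose[OF _ measurable_ennreal] borel_measurable_norm simp: im simp del: mem_ball\<close>)
  also have "\<dots> = (\<integral>\<^sup>+x\<in>ball c r. ennreal (cmod (F x)) \<partial>lborel)"
    unfolding im by (intro nn_integral_cong) (auto simp: indicator_def)
  finally show ?thesis .
qed

lemma holomorphic2_on_imp_continuous_on:
  assumes "holomorphic2_on f S" shows "continuous_on S f"
  using assms unfolding holomorphic2_on_def
  by (intro continuous_at_imp_continuous_on ballI) (blast dest: has_derivative_continuous)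

lemma holomorphic2_on_compose:
  assumes f: "holomorphic2_on f S" and V: "open V"
    and h1: "h1 holomorphic_on V" and h2: "h2 holomorphic_on V" and im: "\<And>x. x \<in> V \<Longrightarrow> (h1 x, h2 x) \<in> S"
  shows "(\<lambda>x. f (h1 x, h2 x)) holomorphic_on V"
proof (rule holomorphic_onI)
  fix x assume x: "x \<in> V"
  obtain A B where f': "(f has_derivative (\<lambda>h. A * fst h + B * snd h)) (at (h1 x, h2 x))"
    using f im[OF x] unfolding holomorphic2_on_def by blast
  have 1: "(h1 has_derivative (\<lambda>h. deriv h1 x * h)) (at x)" "(h2 has_derivative (\<lambda>h. deriv h2 x * h)) (at x)"
    using holomorphic_derivI[OF h1 V x] holomorphic_derivI[OF h2 V x] by (auto simp: has_field_derivative_def)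
  have "((f \<circ> (\<lambda>x. (h1 x, h2 x))) has_derivative (\<lambda>h. A * fst h + B * snd h) \<circ> (\<lambda>h. (deriv h1 x * h, deriv h2 x * h))) (at x)"
    by (rule diff_chain_at) (intro has_derivative_Pair 1, rule f')
  then have "((\<lambda>x. f (h1 x, h2 x)) has_field_derivative (A * deriv h1 x + B * deriv h2 x)) (at x)"
    unfolding has_field_derivative_def o_def by (rule has_derivative_eq_rhs) (auto simp: algebra_simps)
  then show "(\<lambda>x. f (h1 x, h2 x)) field_differentiable at x within V"
    using field_differentiable_at_within field_differentiable_def by blast
qed

lemma bergman_spaceD:
  assumes "f \<in> bergman_space \<alpha>"
  shows "holomorphic2_on f (U_dom \<alpha>)" "set_integrable lborel (U_dom \<alpha>) (\<lambda>w. (cmod (f w))\<^sup>2)"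
    "w \<notin> U_dom \<alpha> \<Longrightarrow> f w = 0"
  using assms unfolding bergman_space_def by blast+

lemma bergman_measurable:
  assumes "\<alpha> > 0" "f \<in> bergman_space \<alpha>"
  shows "f \<in> borel_measurable borel"
proof -
  have "(\<lambda>w. if w \<in> U_dom \<alpha> then f w else 0) \<in> borel_measurable borel"
    using assms by (intro borel_measurable_continuous_on_if holomorphic2_on_imp_continuous_on[OF bergman_spaceD(1)]) auto
  moreover have "(\<lambda>w. if w \<in> U_dom \<alpha> then f w else 0) = f"
    using bergman_spaceD(3)[OF assms(2)] by auto
  ultimately show ?thesis by simp
qed

lemma bergman_nn_integral:
  assumes "\<alpha> > 0" "f \<in> bergman_space \<alpha>"
  shows "(\<integral>\<^sup>+w\<in>U_dom \<alpha>. ennreal ((cmod (f w))\<^sup>2) \<partial>lborel) = ennreal ((l2_norm \<alpha> f)\<^sup>2)"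
proof -
  have "0 \<le> (LINT w:U_dom \<alpha>|lborel. (cmod (f w))\<^sup>2)"
    unfolding set_lebesgue_integral_def by (intro integral_nonneg_AE) auto
  then have "(l2_norm \<alpha> f)\<^sup>2 = (LINT w:U_dom \<alpha>|lborel. (cmod (f w))\<^sup>2)"
    by (simp add: l2_norm_def)
  also have "ennreal \<dots> = (\<integral>\<^sup>+w. ennreal (indicator (U_dom \<alpha>) w *\<^sub>R (cmod (f w))\<^sup>2) \<partial>lborel)"
    unfolding set_lebesgue_integral_def
    by (rule nn_integral_eq_integral[symmetric]) (use bergman_spaceD(2)[OF assms(2)] in \<open>auto simp: set_integrable_def\<close>)
  also have "\<dots> = (\<integral>\<^sup>+w\<in>U_dom \<alpha>. ennreal ((cmod (f w))\<^sup>2) \<partial>lborel)"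
    by (intro nn_integral_cong) (auto split: split_indicator)
  finally show ?thesis by simp
qed

lemma aut_map_in_U_dom:
  assumes "\<alpha> > 0" "cmod b < 1" "w \<in> U_dom \<alpha>"
  shows "aut_map \<alpha> b w \<in> U_dom \<alpha>"
proof -
  have w: "cmod (snd w) < 1" "cmod (fst w) < (1 - (cmod (snd w))\<^sup>2) powr (\<alpha>/2)"
    using mem_U_dom_2[of \<alpha> "fst w" "snd w"] assms by auto
  have "aut_factor \<alpha> b (snd w) \<noteq> 0"
    using one_minus_cnj_mult_nonzero[OF assms(2) w(1)] assms(2) by (auto simp: aut_factor_def abs_square_eq_1)
  then have "cmod (aut_factor \<alpha> b (snd w)) * cmod (fst w) < cmod (aut_factor \<alpha> b (snd w)) * (1 - (cmod (snd w))\<^sup>2) powr (\<alpha>/2)"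
    using w by simp
  then show ?thesis
    unfolding aut_map_eq mem_U_dom_2[OF assms(1)] cmod_aut_factor_radius[OF assms(2) w(1)]
    using cmod_mobius_less_one[OF assms(2) w(1)] by (simp add: norm_mult)
qed

lemma aut_factor_holomorphic:
  assumes b: "cmod b < 1"
  shows "aut_factor \<alpha> b holomorphic_on ball 0 1"
proof -
  have "of_real (sqrt (1 - (cmod b)\<^sup>2)) / (1 - cnj b * y) \<notin> \<real>\<^sub>\<le>\<^sub>0" if "cmod y < 1" for y
  proof -
    have p: "0 < 1 - (cmod b)\<^sup>2" using b by (simp add: abs_square_less_1)
    have "0 < Re (1 - cnj b * y)" by (rule Re_one_minus_cnj_mult_pos[OF b that])
    moreover have "Re (of_real r / z) = r * Re z / (cmod z)\<^sup>2" for r z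
      by (simp add: Re_divide cmod_power2)
    moreover have "1 - cnj b * y \<noteq> 0" by (rule one_minus_cnj_mult_nonzero[OF b that])
    ultimately have "0 < Re (of_real (sqrt (1 - (cmod b)\<^sup>2)) / (1 - cnj b * y))"
      using p by (simp del: minus_complex.sel)
    then show ?thesis by (auto simp: complex_nonpos_Reals_iff)
  qed
  then show ?thesis unfolding aut_factor_def[abs_def]
    using one_minus_cnj_mult_nonzero[OF b] by (auto intro!: holomorphic_intros)
qed

lemma f_alpha_less_one:
  assumes "\<alpha> > 0" "z \<in> U_dom \<alpha>"
  shows "cmod (f_alpha \<alpha> z) < 1"
proof -
  have w: "cmod (snd z) < 1" "cmod (fst z) < (1 - (cmod (snd z))\<^sup>2) powr (\<alpha>/2)"
    using mem_U_dom_2[of \<alpha> "fst z" "snd z"] assms by auto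
  then show ?thesis by (simp add: f_alpha_def norm_divide divide_less_eq)
qed

text \<open>The weight is the one of the reproducing kernel on the diagonal, up to constants. The
  automorphism with parameter \<open>z\<^sub>2\<close> pulls \<open>f\<close> back to a function \<open>g\<close> with the same norm and moves
  \<open>z\<close> to \<open>(a, 0)\<close>; there the sub-mean value property is applied to \<open>g\<^sup>2\<close> in each variable.\<close>

lemma ex_bergman_point_bound:
  assumes \<alpha>: "\<alpha> > 0"
  shows "\<exists>C>0. \<forall>f\<in>bergman_space \<alpha>. \<forall>z\<in>U_dom \<alpha>.
    (cmod (f z))\<^sup>2 \<le> C / ((1 - (cmod (snd z))\<^sup>2) powr (2 + \<alpha>) * (1 - (cmod (f_alpha \<alpha> z))\<^sup>2) ^ 3) * (l2_norm \<alpha> f)\<^sup>2"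
proof -
  \<comment> \<open>The constants make the polydisc with radii \<open>\<delta>/2\<close> and \<open>sqrt (\<gamma> \<delta>)\<close> fit: \<open>1 - |v\<^sub>1|^(2/\<alpha>) > \<gamma> \<delta>\<close> if \<open>|v\<^sub>1| < 1 - \<delta>/2\<close>.\<close>
  define \<gamma> where "\<gamma> = min 1 (2/\<alpha>) / 2"
  have \<gamma>: "\<gamma> > 0" using \<alpha> by (simp add: \<gamma>_def)
  have "(cmod (f z))\<^sup>2 \<le> (32 / (pi\<^sup>2 * \<gamma>)) / ((1 - (cmod (snd z))\<^sup>2) powr (2 + \<alpha>) * (1 - (cmod (f_alpha \<alpha> z))\<^sup>2) ^ 3) * (l2_norm \<alpha> f)\<^sup>2"
    if f: "f \<in> bergman_space \<alpha>" and z: "z \<in> U_dom \<alpha>" for f z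
  proof -
    define b where "b = snd z"
    define a where "a = f_alpha \<alpha> z"
    define \<delta> where "\<delta> = 1 - cmod a"
    have b: "cmod b < 1" using U_dom_bounds[OF \<alpha> z] by (simp add: b_def)
    have a: "cmod a < 1" using f_alpha_less_one[OF \<alpha> z] by (simp add: a_def)
    have \<delta>: "0 < \<delta>" "\<delta> \<le> 1" using a by (auto simp: \<delta>_def)
    define r1 where "r1 = \<delta> / 2"
    define r2 where "r2 = sqrt (\<gamma> * \<delta>)"
    have r: "r1 > 0" "r2 > 0" using \<delta> \<gamma> by (auto simp: r1_def r2_def)
    have P: "(v1, v2) \<in> U_dom \<alpha>" if "v1 \<in> ball a r1" "v2 \<in> ball 0 r2" for v1 v2
    proof -
      have "cmod v1 \<le> cmod a + cmod (v1 - a)" by (metis add.commute diff_add_cancel norm_triangle_ineq)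
      also have "\<dots> < cmod a + r1" using that by (simp add: dist_norm norm_minus_commute)
      finally have v1: "cmod v1 < 1 - \<delta> / 2" by (simp add: r1_def \<delta>_def field_simps)
      have "(cmod v2)\<^sup>2 < r2\<^sup>2" using that by (intro power_strict_mono) auto
      then have "(cmod v2)\<^sup>2 < \<gamma> * \<delta>" using \<gamma> \<delta> by (simp add: r2_def)
      moreover have "min 1 (2/\<alpha>) * (1 - cmod v1) \<le> 1 - cmod v1 powr (2/\<alpha>)"
        using v1 \<delta> \<alpha> by (intro one_minus_powr_ge) auto
      moreover have "min 1 (2/\<alpha>) * (\<delta> / 2) \<le> min 1 (2/\<alpha>) * (1 - cmod v1)"
        using v1 \<alpha> by (intro mult_left_mono) auto
      ultimately show ?thesis by (simp add: U_dom_def \<gamma>_def)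
    qed
    define g where "g = (\<lambda>v. f (aut_map \<alpha> b v) * (aut_factor \<alpha> b (snd v) * deriv (mobius b) (snd v)))"
    have [measurable]: "f \<in> borel_measurable borel" by (rule bergman_measurable[OF \<alpha> f])
    have r2: "cmod v2 < 1" if "v2 \<in> ball 0 r2" for v2
      using P[OF _ that, of a] r U_dom_bounds[OF \<alpha>] by fastforce
    have slice2: "(\<lambda>v2. (g (v1, v2))\<^sup>2) holomorphic_on ball 0 r2" if v1: "v1 \<in> ball a r1" for v1
      unfolding g_def aut_map_eq fst_conv snd_conv
    proof (intro holomorphic_intros holomorphic2_on_compose[OF bergman_spaceD(1)[OF f]])
      have "ball 0 r2 \<subseteq> ball (0::complex) 1" using r2 by auto
      then show "aut_factor \<alpha> b holomorphic_on ball 0 r2" "mobius b holomorphic_on ball 0 r2"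
        "aut_factor \<alpha> b holomorphic_on ball 0 r2" "mobius b holomorphic_on ball 0 r2"
        using holomorphic_on_subset aut_factor_holomorphic[OF b] mobius_holomorphic[OF b] by blast+
      show "(aut_factor \<alpha> b x * v1, mobius b x) \<in> U_dom \<alpha>" if "x \<in> ball 0 r2" for x
        using aut_map_in_U_dom[OF \<alpha> b P[OF v1 that]] by (simp add: aut_map_eq)
    qed auto
    have slice1: "(\<lambda>v1. (g (v1, 0))\<^sup>2) holomorphic_on ball a r1"
      unfolding g_def aut_map_eq fst_conv snd_conv
    proof (intro holomorphic_intros holomorphic2_on_compose[OF bergman_spaceD(1)[OF f]])
      show "(aut_factor \<alpha> b 0 * x, mobius b 0) \<in> U_dom \<alpha>" if "x \<in> ball a r1" for x
        using aut_map_in_U_dom[OF \<alpha> b P[OF that, of 0]] r by (simp add: aut_map_eq)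
    qed auto
    define X where "X = (\<lambda>w::c2. ennreal ((cmod (f w))\<^sup>2))"
    have mX: "X \<in> borel_measurable borel" unfolding X_def by measurable
    have gX: "ennreal ((cmod (g w))\<^sup>2) = X (aut_map \<alpha> b w) * ennreal ((cmod (jacobian (aut_map \<alpha> b) w))\<^sup>2)" if "w \<in> U_dom \<alpha>" for w
      using U_dom_bounds[OF \<alpha> that]
      by (simp add: g_def X_def jacobian_aut_map[OF b] norm_mult power_mult_distrib flip: ennreal_mult)
    have mg: "(\<lambda>w. ennreal ((cmod (if w \<in> U_dom \<alpha> then g w else 0))\<^sup>2)) \<in> borel_measurable borel"
    proof -
      have "continuous_on (U_dom \<alpha>) g" unfolding g_def
      proof (intro continuous_intros)
        have c1: "continuous_on (U_dom \<alpha>) (\<lambda>v. aut_factor \<alpha> b (snd v))"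
          using U_dom_bounds[OF \<alpha>]
          by (intro continuous_on_compose2[OF holomorphic_on_imp_continuous_on[OF aut_factor_holomorphic[OF b]]]) (auto intro: continuous_intros)
        have c2: "continuous_on (U_dom \<alpha>) (\<lambda>v. mobius b (snd v))"
          using U_dom_bounds[OF \<alpha>]
          by (intro continuous_on_compose2[OF holomorphic_on_imp_continuous_on[OF mobius_holomorphic[OF b]]]) (auto intro: continuous_intros)
        have c3: "continuous_on (U_dom \<alpha>) (\<lambda>v. deriv (mobius b) (snd v))"
          using U_dom_bounds[OF \<alpha>]
          by (intro continuous_on_compose2[OF holomorphic_on_imp_continuous_on[OF holomorphic_deriv[OF mobius_holomorphic[OF b]]]]) (auto intro: continuous_intros)
        show "continuous_on (U_dom \<alpha>) (\<lambda>v. aut_factor \<alpha> b (snd v))" by (rule c1)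
        show "continuous_on (U_dom \<alpha>) (\<lambda>v. deriv (mobius b) (snd v))" by (rule c3)
        have "continuous_on (U_dom \<alpha>) (aut_map \<alpha> b)" unfolding aut_map_eq[abs_def]
          by (intro continuous_intros c1 c2)
        then show "continuous_on (U_dom \<alpha>) (\<lambda>v. f (aut_map \<alpha> b v))"
          by (rule continuous_on_compose2[OF holomorphic2_on_imp_continuous_on[OF bergman_spaceD(1)[OF f]]])
             (auto intro: aut_map_in_U_dom[OF \<alpha> b])
      qed
      then have "(\<lambda>w. if w \<in> U_dom \<alpha> then g w else 0) \<in> borel_measurable borel"
        by (intro borel_measurable_continuous_on_if) (use \<alpha> in auto)
      then show ?thesis by measurable
    qed
    \<comment> \<open>Two applications of the sub-mean value property: in the first variable at height \<open>0\<close>, then in the second variable on each slice.\<close>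
    have "ennreal ((cmod (g (a, 0)))\<^sup>2) * ennreal (pi * r1\<^sup>2) * ennreal (pi * r2\<^sup>2)
      \<le> (\<integral>\<^sup>+v1\<in>ball a r1. ennreal ((cmod (g (v1, 0)))\<^sup>2) \<partial>lborel) * ennreal (pi * r2\<^sup>2)"
      using sub_mean_value[OF slice1 r(1)] by (intro mult_right_mono) (auto simp: norm_power)
    also have "\<dots> = (\<integral>\<^sup>+v1. ennreal ((cmod (g (v1, 0)))\<^sup>2) * indicator (ball a r1) v1 * ennreal (pi * r2\<^sup>2) \<partial>lborel)"
    proof (rule nn_integral_multc[symmetric])
      have "(\<lambda>x. if x \<in> ball a r1 then (g (x, 0))\<^sup>2 else 0) \<in> borel_measurable borel"
        by (intro borel_measurable_continuous_on_if holomorphic_on_imp_continuous_on slice1) (auto simp: borel_open)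
      then have "(\<lambda>x. ennreal (cmod (if x \<in> ball a r1 then (g (x, 0))\<^sup>2 else 0))) \<in> borel_measurable lborel" by simp
      also have "(\<lambda>x. ennreal (cmod (if x \<in> ball a r1 then (g (x, 0))\<^sup>2 else 0))) = (\<lambda>v1. ennreal ((cmod (g (v1, 0)))\<^sup>2) * indicator (ball a r1) v1)"
        by (auto simp: norm_power fun_eq_iff)
      finally show "(\<lambda>v1. ennreal ((cmod (g (v1, 0)))\<^sup>2) * indicator (ball a r1) v1) \<in> borel_measurable lborel" .
    qed
    also have "\<dots> \<le> (\<integral>\<^sup>+v1. (\<integral>\<^sup>+v2. ennreal ((cmod (if (v1,v2) \<in> U_dom \<alpha> then g (v1,v2) else 0))\<^sup>2) \<partial>lborel) \<partial>lborel)"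
    proof (rule nn_integral_mono)
      fix v1 :: complex
      show "ennreal ((cmod (g (v1, 0)))\<^sup>2) * indicator (ball a r1) v1 * ennreal (pi * r2\<^sup>2) \<le>
        (\<integral>\<^sup>+v2. ennreal ((cmod (if (v1,v2) \<in> U_dom \<alpha> then g (v1,v2) else 0))\<^sup>2) \<partial>lborel)"
      proof (cases "v1 \<in> ball a r1")
        case True
        have "ennreal ((cmod (g (v1, 0)))\<^sup>2) * ennreal (pi * r2\<^sup>2) \<le> (\<integral>\<^sup>+v2\<in>ball 0 r2. ennreal ((cmod (g (v1,v2)))\<^sup>2) \<partial>lborel)"
          using sub_mean_value[OF slice2[OF True] r(2)] by (simp add: norm_power)
        also have "\<dots> \<le> (\<integral>\<^sup>+v2. ennreal ((cmod (if (v1,v2) \<in> U_dom \<alpha> then g (v1,v2) else 0))\<^sup>2) \<partial>lborel)"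
          by (intro nn_integral_mono) (auto simp: indicator_def P[OF True])
        finally show ?thesis using True by simp
      qed auto
    qed
    also have "\<dots> = (\<integral>\<^sup>+v. ennreal ((cmod (if v \<in> U_dom \<alpha> then g v else 0))\<^sup>2) \<partial>lborel)"
      unfolding lborel_prod[symmetric] by (rule lborel.nn_integral_fst) (use mg in \<open>simp add: lborel_prod\<close>)
    also have "\<dots> = (\<integral>\<^sup>+v\<in>U_dom \<alpha>. X (aut_map \<alpha> b v) * ennreal ((cmod (jacobian (aut_map \<alpha> b) v))\<^sup>2) \<partial>lborel)"
      by (intro nn_integral_cong) (auto simp: gX indicator_def)
    also have "\<dots> = (\<integral>\<^sup>+w\<in>U_dom \<alpha>. X w \<partial>lborel)"
      by (rule nn_integral_aut_map[OF \<alpha> b mX, symmetric])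
    also have "\<dots> = ennreal ((l2_norm \<alpha> f)\<^sup>2)"
      unfolding X_def by (rule bergman_nn_integral[OF \<alpha> f])
    finally have k1: "(cmod (g (a, 0)))\<^sup>2 * (pi * r1\<^sup>2) * (pi * r2\<^sup>2) \<le> (l2_norm \<alpha> f)\<^sup>2"
      by (simp flip: ennreal_mult)
    have k2: "(cmod (g (a, 0)))\<^sup>2 = (cmod (f z))\<^sup>2 * (1 - (cmod b)\<^sup>2) powr (2 + \<alpha>)"
    proof -
      have p: "0 < 1 - (cmod b)\<^sup>2" using b by (simp add: abs_square_less_1)
      have "aut_factor \<alpha> b 0 = of_real ((1 - (cmod b)\<^sup>2) powr (\<alpha>/2))"
        using p by (simp add: aut_factor_def powr_of_real powr_half_sqrt[symmetric] powr_powr del: of_real_diff)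
      then have "aut_map \<alpha> b (a, 0) = z"
        using p by (simp add: aut_map_eq mobius_def a_def f_alpha_def b_def)
      moreover have "cmod (aut_factor \<alpha> b 0 * deriv (mobius b) 0) = (1 - (cmod b)\<^sup>2) powr (1 + \<alpha>/2)"
        using cmod_jacobian_aut_map[of b "(0,0)" \<alpha>] jacobian_aut_map[of b "(0,0)" \<alpha>] b by simp
      ultimately show ?thesis using p unfolding g_def snd_conv norm_mult[of "f _"] power_mult_distrib
        by (simp add: powr_add power2_eq_square mult_ac) (simp add: field_simps flip: powr_add)
    qed
    have k3: "(1 - (cmod a)\<^sup>2) ^ 3 \<le> 8 * \<delta> ^ 3"
    proof -
      have "1 - (cmod a)\<^sup>2 = \<delta> * (1 + cmod a)" by (simp add: \<delta>_def power2_eq_square algebra_simps)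
      also have "\<dots> \<le> \<delta> * 2" using a \<delta> by (intro mult_left_mono) auto
      finally have "(1 - (cmod a)\<^sup>2) ^ 3 \<le> (\<delta> * 2) ^ 3" using a by (intro power_mono) (auto simp: abs_square_le_1)
      then show ?thesis by (simp add: power_mult_distrib)
    qed
    have k4: "pi * r1\<^sup>2 * (pi * r2\<^sup>2) = pi\<^sup>2 * \<gamma> / 4 * \<delta> ^ 3"
      using \<gamma> \<delta> by (simp add: r1_def r2_def power2_eq_square power3_eq_cube)
    have p: "0 < (1 - (cmod b)\<^sup>2) powr (2 + \<alpha>)" "0 < (1 - (cmod a)\<^sup>2) ^ 3" using a b by (auto simp: abs_square_less_1 abs_square_eq_1)
    have "(cmod (f z))\<^sup>2 * (1 - (cmod b)\<^sup>2) powr (2 + \<alpha>) * (pi\<^sup>2 * \<gamma> / 4 * ((1 - (cmod a)\<^sup>2) ^ 3 / 8))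
      \<le> (cmod (f z))\<^sup>2 * (1 - (cmod b)\<^sup>2) powr (2 + \<alpha>) * (pi\<^sup>2 * \<gamma> / 4 * \<delta> ^ 3)"
      using k3 \<gamma> by (intro mult_left_mono) auto
    also have "\<dots> = (cmod (g (a, 0)))\<^sup>2 * (pi * r1\<^sup>2) * (pi * r2\<^sup>2)"
      unfolding k2 k4[symmetric] by (simp only: mult.assoc)
    finally have "(cmod (f z))\<^sup>2 * (1 - (cmod b)\<^sup>2) powr (2 + \<alpha>) * (pi\<^sup>2 * \<gamma> / 4 * ((1 - (cmod a)\<^sup>2) ^ 3 / 8)) \<le> (l2_norm \<alpha> f)\<^sup>2"
      using k1 by linarith
    then show ?thesis unfolding a_def[symmetric] b_def[symmetric] using p \<gamma>
      by (simp add: field_simps)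
  qed
  then show ?thesis using \<gamma> by (intro exI[of _ "32 / (pi\<^sup>2 * \<gamma>)"]) auto
qed

section \<open>Completeness of the Bergman space\<close>

lemma borel_measurable_cnj[measurable (raw)]:
  "f \<in> borel_measurable M \<Longrightarrow> (\<lambda>x. cnj (f x)) \<in> borel_measurable M"
  by (rule measurable_compose[OF _ borel_measurable_continuous_onI]) (auto intro: continuous_intros)

text \<open>Square integrable functions on the domain without holomorphy; the operator under construction
  first takes values here. Their values off the domain are irrelevant for the inner product.\<close>

definition l2_space :: "real \<Rightarrow> (c2 \<Rightarrow> complex) set" where
  "l2_space \<alpha> = {f \<in> borel_measurable borel. set_integrable lborel (U_dom \<alpha>) (\<lambda>w. (cmod (f w))\<^sup>2)}"

lemma l2_space_measurable: "f \<in> l2_space \<alpha> \<Longrightarrow> f \<in> borel_measurable borel"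
  by (simp add: l2_space_def)

lemma bergman_subset_l2: "\<alpha> > 0 \<Longrightarrow> f \<in> bergman_space \<alpha> \<Longrightarrow> f \<in> l2_space \<alpha>"
  using bergman_measurable bergman_spaceD(2) by (auto simp: l2_space_def)

lemma l2_product_integrable:
  assumes \<alpha>: "\<alpha> > 0" and f: "f \<in> l2_space \<alpha>" and g: "g \<in> l2_space \<alpha>"
  shows "set_integrable lborel (U_dom \<alpha>) (\<lambda>w. f w * cnj (g w))"
proof -
  note [measurable] = l2_space_measurable[OF f] l2_space_measurable[OF g]
  have "set_integrable lborel (U_dom \<alpha>) (\<lambda>w. (cmod (f w))\<^sup>2 + (cmod (g w))\<^sup>2)"
    using f g by (intro set_integral_add) (auto simp: l2_space_def)
  then show ?thesis
  proof (rule set_integrable_bound)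
    show "set_borel_measurable lborel (U_dom \<alpha>) (\<lambda>w. f w * cnj (g w))"
      unfolding set_borel_measurable_def using \<alpha> by measurable
    have "cmod (f w) * cmod (g w) \<le> (cmod (f w))\<^sup>2 + (cmod (g w))\<^sup>2" for w
      using sum_squares_bound[of "cmod (f w)" "cmod (g w)"]
        mult_nonneg_nonneg[OF norm_ge_zero[of "f w"] norm_ge_zero[of "g w"]] by linarith
    then show "AE w in lborel. w \<in> U_dom \<alpha> \<longrightarrow> norm (f w * cnj (g w)) \<le> norm ((cmod (f w))\<^sup>2 + (cmod (g w))\<^sup>2)"
      by (intro AE_I2) (simp add: norm_mult)
  qed
qed

lemma l2_space_lincomb:
  assumes \<alpha>: "\<alpha> > 0" and f: "f \<in> l2_space \<alpha>" and g: "g \<in> l2_space \<alpha>"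
  shows "(\<lambda>w. f w + t * g w) \<in> l2_space \<alpha>"
proof -
  note [measurable] = l2_space_measurable[OF f] l2_space_measurable[OF g]
  have "set_integrable lborel (U_dom \<alpha>) (\<lambda>w. 2 * (cmod (f w))\<^sup>2 + 2 * (cmod t)\<^sup>2 * (cmod (g w))\<^sup>2)"
    using f g by (intro set_integral_add set_integrable_mult_right) (auto simp: l2_space_def)
  then have "set_integrable lborel (U_dom \<alpha>) (\<lambda>w. (cmod (f w + t * g w))\<^sup>2)"
  proof (rule set_integrable_bound)
    show "set_borel_measurable lborel (U_dom \<alpha>) (\<lambda>w. (cmod (f w + t * g w))\<^sup>2)"
      unfolding set_borel_measurable_def using \<alpha> by measurable
    have "(cmod (f w + t * g w))\<^sup>2 \<le> 2 * (cmod (f w))\<^sup>2 + 2 * (cmod t)\<^sup>2 * (cmod (g w))\<^sup>2" for w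
    proof -
      have "(cmod (f w + t * g w))\<^sup>2 \<le> (cmod (f w) + cmod (t * g w))\<^sup>2"
        by (intro power_mono norm_triangle_ineq) auto
      also have "\<dots> \<le> 2 * (cmod (f w))\<^sup>2 + 2 * (cmod (t * g w))\<^sup>2"
        using sum_squares_bound[of "cmod (f w)" "cmod (t * g w)"] by (simp add: power2_sum)
      finally show ?thesis by (simp add: norm_mult power_mult_distrib)
    qed
    then show "AE w in lborel. w \<in> U_dom \<alpha> \<longrightarrow> norm ((cmod (f w + t * g w))\<^sup>2) \<le> norm (2 * (cmod (f w))\<^sup>2 + 2 * (cmod t)\<^sup>2 * (cmod (g w))\<^sup>2)"
      by (intro AE_I2) simp
  qed
  then show ?thesis by (simp add: l2_space_def)
qed

lemma l2_inner_lincomb_left: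
  assumes \<alpha>: "\<alpha> > 0" and "f \<in> l2_space \<alpha>" "g \<in> l2_space \<alpha>" "h \<in> l2_space \<alpha>"
  shows "l2_inner \<alpha> (\<lambda>w. f w + t * g w) h = l2_inner \<alpha> f h + t * l2_inner \<alpha> g h"
proof -
  have "l2_inner \<alpha> (\<lambda>w. f w + t * g w) h = (LINT w:U_dom \<alpha>|lborel. f w * cnj (h w) + t * (g w * cnj (h w)))"
    unfolding l2_inner_def by (simp add: algebra_simps)
  also have "\<dots> = (LINT w:U_dom \<alpha>|lborel. f w * cnj (h w)) + (LINT w:U_dom \<alpha>|lborel. t * (g w * cnj (h w)))"
    using assms by (intro set_integral_add set_integrable_mult_right l2_product_integrable) auto
  also have "(LINT w:U_dom \<alpha>|lborel. t * (g w * cnj (h w))) = t * (LINT w:U_dom \<alpha>|lborel. g w * cnj (h w))"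
    by simp
  finally show ?thesis by (simp add: l2_inner_def)
qed

lemma l2_inner_scale_left: "l2_inner \<alpha> (\<lambda>w. t * f w) g = t * l2_inner \<alpha> f g"
  unfolding l2_inner_def by (simp add: mult.assoc)

lemma l2_inner_cnj: "l2_inner \<alpha> g f = cnj (l2_inner \<alpha> f g)"
proof -
  have "cnj (l2_inner \<alpha> f g) = (LINT w|lborel. cnj (indicator (U_dom \<alpha>) w *\<^sub>R (f w * cnj (g w))))"
    unfolding l2_inner_def set_lebesgue_integral_def by (rule Bochner_Integration.integral_cnj[symmetric])
  also have "\<dots> = l2_inner \<alpha> g f"
    unfolding l2_inner_def set_lebesgue_integral_def by (intro Bochner_Integration.integral_cong) (auto simp: mult.commute)
  finally show ?thesis by simp
qed

lemma l2_inner_scale_right: "l2_inner \<alpha> f (\<lambda>w. t * g w) = cnj t * l2_inner \<alpha> f g"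
  using l2_inner_scale_left[of \<alpha> t g f] l2_inner_cnj[of \<alpha> f] by (metis complex_cnj_mult)

lemma l2_norm_nonneg: "0 \<le> l2_norm \<alpha> f"
  unfolding l2_norm_def set_lebesgue_integral_def by (intro real_sqrt_ge_zero integral_nonneg_AE) auto

lemma l2_norm_power2: "(l2_norm \<alpha> f)\<^sup>2 = (LINT w:U_dom \<alpha>|lborel. (cmod (f w))\<^sup>2)"
proof -
  have "0 \<le> (LINT w:U_dom \<alpha>|lborel. (cmod (f w))\<^sup>2)"
    unfolding set_lebesgue_integral_def by (intro integral_nonneg_AE) auto
  then show ?thesis by (simp add: l2_norm_def)
qed

lemma l2_inner_self: "l2_inner \<alpha> f f = of_real ((l2_norm \<alpha> f)\<^sup>2)"
  unfolding l2_norm_power2 l2_inner_def set_lebesgue_integral_def complex_norm_square[symmetric] scaleR_conv_of_real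
  by (simp flip: of_real_mult of_real_power)

lemma l2_nn_integral:
  assumes "f \<in> l2_space \<alpha>"
  shows "(\<integral>\<^sup>+w\<in>U_dom \<alpha>. ennreal ((cmod (f w))\<^sup>2) \<partial>lborel) = ennreal ((l2_norm \<alpha> f)\<^sup>2)"
proof -
  have "ennreal ((l2_norm \<alpha> f)\<^sup>2) = (\<integral>\<^sup>+w. ennreal (indicator (U_dom \<alpha>) w *\<^sub>R (cmod (f w))\<^sup>2) \<partial>lborel)"
    unfolding set_lebesgue_integral_def l2_norm_power2
    by (rule nn_integral_eq_integral[symmetric]) (use assms in \<open>auto simp: set_integrable_def l2_space_def\<close>)
  also have "\<dots> = (\<integral>\<^sup>+w\<in>U_dom \<alpha>. ennreal ((cmod (f w))\<^sup>2) \<partial>lborel)"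
    by (intro nn_integral_cong) (auto split: split_indicator)
  finally show ?thesis by simp
qed

text \<open>The expansion of \<open>\<parallel>f + t g\<parallel>\<^sup>2\<close>; the Cauchy--Schwarz inequality and the minimisation in the Riesz
  theorem are both read off from it.\<close>

lemma l2_norm_lincomb:
  assumes \<alpha>: "\<alpha> > 0" and f: "f \<in> l2_space \<alpha>" and g: "g \<in> l2_space \<alpha>"
  shows "(l2_norm \<alpha> (\<lambda>w. f w + t * g w))\<^sup>2 = (l2_norm \<alpha> f)\<^sup>2 + 2 * Re (t * l2_inner \<alpha> g f) + (cmod t)\<^sup>2 * (l2_norm \<alpha> g)\<^sup>2"
proof -
  let ?h = "\<lambda>w. f w + t * g w"
  have h: "?h \<in> l2_space \<alpha>" by (rule l2_space_lincomb[OF assms])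
  have e: "l2_inner \<alpha> u ?h = l2_inner \<alpha> u f + cnj t * l2_inner \<alpha> u g" if "u \<in> l2_space \<alpha>" for u
    using l2_inner_lincomb_left[OF \<alpha> f g that, of t] l2_inner_cnj[of \<alpha> u] by (metis complex_cnj_add complex_cnj_mult)
  have "of_real ((l2_norm \<alpha> ?h)\<^sup>2) = l2_inner \<alpha> f f + cnj t * l2_inner \<alpha> f g + t * (l2_inner \<alpha> g f + cnj t * l2_inner \<alpha> g g)"
    unfolding l2_inner_self[symmetric] l2_inner_lincomb_left[OF \<alpha> f g h] e[OF f] e[OF g] by simp
  moreover have "cnj t * l2_inner \<alpha> f g = cnj (t * l2_inner \<alpha> g f)" using l2_inner_cnj[of \<alpha> f g] by simp
  moreover have "t * (cnj t * l2_inner \<alpha> g g) = of_real ((cmod t)\<^sup>2 * (l2_norm \<alpha> g)\<^sup>2)"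
    by (simp only: l2_inner_self of_real_mult complex_norm_square mult.assoc)
  ultimately have "complex_of_real ((l2_norm \<alpha> ?h)\<^sup>2) = of_real ((l2_norm \<alpha> f)\<^sup>2) + cnj (t * l2_inner \<alpha> g f) + t * l2_inner \<alpha> g f + of_real ((cmod t)\<^sup>2 * (l2_norm \<alpha> g)\<^sup>2)"
    by (simp only: l2_inner_self distrib_left add.assoc)
  then have "Re (complex_of_real ((l2_norm \<alpha> ?h)\<^sup>2)) = Re (of_real ((l2_norm \<alpha> f)\<^sup>2) + cnj (t * l2_inner \<alpha> g f) + t * l2_inner \<alpha> g f + of_real ((cmod t)\<^sup>2 * (l2_norm \<alpha> g)\<^sup>2))"
    by (rule arg_cong)
  then show ?thesis by simp
qed

lemma l2_Cauchy_Schwarz: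
  assumes \<alpha>: "\<alpha> > 0" and f: "f \<in> l2_space \<alpha>" and g: "g \<in> l2_space \<alpha>"
  shows "cmod (l2_inner \<alpha> f g) \<le> l2_norm \<alpha> f * l2_norm \<alpha> g"
proof -
  define c where "c = l2_inner \<alpha> f g"
  define A where "A = (l2_norm \<alpha> f)\<^sup>2"
  define B where "B = (l2_norm \<alpha> g)\<^sup>2"
  have AB: "A \<ge> 0" "B \<ge> 0" by (auto simp: A_def B_def)
  have q: "0 \<le> B + 2 * s * (cmod c)\<^sup>2 + s\<^sup>2 * (cmod c)\<^sup>2 * A" for s
  proof -
    have "0 \<le> (l2_norm \<alpha> (\<lambda>w. g w + of_real s * cnj c * f w))\<^sup>2" by simp
    also have "\<dots> = B + 2 * Re (of_real s * cnj c * c) + (cmod (of_real s * cnj c))\<^sup>2 * A"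
      unfolding l2_norm_lincomb[OF \<alpha> g f] A_def B_def c_def ..
    also have "of_real s * cnj c * c = of_real (s * (cmod c)\<^sup>2)"
      by (simp only: of_real_mult complex_norm_square mult_ac)
    also have "(cmod (of_real s * cnj c))\<^sup>2 = s\<^sup>2 * (cmod c)\<^sup>2" by (simp add: norm_mult power_mult_distrib)
    finally show ?thesis by simp
  qed
  have "(cmod c)\<^sup>2 \<le> A * B"
  proof (cases "c = 0")
    case True then show ?thesis using AB by simp
  next
    case False
    then have c: "(cmod c)\<^sup>2 > 0" by simp
    show ?thesis
    proof (cases "A = 0")
      case True
      have "0 \<le> B + 2 * (- (B + 1) / (2 * (cmod c)\<^sup>2)) * (cmod c)\<^sup>2" using q[of "- (B + 1) / (2 * (cmod c)\<^sup>2)"] True by simp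
      then show ?thesis using c by (simp add: field_simps)
    next
      case A: False
      \<comment> \<open>The minimum of the quadratic polynomial in \<open>s\<close> is attained at \<open>-1/A\<close>.\<close>
      have "0 \<le> B + 2 * (-1/A) * (cmod c)\<^sup>2 + (-1/A)\<^sup>2 * (cmod c)\<^sup>2 * A" by (rule q)
      also have "\<dots> = B - (cmod c)\<^sup>2 / A" using A by (simp add: power2_eq_square field_simps)
      finally show ?thesis using A AB by (simp add: field_simps)
    qed
  qed
  also have "A * B = (l2_norm \<alpha> f * l2_norm \<alpha> g)\<^sup>2" by (simp add: A_def B_def power_mult_distrib)
  finally show ?thesis unfolding c_def
    by (rule power2_le_imp_le) (simp add: l2_norm_nonneg)
qed

lemma bergman_lincomb:
  assumes \<alpha>: "\<alpha> > 0" and f: "f \<in> bergman_space \<alpha>" and g: "g \<in> bergman_space \<alpha>"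
  shows "(\<lambda>w. f w + t * g w) \<in> bergman_space \<alpha>"
proof -
  have "holomorphic2_on (\<lambda>w. f w + t * g w) (U_dom \<alpha>)"
    unfolding holomorphic2_on_def
  proof
    fix z assume z: "z \<in> U_dom \<alpha>"
    obtain a b where 1: "(f has_derivative (\<lambda>h. a * fst h + b * snd h)) (at z)"
      using bergman_spaceD(1)[OF f] z unfolding holomorphic2_on_def by blast
    obtain c d where 2: "(g has_derivative (\<lambda>h. c * fst h + d * snd h)) (at z)"
      using bergman_spaceD(1)[OF g] z unfolding holomorphic2_on_def by blast
    have "((\<lambda>w. f w + t * g w) has_derivative (\<lambda>h. (a * fst h + b * snd h) + t * (c * fst h + d * snd h))) (at z)"
      by (intro has_derivative_add 1 has_derivative_mult_right 2)
    also have "(\<lambda>h. (a * fst h + b * snd h) + t * (c * fst h + d * snd h)) = (\<lambda>h. (a + t * c) * fst h + (b + t * d) * snd h)"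
      by (simp add: algebra_simps fun_eq_iff)
    finally show "\<exists>a b. ((\<lambda>w. f w + t * g w) has_derivative (\<lambda>h. a * fst h + b * snd h)) (at z)" by blast
  qed
  moreover have "(\<lambda>w. f w + t * g w) \<in> l2_space \<alpha>"
    by (intro l2_space_lincomb bergman_subset_l2 assms)
  ultimately show ?thesis
    using bergman_spaceD(3)[OF f] bergman_spaceD(3)[OF g] unfolding bergman_space_def l2_space_def by auto
qed

lemma zero_in_bergman: "(\<lambda>w. 0) \<in> bergman_space \<alpha>"
  by (auto simp: bergman_space_def holomorphic2_on_def set_integrable_def intro!: exI[of _ 0])

lemma bergman_scale:
  assumes \<alpha>: "\<alpha> > 0" and g: "g \<in> bergman_space \<alpha>"
  shows "(\<lambda>w. t * g w) \<in> bergman_space \<alpha>"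
  using bergman_lincomb[OF \<alpha> zero_in_bergman g, of t] by simp

lemma bergman_diff:
  assumes \<alpha>: "\<alpha> > 0" and f: "f \<in> bergman_space \<alpha>" and g: "g \<in> bergman_space \<alpha>"
  shows "(\<lambda>w. f w - g w) \<in> bergman_space \<alpha>"
  using bergman_lincomb[OF assms, of "-1"] by simp

lemma holomorphic2_on_has_derivative:
  assumes f: "holomorphic2_on f S" and z: "z \<in> S"
  shows "(f has_derivative (\<lambda>h. deriv (\<lambda>x. f (x, snd z)) (fst z) * fst h + deriv (\<lambda>y. f (fst z, y)) (snd z) * snd h)) (at z)"
proof -
  obtain a b where 1: "(f has_derivative (\<lambda>h. a * fst h + b * snd h)) (at (fst z, snd z))"
    using f z unfolding holomorphic2_on_def by force
  have "((\<lambda>x. (x, snd z)) has_derivative (\<lambda>h. (h, 0))) (at (fst z))" by (intro derivative_intros)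
  from diff_chain_at[OF this 1] have "((\<lambda>x. f (x, snd z)) has_field_derivative a) (at (fst z))"
    by (simp add: has_field_derivative_def o_def)
  then have a: "deriv (\<lambda>x. f (x, snd z)) (fst z) = a" by (rule DERIV_imp_deriv)
  have "((\<lambda>y. (fst z, y)) has_derivative (\<lambda>h. (0, h))) (at (snd z))" by (intro derivative_intros)
  from diff_chain_at[OF this 1] have "((\<lambda>y. f (fst z, y)) has_field_derivative b) (at (snd z))"
    by (simp add: has_field_derivative_def o_def)
  then have b: "deriv (\<lambda>y. f (fst z, y)) (snd z) = b" by (rule DERIV_imp_deriv)
  show ?thesis using 1 unfolding a b by simp
qed

text \<open>The bound for point evaluations is locally uniform because its weight is continuous; Cauchy's
  estimate on a slightly smaller ball turns it into a bound for the partial derivatives.\<close>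

lemma bergman_local_bound:
  assumes \<alpha>: "\<alpha> > 0" and z0: "z0 \<in> U_dom \<alpha>"
  shows "\<exists>r>0. \<exists>M>0. ball z0 r \<subseteq> U_dom \<alpha> \<and> (\<forall>f\<in>bergman_space \<alpha>. \<forall>z\<in>ball z0 r.
    cmod (f z) \<le> M * l2_norm \<alpha> f \<and> cmod (deriv (\<lambda>x. f (x, snd z)) (fst z)) \<le> M * l2_norm \<alpha> f \<and>
    cmod (deriv (\<lambda>y. f (fst z, y)) (snd z)) \<le> M * l2_norm \<alpha> f)"
proof -
  obtain C where C: "C > 0" "\<And>f z. f\<in>bergman_space \<alpha> \<Longrightarrow> z\<in>U_dom \<alpha> \<Longrightarrow>
    (cmod (f z))\<^sup>2 \<le> C / ((1 - (cmod (snd z))\<^sup>2) powr (2 + \<alpha>) * (1 - (cmod (f_alpha \<alpha> z))\<^sup>2) ^ 3) * (l2_norm \<alpha> f)\<^sup>2"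
    using ex_bergman_point_bound[OF \<alpha>] by blast
  define W where "W = (\<lambda>z. C / ((1 - (cmod (snd z))\<^sup>2) powr (2 + \<alpha>) * (1 - (cmod (f_alpha \<alpha> z))\<^sup>2) ^ 3))"
  have nz: "1 - (cmod (snd z))\<^sup>2 > 0" "1 - (cmod (f_alpha \<alpha> z))\<^sup>2 > 0" if "z \<in> U_dom \<alpha>" for z
    using U_dom_bounds[OF \<alpha> that] f_alpha_less_one[OF \<alpha> that] by (auto simp: abs_square_less_1)
  have cf: "continuous_on (U_dom \<alpha>) (f_alpha \<alpha>)"
    unfolding f_alpha_def[abs_def] using nz by (intro continuous_intros) force+
  have cW: "continuous_on (U_dom \<alpha>) W"
    unfolding W_def using nz by (intro continuous_intros cf) force+
  obtain R where R: "R > 0" "cball z0 R \<subseteq> U_dom \<alpha>"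
    using open_contains_cball open_U_dom[OF \<alpha>] z0 by blast
  define r where "r = R / 3"
  have r: "r > 0" using R by (simp add: r_def)
  have "compact (W ` cball z0 R)"
    by (intro compact_continuous_image continuous_on_subset[OF cW] R) auto
  then have "bounded (W ` cball z0 R)" by (rule compact_imp_bounded)
  then obtain B where B: "\<And>z. z \<in> cball z0 R \<Longrightarrow> \<bar>W z\<bar> \<le> B" "B > 0" unfolding bounded_pos by (metis image_eqI real_norm_def)
  define M0 where "M0 = sqrt B"
  have M0: "cmod (f z) \<le> M0 * l2_norm \<alpha> f" if "f \<in> bergman_space \<alpha>" "z \<in> cball z0 R" for f z
  proof (rule power2_le_imp_le)
    have "(cmod (f z))\<^sup>2 \<le> W z * (l2_norm \<alpha> f)\<^sup>2" unfolding W_def using that R by (intro C) auto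
    also have "\<dots> \<le> B * (l2_norm \<alpha> f)\<^sup>2" using B(1)[OF that(2)] by (intro mult_right_mono) auto
    finally show "(cmod (f z))\<^sup>2 \<le> (M0 * l2_norm \<alpha> f)\<^sup>2" using B by (simp add: M0_def power_mult_distrib)
    show "0 \<le> M0 * l2_norm \<alpha> f" using B by (simp add: M0_def l2_norm_nonneg)
  qed
  define M where "M = M0 + M0 / r"
  have M0pos: "M0 > 0" using B by (simp add: M0_def)
  have M: "M > 0" "M0 \<le> M" "M0 / r \<le> M" using M0pos r by (auto simp: M_def add_pos_pos)
  have D: "cmod (deriv (\<lambda>x. f (x, snd z)) (fst z)) \<le> M0 * l2_norm \<alpha> f / r \<and> cmod (deriv (\<lambda>y. f (fst z, y)) (snd z)) \<le> M0 * l2_norm \<alpha> f / r"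
    if f: "f \<in> bergman_space \<alpha>" and z: "z \<in> ball z0 r" for f z
  proof -
    have in1: "(x, snd z) \<in> cball z0 R" if "x \<in> ball (fst z) (2 * r)" for x
    proof -
      have "dist z0 (x, snd z) \<le> dist z0 z + dist z (x, snd z)" by (rule dist_triangle)
      also have "dist z (x, snd z) = dist (fst z) x" by (simp add: dist_prod_def)
      finally show ?thesis using z that by (simp add: r_def)
    qed
    have in2: "(fst z, x) \<in> cball z0 R" if "x \<in> ball (snd z) (2 * r)" for x
    proof -
      have "dist z0 (fst z, x) \<le> dist z0 z + dist z (fst z, x)" by (rule dist_triangle)
      also have "dist z (fst z, x) = dist (snd z) x" by (simp add: dist_prod_def)
      finally show ?thesis using z that by (simp add: r_def)
    qed
    have h1: "(\<lambda>x. f (x, snd z)) holomorphic_on ball (fst z) (2 * r)"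
      by (rule holomorphic2_on_compose[OF bergman_spaceD(1)[OF f]]) (use in1 R in auto)
    have h2: "(\<lambda>x. f (fst z, x)) holomorphic_on ball (snd z) (2 * r)"
      by (rule holomorphic2_on_compose[OF bergman_spaceD(1)[OF f]]) (use in2 R in auto)
    have sub: "ball x r \<subseteq> ball x (2 * r)" "cball x r \<subseteq> ball x (2 * r)" for x :: complex using r by auto
    have "cmod ((deriv ^^ 1) (\<lambda>x. f (x, snd z)) (fst z)) \<le> fact 1 * (M0 * l2_norm \<alpha> f) / r ^ 1"
    proof (rule Cauchy_inequality)
      show "cmod (f (x, snd z)) \<le> M0 * l2_norm \<alpha> f" if "cmod (fst z - x) = r" for x
        by (rule M0[OF f in1]) (use that r in \<open>auto simp: dist_norm\<close>)
    qed (use holomorphic_on_subset[OF h1 sub(1)] continuous_on_subset[OF holomorphic_on_imp_continuous_on[OF h1] sub(2)] r in auto)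
    moreover have "cmod ((deriv ^^ 1) (\<lambda>x. f (fst z, x)) (snd z)) \<le> fact 1 * (M0 * l2_norm \<alpha> f) / r ^ 1"
    proof (rule Cauchy_inequality)
      show "cmod (f (fst z, x)) \<le> M0 * l2_norm \<alpha> f" if "cmod (snd z - x) = r" for x
        by (rule M0[OF f in2]) (use that r in \<open>auto simp: dist_norm\<close>)
    qed (use holomorphic_on_subset[OF h2 sub(1)] continuous_on_subset[OF holomorphic_on_imp_continuous_on[OF h2] sub(2)] r in auto)
    ultimately show ?thesis by simp
  qed
  have le: "M0 * l2_norm \<alpha> f / r \<le> M * l2_norm \<alpha> f" "M0 * l2_norm \<alpha> f \<le> M * l2_norm \<alpha> f" for f
    using mult_right_mono[OF M(3) l2_norm_nonneg[of \<alpha> f]] mult_right_mono[OF M(2) l2_norm_nonneg[of \<alpha> f]] by auto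
  have "ball z0 r \<subseteq> U_dom \<alpha>" using R r by (auto simp: r_def subset_iff)
  moreover have "ball z0 r \<subseteq> cball z0 R" using r by (auto simp: r_def)
  ultimately have "cmod (f z) \<le> M * l2_norm \<alpha> f \<and> cmod (deriv (\<lambda>x. f (x, snd z)) (fst z)) \<le> M * l2_norm \<alpha> f \<and>
    cmod (deriv (\<lambda>y. f (fst z, y)) (snd z)) \<le> M * l2_norm \<alpha> f" if "f \<in> bergman_space \<alpha>" "z \<in> ball z0 r" for f z
    using M0[OF that(1), of z] D[OF that] le[of f] that(2) by (meson in_mono order_trans)
  with \<open>ball z0 r \<subseteq> U_dom \<alpha>\<close> r M(1) show ?thesis by blast
qed

text \<open>By the local bounds a Cauchy sequence converges locally uniformly together with its partial
  derivatives, so the limit is holomorphic; Fatou's lemma shows that the limit is also the limit in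
  norm.\<close>

lemma bergman_complete:
  assumes \<alpha>: "\<alpha> > 0" and F: "\<And>n. F n \<in> bergman_space \<alpha>"
    and Cau: "\<And>e. e > 0 \<Longrightarrow> \<exists>N. \<forall>m\<ge>N. \<forall>n\<ge>N. l2_norm \<alpha> (\<lambda>w. F m w - F n w) \<le> e"
  shows "\<exists>g\<in>bergman_space \<alpha>. (\<lambda>n. l2_norm \<alpha> (\<lambda>w. F n w - g w)) \<longlonglongrightarrow> 0"
proof -
  define g where "g = (\<lambda>z. if z \<in> U_dom \<alpha> then lim (\<lambda>n. F n z) else 0)"
  define d1 where "d1 = (\<lambda>f z. deriv (\<lambda>x. (f::c2\<Rightarrow>complex) (x, snd z)) (fst z))"
  define d2 where "d2 = (\<lambda>f z. deriv (\<lambda>y. (f::c2\<Rightarrow>complex) (fst z, y)) (snd z))"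
  \<comment> \<open>The derivative determines both partial derivatives, so these are additive.\<close>
  have d12: "d1 (\<lambda>w. F m w - F n w) z = d1 (F m) z - d1 (F n) z \<and> d2 (\<lambda>w. F m w - F n w) z = d2 (F m) z - d2 (F n) z" if z: "z \<in> U_dom \<alpha>" for m n z
  proof -
    have *: "(f has_derivative (\<lambda>h. d1 f z * fst h + d2 f z * snd h)) (at z)" if "f \<in> bergman_space \<alpha>" for f
      unfolding d1_def d2_def by (rule holomorphic2_on_has_derivative[OF bergman_spaceD(1)[OF that] z])
    have "((\<lambda>w. F m w - F n w) has_derivative (\<lambda>h. (d1 (F m) z * fst h + d2 (F m) z * snd h) - (d1 (F n) z * fst h + d2 (F n) z * snd h))) (at z)"
      by (intro has_derivative_diff * F)
    from has_derivative_unique[OF *[OF bergman_diff[OF \<alpha> F F]] this]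
    have eq: "d1 (\<lambda>w. F m w - F n w) z * fst h + d2 (\<lambda>w. F m w - F n w) z * snd h = (d1 (F m) z * fst h + d2 (F m) z * snd h) - (d1 (F n) z * fst h + d2 (F n) z * snd h)" for h
      by (rule fun_cong)
    show ?thesis using eq[of "(1,0)"] eq[of "(0,1)"] by simp
  qed
  have loc: "\<exists>r>0. ball z0 r \<subseteq> U_dom \<alpha> \<and> (\<exists>a b. \<forall>z\<in>ball z0 r. (\<lambda>n. F n z) \<longlonglongrightarrow> g z \<and> (g has_derivative (\<lambda>h. a z * fst h + b z * snd h)) (at z))"
    if z0: "z0 \<in> U_dom \<alpha>" for z0
  proof -
    obtain r M where r: "r > 0" "M > 0" "ball z0 r \<subseteq> U_dom \<alpha>" and bd: "\<And>f z. f\<in>bergman_space \<alpha> \<Longrightarrow> z\<in>ball z0 r \<Longrightarrow>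
      cmod (f z) \<le> M * l2_norm \<alpha> f \<and> cmod (d1 f z) \<le> M * l2_norm \<alpha> f \<and> cmod (d2 f z) \<le> M * l2_norm \<alpha> f"
      using bergman_local_bound[OF \<alpha> z0] unfolding d1_def d2_def by blast
    have unif: "\<exists>N. \<forall>m\<ge>N. \<forall>n\<ge>N. \<forall>z\<in>ball z0 r. cmod (F m z - F n z) \<le> e \<and> cmod (d1 (F m) z - d1 (F n) z) \<le> e \<and> cmod (d2 (F m) z - d2 (F n) z) \<le> e"
      if e: "e > 0" for e
    proof -
      obtain N where N: "\<And>m n. m \<ge> N \<Longrightarrow> n \<ge> N \<Longrightarrow> l2_norm \<alpha> (\<lambda>w. F m w - F n w) \<le> e / M"
        using Cau[of "e / M"] e r by auto
      have "cmod (F m z - F n z) \<le> e \<and> cmod (d1 (F m) z - d1 (F n) z) \<le> e \<and> cmod (d2 (F m) z - d2 (F n) z) \<le> e"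
        if "m \<ge> N" "n \<ge> N" "z \<in> ball z0 r" for m n z
      proof -
        have zU: "z \<in> U_dom \<alpha>" using that r by blast
        have "M * l2_norm \<alpha> (\<lambda>w. F m w - F n w) \<le> e"
          using N[OF that(1,2)] r by (simp add: field_simps)
        then show ?thesis using bd[OF bergman_diff[OF \<alpha> F F, of m n] that(3)] d12[OF zU, of m n]
          by (auto intro: order_trans)
      qed
      then show ?thesis by blast
    qed
    have conv: "convergent (\<lambda>n. F n z) \<and> convergent (\<lambda>n. d1 (F n) z) \<and> convergent (\<lambda>n. d2 (F n) z)" if z: "z \<in> ball z0 r" for z
    proof -
      have "\<exists>N. \<forall>m\<ge>N. \<forall>n\<ge>N. norm (F m z - F n z) < e \<and> norm (d1 (F m) z - d1 (F n) z) < e \<and> norm (d2 (F m) z - d2 (F n) z) < e" if epos: "e > 0" for e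
      proof -
        obtain N where N: "\<forall>m\<ge>N. \<forall>n\<ge>N. \<forall>z\<in>ball z0 r. cmod (F m z - F n z) \<le> e/2 \<and> cmod (d1 (F m) z - d1 (F n) z) \<le> e/2 \<and> cmod (d2 (F m) z - d2 (F n) z) \<le> e/2"
          using unif[of "e/2"] epos by auto
        have "e/2 < e" using epos by simp
        then show ?thesis using N z by (intro exI[of _ N]) (blast intro: le_less_trans)
      qed
      then show ?thesis unfolding Cauchy_convergent_iff[symmetric] Cauchy_iff by meson
    qed
    have lF: "(\<lambda>n. F n z) \<longlonglongrightarrow> g z" if "z \<in> ball z0 r" for z
      using conv[OF that] that r by (auto simp: g_def convergent_LIMSEQ_iff)
    define a where "a = (\<lambda>z. lim (\<lambda>n. d1 (F n) z))"
    define b where "b = (\<lambda>z. lim (\<lambda>n. d2 (F n) z))"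
    have la: "(\<lambda>n. d1 (F n) z) \<longlonglongrightarrow> a z" and lb: "(\<lambda>n. d2 (F n) z) \<longlonglongrightarrow> b z" if "z \<in> ball z0 r" for z
      using conv[OF that] by (auto simp: a_def b_def convergent_LIMSEQ_iff)
    have close: "\<exists>N. \<forall>n\<ge>N. \<forall>z\<in>ball z0 r. cmod (d1 (F n) z - a z) \<le> e \<and> cmod (d2 (F n) z - b z) \<le> e" if e: "e > 0" for e
    proof -
      obtain N where N: "\<And>m n z. m \<ge> N \<Longrightarrow> n \<ge> N \<Longrightarrow> z\<in>ball z0 r \<Longrightarrow> cmod (d1 (F m) z - d1 (F n) z) \<le> e \<and> cmod (d2 (F m) z - d2 (F n) z) \<le> e"
        using unif[OF e] by blast
      have "cmod (d1 (F n) z - a z) \<le> e \<and> cmod (d2 (F n) z - b z) \<le> e" if "n \<ge> N" "z \<in> ball z0 r" for n z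
      proof
        show "cmod (d1 (F n) z - a z) \<le> e"
          by (rule LIMSEQ_le_const2[OF tendsto_norm[OF tendsto_diff[OF tendsto_const la[OF that(2)]]]]) (use N[OF that(1) _ that(2)] in blast)
        show "cmod (d2 (F n) z - b z) \<le> e"
          by (rule LIMSEQ_le_const2[OF tendsto_norm[OF tendsto_diff[OF tendsto_const lb[OF that(2)]]]]) (use N[OF that(1) _ that(2)] in blast)
      qed
      then show ?thesis by blast
    qed
    \<comment> \<open>Uniform convergence of the complex linear derivatives makes the limit differentiable with complex linear derivative.\<close>
    have seq1: "(F n has_derivative (\<lambda>h. d1 (F n) z * fst h + d2 (F n) z * snd h)) (at z within ball z0 r)" if "z \<in> ball z0 r" for n z
        unfolding d1_def d2_def by (rule has_derivative_at_withinI, rule holomorphic2_on_has_derivative[OF bergman_spaceD(1)[OF F]]) (use that r in auto)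
    have seq2: "\<forall>\<^sub>F n in sequentially. \<forall>z\<in>ball z0 r. \<forall>h. norm ((d1 (F n) z * fst h + d2 (F n) z * snd h) - (a z * fst h + b z * snd h)) \<le> e * norm h" if e: "e > 0" for e
      proof -
        obtain N where N: "\<And>n z. n \<ge> N \<Longrightarrow> z\<in>ball z0 r \<Longrightarrow> cmod (d1 (F n) z - a z) \<le> e / 2 \<and> cmod (d2 (F n) z - b z) \<le> e / 2"
          using close[OF half_gt_zero[OF e]] by blast
        have "norm ((d1 (F n) z * fst h + d2 (F n) z * snd h) - (a z * fst h + b z * snd h)) \<le> e * norm h" if "n \<ge> N" "z \<in> ball z0 r" for n z h
        proof -
          have "(d1 (F n) z * fst h + d2 (F n) z * snd h) - (a z * fst h + b z * snd h) = (d1 (F n) z - a z) * fst h + (d2 (F n) z - b z) * snd h"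
            by (simp add: algebra_simps)
          also have "norm \<dots> \<le> cmod (d1 (F n) z - a z) * cmod (fst h) + cmod (d2 (F n) z - b z) * cmod (snd h)"
            by (intro norm_triangle_le) (simp add: norm_mult)
          also have "\<dots> \<le> e/2 * norm h + e/2 * norm h"
            using N[OF that] e norm_fst_le[of "fst h" "snd h"] norm_snd_le[of "snd h" "fst h"]
            by (intro add_mono mult_mono) auto
          finally show ?thesis by simp
        qed
        then show ?thesis unfolding eventually_sequentially by blast
      qed
    have "z0 \<in> ball z0 r" "(\<lambda>n. F n z0) \<longlonglongrightarrow> g z0" using r lF[of z0] by auto
    from has_derivative_sequence[where f = F and S = "ball z0 r" and l = "g z0"
          and f' = "\<lambda>n z h. d1 (F n) z * fst h + d2 (F n) z * snd h" and g' = "\<lambda>z h. a z * fst h + b z * snd h",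
          OF convex_ball seq1 seq2 this]
    have "\<exists>G. \<forall>z\<in>ball z0 r. (\<lambda>n. F n z) \<longlonglongrightarrow> G z \<and> (G has_derivative (\<lambda>h. a z * fst h + b z * snd h)) (at z within ball z0 r)"
      .
    then obtain G where G: "\<And>z. z\<in>ball z0 r \<Longrightarrow> (\<lambda>n. F n z) \<longlonglongrightarrow> G z"
      "\<And>z. z\<in>ball z0 r \<Longrightarrow> (G has_derivative (\<lambda>h. a z * fst h + b z * snd h)) (at z within ball z0 r)" by blast
    have "g z = G z" if "z \<in> ball z0 r" for z using LIMSEQ_unique[OF lF[OF that] G(1)[OF that]] .
    then have "(g has_derivative (\<lambda>h. a z * fst h + b z * snd h)) (at z)" if "z \<in> ball z0 r" for z
      using has_derivative_transform[OF that _ G(2)[OF that], of g] at_within_open[OF that] by auto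
    then show ?thesis using r lF by blast
  qed
  have lim: "(\<lambda>n. F n z) \<longlonglongrightarrow> g z" for z
  proof (cases "z \<in> U_dom \<alpha>")
    case True
    then show ?thesis using loc[OF True] by (meson centre_in_ball)
  next
    case False
    then show ?thesis using bergman_spaceD(3)[OF F] by (simp add: g_def)
  qed
  have hol: "holomorphic2_on g (U_dom \<alpha>)" unfolding holomorphic2_on_def
  proof
    fix z0 assume "z0 \<in> U_dom \<alpha>"
    from loc[OF this] show "\<exists>a b. (g has_derivative (\<lambda>h. a * fst h + b * snd h)) (at z0)" by (meson centre_in_ball)
  qed
  note [measurable] = bergman_measurable[OF \<alpha> F]
  have [measurable]: "g \<in> borel_measurable borel" by (rule borel_measurable_LIMSEQ_metric[OF _ lim]) simp
  have fatou: "(\<integral>\<^sup>+w\<in>U_dom \<alpha>. ennreal ((cmod (F n w - g w))\<^sup>2) \<partial>lborel) \<le> ennreal (e\<^sup>2)"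
    if N: "\<And>m. m \<ge> N \<Longrightarrow> l2_norm \<alpha> (\<lambda>w. F n w - F m w) \<le> e" for n e N
  proof -
    have "(\<integral>\<^sup>+w\<in>U_dom \<alpha>. ennreal ((cmod (F n w - g w))\<^sup>2) \<partial>lborel) =
      (\<integral>\<^sup>+w. liminf (\<lambda>m. ennreal ((cmod (F n w - F m w))\<^sup>2) * indicator (U_dom \<alpha>) w) \<partial>lborel)"
    proof (intro nn_integral_cong)
      fix w
      have "(\<lambda>m. ennreal ((cmod (F n w - F m w))\<^sup>2)) \<longlonglongrightarrow> ennreal ((cmod (F n w - g w))\<^sup>2)"
        by (intro tendsto_ennrealI tendsto_intros lim)
      then have "(\<lambda>m. ennreal ((cmod (F n w - F m w))\<^sup>2) * indicator (U_dom \<alpha>) w) \<longlonglongrightarrow> ennreal ((cmod (F n w - g w))\<^sup>2) * indicator (U_dom \<alpha>) w"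
        by (cases "w \<in> U_dom \<alpha>") auto
      then show "ennreal ((cmod (F n w - g w))\<^sup>2) * indicator (U_dom \<alpha>) w = liminf (\<lambda>m. ennreal ((cmod (F n w - F m w))\<^sup>2) * indicator (U_dom \<alpha>) w)"
        by (intro lim_imp_Liminf[symmetric]) auto
    qed
    also have "\<dots> \<le> liminf (\<lambda>m. \<integral>\<^sup>+w. ennreal ((cmod (F n w - F m w))\<^sup>2) * indicator (U_dom \<alpha>) w \<partial>lborel)"
      using \<alpha> by (intro nn_integral_liminf) measurable
    also have "\<dots> = liminf (\<lambda>m. ennreal ((l2_norm \<alpha> (\<lambda>w. F n w - F m w))\<^sup>2))"
      by (simp add: l2_nn_integral[OF bergman_subset_l2[OF \<alpha> bergman_diff[OF \<alpha> F F]]])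
    also have "\<dots> \<le> ennreal (e\<^sup>2)"
    proof (rule Liminf_le)
      show "\<forall>\<^sub>F m in sequentially. ennreal ((l2_norm \<alpha> (\<lambda>w. F n w - F m w))\<^sup>2) \<le> ennreal (e\<^sup>2)"
        unfolding eventually_sequentially using N l2_norm_nonneg by (intro exI[of _ N]) (auto intro!: ennreal_leI power_mono)
    qed auto
    finally show ?thesis .
  qed
  have dl2: "(\<lambda>w. F n w - g w) \<in> l2_space \<alpha>" if "\<And>m. m \<ge> N \<Longrightarrow> l2_norm \<alpha> (\<lambda>w. F n w - F m w) \<le> e" for n e N
  proof -
    have "integrable lborel (\<lambda>w. indicator (U_dom \<alpha>) w *\<^sub>R (cmod (F n w - g w))\<^sup>2)"
    proof (rule integrableI_bounded)
      have "(\<integral>\<^sup>+w. ennreal (norm (indicator (U_dom \<alpha>) w *\<^sub>R (cmod (F n w - g w))\<^sup>2)) \<partial>lborel) = (\<integral>\<^sup>+w\<in>U_dom \<alpha>. ennreal ((cmod (F n w - g w))\<^sup>2) \<partial>lborel)"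
        by (intro nn_integral_cong) (auto split: split_indicator)
      also have "\<dots> \<le> ennreal (e\<^sup>2)" by (rule fatou[OF that])
      finally show "(\<integral>\<^sup>+w. ennreal (norm (indicator (U_dom \<alpha>) w *\<^sub>R (cmod (F n w - g w))\<^sup>2)) \<partial>lborel) < \<infinity>"
        by (auto simp: less_top[symmetric] top_unique)
    qed (use \<alpha> in measurable)
    then show ?thesis by (simp add: l2_space_def set_integrable_def)
  qed
  obtain N1 where N1: "\<And>m n. m \<ge> N1 \<Longrightarrow> n \<ge> N1 \<Longrightarrow> l2_norm \<alpha> (\<lambda>w. F m w - F n w) \<le> 1" using Cau[of 1] by auto
  have "(\<lambda>w. F N1 w + (-1) * (F N1 w - g w)) \<in> l2_space \<alpha>"
    by (intro l2_space_lincomb[OF \<alpha>] bergman_subset_l2[OF \<alpha> F] dl2[of N1 N1 1] N1) auto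
  then have "g \<in> l2_space \<alpha>" by simp
  then have gA: "g \<in> bergman_space \<alpha>" using hol by (auto simp: bergman_space_def l2_space_def g_def)
  moreover have "(\<lambda>n. l2_norm \<alpha> (\<lambda>w. F n w - g w)) \<longlonglongrightarrow> 0"
  proof (rule LIMSEQ_I)
    fix e :: real assume e: "e > 0"
    obtain N where N: "\<And>m n. m \<ge> N \<Longrightarrow> n \<ge> N \<Longrightarrow> l2_norm \<alpha> (\<lambda>w. F m w - F n w) \<le> e/2" using Cau[of "e/2"] e by auto
    have "norm (l2_norm \<alpha> (\<lambda>w. F n w - g w) - 0) < e" if "n \<ge> N" for n
    proof -
      have "ennreal ((l2_norm \<alpha> (\<lambda>w. F n w - g w))\<^sup>2) \<le> ennreal ((e/2)\<^sup>2)"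
        using fatou[of N n "e/2"] N[OF that] l2_nn_integral[OF bergman_subset_l2[OF \<alpha> bergman_diff[OF \<alpha> F gA]]] by simp
      then have "(l2_norm \<alpha> (\<lambda>w. F n w - g w))\<^sup>2 \<le> (e/2)\<^sup>2" by simp
      then have "l2_norm \<alpha> (\<lambda>w. F n w - g w) \<le> e/2" by (rule power2_le_imp_le) (use e in auto)
      then show ?thesis using e l2_norm_nonneg[of \<alpha>] by simp
    qed
    then show "\<exists>N. \<forall>n\<ge>N. norm (l2_norm \<alpha> (\<lambda>w. F n w - g w) - 0) < e" by blast
  qed
  ultimately show ?thesis by blast
qed

section \<open>Riesz representation and the reproducing kernel\<close>

text \<open>The representing element minimises \<open>\<parallel>f\<parallel>\<^sup>2 - 2 Re (\<Lambda> f)\<close>. The parallelogram identity makes a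
  minimising sequence a Cauchy sequence, and the first variation at the limit vanishes.\<close>

lemma bergman_Riesz:
  assumes \<alpha>: "\<alpha> > 0"
    and add: "\<And>f g t. f \<in> bergman_space \<alpha> \<Longrightarrow> g \<in> bergman_space \<alpha> \<Longrightarrow> \<Lambda> (\<lambda>w. f w + t * g w) = \<Lambda> f + t * \<Lambda> g"
    and bdd: "\<And>f. f \<in> bergman_space \<alpha> \<Longrightarrow> cmod (\<Lambda> f) \<le> L * l2_norm \<alpha> f"
  shows "\<exists>g\<in>bergman_space \<alpha>. \<forall>f\<in>bergman_space \<alpha>. \<Lambda> f = l2_inner \<alpha> f g"
proof -
  define Q where "Q = (\<lambda>f. (l2_norm \<alpha> f)\<^sup>2 - 2 * Re (\<Lambda> f))"
  note l2 = bergman_subset_l2[OF \<alpha>]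
  have Qadd: "Q (\<lambda>w. f w + t * h w) = Q f + 2 * Re (t * (l2_inner \<alpha> h f - \<Lambda> h)) + (cmod t)\<^sup>2 * (l2_norm \<alpha> h)\<^sup>2"
    if "f \<in> bergman_space \<alpha>" "h \<in> bergman_space \<alpha>" for f h t
    unfolding Q_def l2_norm_lincomb[OF \<alpha> l2[OF that(1)] l2[OF that(2)]] add[OF that]
    by (simp add: algebra_simps)
  have Qlow: "- L\<^sup>2 \<le> Q f" if "f \<in> bergman_space \<alpha>" for f
  proof -
    have "Re (\<Lambda> f) \<le> L * l2_norm \<alpha> f" using bdd[OF that] complex_Re_le_cmod[of "\<Lambda> f"] by linarith
    then show ?thesis using zero_le_power2[of "l2_norm \<alpha> f - L"] unfolding Q_def power2_diff by (simp add: algebra_simps)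
  qed
  define m where "m = Inf (Q ` bergman_space \<alpha>)"
  have bb: "bdd_below (Q ` bergman_space \<alpha>)" using Qlow by (intro bdd_belowI2[of _ "- L\<^sup>2"])
  have mle: "m \<le> Q f" if "f \<in> bergman_space \<alpha>" for f
    unfolding m_def by (rule cInf_lower[OF _ bb]) (use that in auto)
  have "\<exists>f\<in>bergman_space \<alpha>. Q f < m + 1 / real (Suc n)" for n
  proof -
    have "Inf (Q ` bergman_space \<alpha>) < m + 1 / real (Suc n)" by (simp add: m_def)
    then show ?thesis using cInf_less_iff[OF _ bb] zero_in_bergman by blast
  qed
  define \<epsilon> where "\<epsilon> = (\<lambda>n. 1 / real (Suc n))"
  have "\<exists>f\<in>bergman_space \<alpha>. Q f < m + \<epsilon> n" for n
    unfolding \<epsilon>_def by fact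
  then obtain F where F: "\<And>n. F n \<in> bergman_space \<alpha>" "\<And>n. Q (F n) < m + \<epsilon> n" by metis
  have Fle: "Q (F n) - m \<le> \<epsilon> n" for n using less_imp_le[OF F(2)[of n]] by (simp only: diff_le_eq add.commute)
  have par: "(l2_norm \<alpha> (\<lambda>w. F j w - F k w))\<^sup>2 \<le> 2 / real (Suc j) + 2 / real (Suc k)" for j k
  proof -
    define h where "h = (\<lambda>w. F k w - F j w)"
    have h: "h \<in> bergman_space \<alpha>" unfolding h_def by (rule bergman_diff[OF \<alpha> F(1) F(1)])
    define c where "c = l2_inner \<alpha> h (F j) - \<Lambda> h"
    define N where "N = (l2_norm \<alpha> h)\<^sup>2"
    have "(\<lambda>w. F j w + 1 * h w) = F k" by (simp add: h_def)
    then have 1: "Q (F k) = Q (F j) + 2 * Re c + N"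
      using Qadd[OF F(1) h, of j 1] by (simp add: c_def N_def)
    have "m \<le> Q (\<lambda>w. F j w + (1/2) * h w)" by (intro mle bergman_lincomb[OF \<alpha> F(1) h])
    also have "\<dots> = Q (F j) + Re c + N / 4"
      using Qadd[OF F(1) h, of j "1/2"] by (simp add: c_def N_def power_divide)
    finally have "N \<le> 2 * (Q (F j) - m) + 2 * (Q (F k) - m)" using 1 by simp
    also have "\<dots> \<le> 2 * \<epsilon> j + 2 * \<epsilon> k"
      using Fle[of j] Fle[of k] by (intro add_mono mult_left_mono) auto
    finally have "N \<le> 2 / real (Suc j) + 2 / real (Suc k)" by (simp add: \<epsilon>_def)
    moreover have "l2_norm \<alpha> (\<lambda>w. F j w - F k w) = l2_norm \<alpha> h"
      unfolding l2_norm_def h_def by (simp add: norm_minus_commute)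
    ultimately show ?thesis by (simp add: N_def)
  qed
  have "\<exists>N. \<forall>j\<ge>N. \<forall>k\<ge>N. l2_norm \<alpha> (\<lambda>w. F j w - F k w) \<le> e" if e: "e > 0" for e
  proof -
    obtain N where N: "4 / e\<^sup>2 < real N" using reals_Archimedean2 by blast
    have "l2_norm \<alpha> (\<lambda>w. F j w - F k w) \<le> e" if "j \<ge> N" "k \<ge> N" for j k
    proof (rule power2_le_imp_le)
      have p: "0 < real N" using N e by (smt (verit) divide_pos_pos zero_less_power)
      have "2 / real (Suc j) + 2 / real (Suc k) \<le> 2 / real N + 2 / real N"
        using that p by (intro add_mono divide_left_mono) auto
      also have "\<dots> \<le> e\<^sup>2" using N p e by (simp add: field_simps)
      finally show "(l2_norm \<alpha> (\<lambda>w. F j w - F k w))\<^sup>2 \<le> e\<^sup>2" using par[of j k] by simp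
    qed (use e in auto)
    then show ?thesis by blast
  qed
  from bergman_complete[OF \<alpha> F(1) this] obtain g where g: "g \<in> bergman_space \<alpha>"
    and lim: "(\<lambda>n. l2_norm \<alpha> (\<lambda>w. F n w - g w)) \<longlonglongrightarrow> 0" by blast
  have "\<Lambda> h = l2_inner \<alpha> h g" if h: "h \<in> bergman_space \<alpha>" for h
  proof -
    define c where "c = l2_inner \<alpha> h g - \<Lambda> h"
    define N where "N = (l2_norm \<alpha> h)\<^sup>2"
    have Fc: "(\<lambda>n. l2_inner \<alpha> h (F n)) \<longlonglongrightarrow> l2_inner \<alpha> h g"
    proof (rule Lim_transform_bound[of "\<lambda>n. l2_inner \<alpha> h (F n) - l2_inner \<alpha> h g" "\<lambda>n. l2_norm \<alpha> h * l2_norm \<alpha> (\<lambda>w. F n w - g w)", THEN LIM_zero_cancel])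
      have "cmod (l2_inner \<alpha> h (F n) - l2_inner \<alpha> h g) \<le> l2_norm \<alpha> h * l2_norm \<alpha> (\<lambda>w. F n w - g w)" for n
      proof -
        have "l2_inner \<alpha> (\<lambda>w. F n w + (-1) * g w) h = l2_inner \<alpha> (F n) h + (-1) * l2_inner \<alpha> g h"
          by (intro l2_inner_lincomb_left[OF \<alpha>] l2 F g h)
        then have "l2_inner \<alpha> h (\<lambda>w. F n w - g w) = l2_inner \<alpha> h (F n) - l2_inner \<alpha> h g"
          using l2_inner_cnj[of \<alpha> h "\<lambda>w. F n w - g w"] l2_inner_cnj[of \<alpha> h "F n"] l2_inner_cnj[of \<alpha> h g] by simp
        then show ?thesis
          using l2_Cauchy_Schwarz[OF \<alpha> l2[OF h] l2[OF bergman_diff[OF \<alpha> F(1) g]], of n] by simp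
      qed
      then show "\<forall>\<^sub>F n in sequentially. norm (l2_inner \<alpha> h (F n) - l2_inner \<alpha> h g) \<le> norm (l2_norm \<alpha> h * l2_norm \<alpha> (\<lambda>w. F n w - g w))"
        by (intro always_eventually allI) (simp add: l2_norm_nonneg)
      show "(\<lambda>n. l2_norm \<alpha> h * l2_norm \<alpha> (\<lambda>w. F n w - g w)) \<longlonglongrightarrow> 0"
        using tendsto_mult_right_zero[OF lim] .
    qed
    have ge: "0 \<le> 2 * Re (t * c) + (cmod t)\<^sup>2 * N" for t
    proof (rule LIMSEQ_le_const)
      have "\<epsilon> \<longlonglongrightarrow> 0" unfolding \<epsilon>_def by (rule LIMSEQ_inverse_real_of_nat[unfolded inverse_eq_divide])
      then have "(\<lambda>n. 2 * Re (t * (l2_inner \<alpha> h (F n) - \<Lambda> h)) + (cmod t)\<^sup>2 * N + \<epsilon> n) \<longlonglongrightarrow> 2 * Re (t * (l2_inner \<alpha> h g - \<Lambda> h)) + (cmod t)\<^sup>2 * N + 0"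
        by (intro tendsto_intros Fc)
      then show "(\<lambda>n. 2 * Re (t * (l2_inner \<alpha> h (F n) - \<Lambda> h)) + (cmod t)\<^sup>2 * N + \<epsilon> n) \<longlonglongrightarrow> 2 * Re (t * c) + (cmod t)\<^sup>2 * N"
        by (simp add: c_def)
      have "0 \<le> 2 * Re (t * (l2_inner \<alpha> h (F n) - \<Lambda> h)) + (cmod t)\<^sup>2 * N + \<epsilon> n" for n
      proof -
        have "m \<le> Q (F n) + 2 * Re (t * (l2_inner \<alpha> h (F n) - \<Lambda> h)) + (cmod t)\<^sup>2 * N"
          using mle[OF bergman_lincomb[OF \<alpha> F(1)[of n] h, of t]] unfolding Qadd[OF F(1) h] N_def .
        then show ?thesis using Fle[of n] by simp
      qed
      then show "\<exists>K. \<forall>n\<ge>K. 0 \<le> 2 * Re (t * (l2_inner \<alpha> h (F n) - \<Lambda> h)) + (cmod t)\<^sup>2 * N + \<epsilon> n" by blast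
    qed
    have N: "N \<ge> 0" by (simp add: N_def)
    define s where "s = 1 / (N + 1)"
    have s: "s > 0" "s * N < 2" using N by (auto simp: s_def field_simps)
    \<comment> \<open>For small \<open>s > 0\<close> the choice \<open>t = - s * cnj c\<close> contradicts minimality unless \<open>c = 0\<close>.\<close>
    have "0 \<le> 2 * Re (- of_real s * cnj c * c) + (cmod (- of_real s * cnj c))\<^sup>2 * N" by (rule ge)
    also have "- of_real s * cnj c * c = of_real (- s * (cmod c)\<^sup>2)"
      by (simp only: of_real_mult of_real_minus complex_norm_square mult_ac)
    also have "(cmod (- of_real s * cnj c))\<^sup>2 = s\<^sup>2 * (cmod c)\<^sup>2" by (simp add: norm_mult power_mult_distrib)
    finally have "0 \<le> (cmod c)\<^sup>2 * (s * (s * N - 2))" by (simp add: algebra_simps power2_eq_square)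
    moreover have "s * (s * N - 2) < 0" using s by (simp add: mult_pos_neg)
    ultimately have "\<not> 0 < (cmod c)\<^sup>2" using mult_pos_neg[of "(cmod c)\<^sup>2" "s * (s * N - 2)"] by (metis not_less)
    then show ?thesis by (simp add: c_def)
  qed
  then show ?thesis using g by blast
qed

text \<open>Point evaluations are represented by the Riesz theorem. Uniqueness is what turns the definite
  description in the definition of the kernel into a usable function.\<close>

lemma bergman_kernel_props:
  assumes \<alpha>: "\<alpha> > 0" and z: "z \<in> U_dom \<alpha>"
  shows "bergman_kernel \<alpha> z \<in> bergman_space \<alpha>"
    and "f \<in> bergman_space \<alpha> \<Longrightarrow> l2_inner \<alpha> f (bergman_kernel \<alpha> z) = f z"
proof -
  note l2 = bergman_subset_l2[OF \<alpha>]
  obtain C where C: "C > 0" "\<And>f z. f\<in>bergman_space \<alpha> \<Longrightarrow> z\<in>U_dom \<alpha> \<Longrightarrow>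
    (cmod (f z))\<^sup>2 \<le> C / ((1 - (cmod (snd z))\<^sup>2) powr (2 + \<alpha>) * (1 - (cmod (f_alpha \<alpha> z))\<^sup>2) ^ 3) * (l2_norm \<alpha> f)\<^sup>2"
    using ex_bergman_point_bound[OF \<alpha>] by blast
  define W where "W = (\<lambda>z. C / ((1 - (cmod (snd z))\<^sup>2) powr (2 + \<alpha>) * (1 - (cmod (f_alpha \<alpha> z))\<^sup>2) ^ 3))"
  have "\<exists>g\<in>bergman_space \<alpha>. \<forall>f\<in>bergman_space \<alpha>. f z = l2_inner \<alpha> f g"
  proof (rule bergman_Riesz[OF \<alpha>])
    fix f assume f: "f \<in> bergman_space \<alpha>"
    have "(cmod (f z))\<^sup>2 \<le> W z * (l2_norm \<alpha> f)\<^sup>2" unfolding W_def by (rule C(2)[OF f z])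
    also have "\<dots> \<le> \<bar>W z\<bar> * (l2_norm \<alpha> f)\<^sup>2" by (intro mult_right_mono) auto
    also have "\<dots> = (sqrt \<bar>W z\<bar> * l2_norm \<alpha> f)\<^sup>2" by (simp add: power_mult_distrib)
    finally show "cmod (f z) \<le> sqrt \<bar>W z\<bar> * l2_norm \<alpha> f"
      by (rule power2_le_imp_le) (simp add: l2_norm_nonneg)
  qed auto
  then obtain g where g: "g \<in> bergman_space \<alpha>" "\<And>f. f\<in>bergman_space \<alpha> \<Longrightarrow> l2_inner \<alpha> f g = f z" by metis
  have uniq: "K = g" if K: "K \<in> bergman_space \<alpha>" "\<forall>f\<in>bergman_space \<alpha>. l2_inner \<alpha> f K = f z" for K
  proof -
    define d where "d = (\<lambda>w. K w - g w)"
    have d: "d \<in> bergman_space \<alpha>" unfolding d_def by (rule bergman_diff[OF \<alpha> K(1) g(1)])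
    have "l2_inner \<alpha> (\<lambda>w. K w + (-1) * g w) d = l2_inner \<alpha> K d + (-1) * l2_inner \<alpha> g d"
      by (intro l2_inner_lincomb_left[OF \<alpha>] l2 K g d)
    moreover have "l2_inner \<alpha> K d = cnj (d z)" "l2_inner \<alpha> g d = cnj (d z)"
      using K(2) g(2)[OF d] d l2_inner_cnj[of \<alpha> K d] l2_inner_cnj[of \<alpha> g d] by auto
    ultimately have "l2_inner \<alpha> d d = 0" by (simp add: d_def)
    then have "(l2_norm \<alpha> d)\<^sup>2 = 0" unfolding l2_inner_self by (simp only: of_real_eq_0_iff)
    then have "d w = 0" for w
      using C(2)[OF d, of w] bergman_spaceD(3)[OF d, of w] by (cases "w \<in> U_dom \<alpha>") auto
    then show ?thesis by (auto simp: d_def fun_eq_iff)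
  qed
  have "bergman_kernel \<alpha> z = g"
    unfolding bergman_kernel_def
  proof (rule the_equality)
    show "g \<in> bergman_space \<alpha> \<and> (\<forall>f\<in>bergman_space \<alpha>. l2_inner \<alpha> f g = f z)" using g by simp
    show "K = g" if "K \<in> bergman_space \<alpha> \<and> (\<forall>f\<in>bergman_space \<alpha>. l2_inner \<alpha> f K = f z)" for K
      using uniq[of K] that by simp
  qed
  then show "bergman_kernel \<alpha> z \<in> bergman_space \<alpha>"
    "f \<in> bergman_space \<alpha> \<Longrightarrow> l2_inner \<alpha> f (bergman_kernel \<alpha> z) = f z" using g by auto
qed

lemma emeasure_U_dom_finite:
  assumes \<alpha>: "\<alpha> > 0" shows "emeasure lborel (U_dom \<alpha>) < \<infinity>"
proof -
  have "U_dom \<alpha> \<subseteq> ball 0 1 \<times> ball 0 1" using U_dom_bounds[OF \<alpha>] by (auto simp: mem_Times_iff)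
  then have "bounded (U_dom \<alpha>)" by (rule bounded_subset[rotated]) (intro bounded_Times bounded_ball)
  then show ?thesis by (rule emeasure_bounded_finite)
qed

lemma indicator_in_bergman:
  assumes \<alpha>: "\<alpha> > 0" shows "indicator (U_dom \<alpha>) \<in> bergman_space \<alpha>"
proof -
  have "((indicator (U_dom \<alpha>) :: c2 \<Rightarrow> complex) has_derivative (\<lambda>h. 0 * fst h + 0 * snd h)) (at z)" if z: "z \<in> U_dom \<alpha>" for z
  proof -
    have "((\<lambda>w. 1 :: complex) has_derivative (\<lambda>h. 0 * fst h + 0 * snd h)) (at z)" by simp
    then show ?thesis
      by (rule has_derivative_transform_within_open[OF _ open_U_dom[OF \<alpha>] z]) auto
  qed
  moreover have "set_integrable lborel (U_dom \<alpha>) (\<lambda>w. (cmod (indicator (U_dom \<alpha>) w))\<^sup>2)"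
  proof -
    have "(\<lambda>w::c2. indicator (U_dom \<alpha>) w *\<^sub>R (cmod (indicator (U_dom \<alpha>) w))\<^sup>2) = indicator (U_dom \<alpha>)"
      by (auto simp: fun_eq_iff indicator_def)
    then show ?thesis unfolding set_integrable_def using emeasure_U_dom_finite[OF \<alpha>] \<alpha>
      by (simp add: integrable_indicator_iff)
  qed
  ultimately show ?thesis unfolding bergman_space_def holomorphic2_on_def
    by (intro CollectI conjI ballI exI[of _ 0]) (simp_all add: indicator_def)
qed

text \<open>Otherwise every function in the space would vanish at \<open>z\<close>; the constant \<open>1\<close> does not.\<close>

lemma l2_norm_kernel_pos:
  assumes \<alpha>: "\<alpha> > 0" and z: "z \<in> U_dom \<alpha>"
  shows "0 < l2_norm \<alpha> (bergman_kernel \<alpha> z)"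
proof (rule ccontr)
  note l2 = bergman_subset_l2[OF \<alpha>]
  assume "\<not> ?thesis"
  then have 0: "l2_norm \<alpha> (bergman_kernel \<alpha> z) = 0" using l2_norm_nonneg[of \<alpha>] by (meson not_less order_antisym)
  have "cmod (l2_inner \<alpha> (indicator (U_dom \<alpha>)) (bergman_kernel \<alpha> z)) \<le> 0"
    using l2_Cauchy_Schwarz[OF \<alpha> l2[OF indicator_in_bergman[OF \<alpha>]] l2[OF bergman_kernel_props(1)[OF \<alpha> z]]] by (simp add: 0)
  then show False using bergman_kernel_props(2)[OF \<alpha> z indicator_in_bergman[OF \<alpha>]] z by simp
qed

text \<open>Apply the bound for point evaluations to \<open>K\<^sub>z\<close> itself, whose value at \<open>z\<close> is the square of its
  norm.\<close>

lemma ex_kernel_norm_bound: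
  assumes \<alpha>: "\<alpha> > 0"
  shows "\<exists>C>0. \<forall>z\<in>U_dom \<alpha>. l2_norm \<alpha> (bergman_kernel \<alpha> z) \<le>
    C / ((1 - (cmod (snd z))\<^sup>2) powr (1 + \<alpha>/2) * (1 - (cmod (f_alpha \<alpha> z))\<^sup>2) powr (3/2))"
proof -
  obtain C where C: "C > 0" "\<And>f z. f\<in>bergman_space \<alpha> \<Longrightarrow> z\<in>U_dom \<alpha> \<Longrightarrow>
    (cmod (f z))\<^sup>2 \<le> C / ((1 - (cmod (snd z))\<^sup>2) powr (2 + \<alpha>) * (1 - (cmod (f_alpha \<alpha> z))\<^sup>2) ^ 3) * (l2_norm \<alpha> f)\<^sup>2"
    using ex_bergman_point_bound[OF \<alpha>] by blast
  have "l2_norm \<alpha> (bergman_kernel \<alpha> z) \<le>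
    sqrt C / ((1 - (cmod (snd z))\<^sup>2) powr (1 + \<alpha>/2) * (1 - (cmod (f_alpha \<alpha> z))\<^sup>2) powr (3/2))" if z: "z \<in> U_dom \<alpha>" for z
  proof -
    define K where "K = bergman_kernel \<alpha> z"
    define x where "x = 1 - (cmod (snd z))\<^sup>2"
    define y where "y = 1 - (cmod (f_alpha \<alpha> z))\<^sup>2"
    have xy: "x > 0" "y > 0" using U_dom_bounds[OF \<alpha> z] f_alpha_less_one[OF \<alpha> z] by (auto simp: x_def y_def abs_square_less_1)
    have K: "K \<in> bergman_space \<alpha>" unfolding K_def by (rule bergman_kernel_props[OF \<alpha> z])
    define N where "N = l2_norm \<alpha> K"
    have N: "N > 0" unfolding N_def K_def by (rule l2_norm_kernel_pos[OF \<alpha> z])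
    have "K z = of_real (N\<^sup>2)"
      unfolding N_def l2_inner_self[symmetric] using bergman_kernel_props(2)[OF \<alpha> z K] by (simp add: K_def)
    then have "(N\<^sup>2)\<^sup>2 \<le> C / (x powr (2 + \<alpha>) * y ^ 3) * N\<^sup>2"
      using C(2)[OF K z] by (simp add: norm_power N_def x_def y_def)
    then have "N\<^sup>2 * N\<^sup>2 \<le> C / (x powr (2 + \<alpha>) * y ^ 3) * N\<^sup>2" by (simp only: power2_eq_square[of "N\<^sup>2"])
    then have "N\<^sup>2 \<le> C / (x powr (2 + \<alpha>) * y ^ 3)" by (rule mult_right_le_imp_le) (use N in auto)
    also have "\<dots> = (sqrt C / (x powr (1 + \<alpha>/2) * y powr (3/2)))\<^sup>2"
    proof -
      have "(x powr (1 + \<alpha>/2))\<^sup>2 = x powr (2 + \<alpha>)" using xy by (simp add: power2_eq_square flip: powr_add)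
      moreover have "(y powr (3/2))\<^sup>2 = y ^ 3" using xy by (simp add: power2_eq_square powr_numeral flip: powr_add)
      ultimately show ?thesis using C by (simp add: power_divide power_mult_distrib)
    qed
    finally show ?thesis unfolding N_def[symmetric] K_def[symmetric] x_def[symmetric] y_def[symmetric]
      by (rule power2_le_imp_le) (use C xy in auto)
  qed
  then show ?thesis using C by (intro exI[of _ "sqrt C"]) auto
qed

section \<open>Integrals of Forelli--Rudin type over the disc\<close>

lemma nn_integral_powr_0:
  fixes e l :: real
  assumes "e < 1" "0 \<le> l"
  shows "(\<integral>\<^sup>+x\<in>{0..l}. ennreal (x powr (-e)) \<partial>lborel) = ennreal (l powr (1 - e) / (1 - e))"
  using nn_integral_has_integral_lebesgue'[OF _ has_integral_powr_from_0[of "-e" l]] assms by simp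

lemma nn_integral_powr_both_ends:
  fixes e l :: real
  assumes "e < 1" "0 < l"
  shows "(\<integral>\<^sup>+x\<in>{-l<..<l}. ennreal ((l - \<bar>x\<bar>) powr (-e)) \<partial>lborel) \<le> ennreal (2 * (l powr (1 - e) / (1 - e)))"
proof -
  have 1: "(\<integral>\<^sup>+x\<in>{0..l}. ennreal (x powr (-e)) \<partial>lborel) =
     (\<integral>\<^sup>+x. ennreal ((l + (-1) * x) powr (-e)) * indicator {0..l} (l + (-1) * x) \<partial>lborel)"
    by (subst nn_integral_real_affine[where c = "-1" and t = l]) auto
  have 2: "(\<integral>\<^sup>+x\<in>{0..l}. ennreal (x powr (-e)) \<partial>lborel) =
     (\<integral>\<^sup>+x. ennreal ((l + 1 * x) powr (-e)) * indicator {0..l} (l + 1 * x) \<partial>lborel)"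
    by (subst nn_integral_real_affine[where c = "1" and t = l]) auto
  have "(\<integral>\<^sup>+x\<in>{-l<..<l}. ennreal ((l - \<bar>x\<bar>) powr (-e)) \<partial>lborel) \<le>
     (\<integral>\<^sup>+x. ennreal ((l + (-1) * x) powr (-e)) * indicator {0..l} (l + (-1) * x) + ennreal ((l + 1 * x) powr (-e)) * indicator {0..l} (l + 1 * x) \<partial>lborel)"
    by (intro nn_integral_mono) (auto simp: indicator_def abs_if)
  also have "\<dots> = ennreal (l powr (1 - e) / (1 - e)) + ennreal (l powr (1 - e) / (1 - e))"
    using 1 2 nn_integral_powr_0[of e l] assms by (subst nn_integral_add) auto
  also have "\<dots> = ennreal (2 * (l powr (1 - e) / (1 - e)))"
    using assms by (subst ennreal_plus[symmetric]) auto
  finally show ?thesis .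
qed

lemma nn_integral_powr_abs:
  fixes e :: real
  assumes "e < 1"
  shows "(\<integral>\<^sup>+x\<in>{-1<..<1}. ennreal (\<bar>x\<bar> powr (-e)) \<partial>lborel) \<le> ennreal (2 / (1 - e))"
proof -
  have 1: "(\<integral>\<^sup>+x\<in>{0..1}. ennreal (x powr (-e)) \<partial>lborel) =
     (\<integral>\<^sup>+x. ennreal ((0 + (-1) * x) powr (-e)) * indicator {0..1} (0 + (-1) * x) \<partial>lborel)"
    by (subst nn_integral_real_affine[where c = "-1" and t = 0]) auto
  have "(\<integral>\<^sup>+x\<in>{-1<..<1}. ennreal (\<bar>x\<bar> powr (-e)) \<partial>lborel) \<le>
     (\<integral>\<^sup>+x. ennreal (x powr (-e)) * indicator {0..1} x + ennreal ((0 + (-1) * x) powr (-e)) * indicator {0..1} (0 + (-1) * x) \<partial>lborel)"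
    by (intro nn_integral_mono) (auto simp: indicator_def abs_if)
  also have "\<dots> = ennreal (1 / (1 - e)) + ennreal (1 / (1 - e))"
    using 1 nn_integral_powr_0[of e 1] assms by (subst nn_integral_add) auto
  also have "\<dots> = ennreal (2 / (1 - e))"
    using assms by (subst ennreal_plus[symmetric]) auto
  finally show ?thesis .
qed

text \<open>In Cartesian coordinates \<open>y = x + \<i>\<eta>\<close> with \<open>l = sqrt (1 - \<eta>\<^sup>2)\<close> one has
  \<open>1 - |y|\<^sup>2 \<ge> l (l - |x|)\<close> and, for real \<open>c\<close>, \<open>|1 - c y| \<ge> |\<eta>|/2\<close>. This separates the variables, and
  the remaining singularities are one-dimensional of order \<open>e < 1\<close>.\<close>

lemma disc_integral_real:
  fixes e c :: real
  assumes e: "0 \<le> e" "e < 1" and c: "0 \<le> c" "c < 1"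
  shows "(\<integral>\<^sup>+y\<in>ball 0 1. ennreal ((1 - (cmod y)\<^sup>2) powr (-e) * cmod (1 - of_real c * y) powr (-e)) \<partial>lborel)
    \<le> ennreal (2 powr (1 + 2 * e) / (1 - e) * (4 / (1 - e)))"
proof -
  define K where "K = 2 powr (1 + 2 * e) / (1 - e)"
  have K: "K \<ge> 0" using e by (simp add: K_def)
  have inner: "(\<integral>\<^sup>+x. ennreal ((1 - (cmod (Complex x \<eta>))\<^sup>2) powr (-e) * cmod (1 - of_real c * Complex x \<eta>) powr (-e)) * indicator (ball 0 1) (Complex x \<eta>) \<partial>lborel)
    \<le> ennreal K * (ennreal (\<bar>\<eta>\<bar> powr (-e)) * indicator {-1<..<1} \<eta> + ennreal ((1 - \<bar>\<eta>\<bar>) powr (-e)) * indicator {-1<..<1} \<eta>)"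
    if \<eta>: "\<eta> \<noteq> 0" for \<eta>
  proof (cases "\<bar>\<eta>\<bar> < 1")
    case False
    have "indicator (ball 0 1) (Complex x \<eta>) = (0::ennreal)" for x
      using abs_Im_le_cmod[of "Complex x \<eta>"] False by (simp add: indicator_def)
    then show ?thesis by simp
  next
    case True
    define l where "l = sqrt (1 - \<eta>\<^sup>2)"
    have l2: "l\<^sup>2 = 1 - \<eta>\<^sup>2" "0 < 1 - \<eta>\<^sup>2" using True by (auto simp: l_def abs_square_less_1 abs_square_le_1)
    have l: "0 < l" "l \<le> 1" using l2 by (auto simp: l_def)
    define M where "M = (2 powr e * \<bar>\<eta>\<bar> powr (-e)) * l powr (-e)"
    have M: "M \<ge> 0" by (simp add: M_def)
    have pt: "ennreal ((1 - (cmod (Complex x \<eta>))\<^sup>2) powr (-e) * cmod (1 - of_real c * Complex x \<eta>) powr (-e)) * indicator (ball 0 1) (Complex x \<eta>)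
      \<le> ennreal M * (ennreal ((l - \<bar>x\<bar>) powr (-e)) * indicator {-l<..<l} x)" for x
    proof (cases "cmod (Complex x \<eta>) < 1")
      case False
      then show ?thesis by simp
    next
      case inD: True
      then have "x\<^sup>2 + \<eta>\<^sup>2 < 1" by (simp add: cmod_def)
      then have "x\<^sup>2 < l\<^sup>2" using l2 by simp
      then have x: "\<bar>x\<bar> < l" using l power2_less_imp_less[of "\<bar>x\<bar>" l] by simp
      have "l * (l - \<bar>x\<bar>) \<le> (l + \<bar>x\<bar>) * (l - \<bar>x\<bar>)" using x l by (intro mult_right_mono) auto
      also have "\<dots> = l\<^sup>2 - x\<^sup>2" by (simp add: power2_eq_square algebra_simps)
      also have "\<dots> = 1 - (cmod (Complex x \<eta>))\<^sup>2" using l2 by (simp add: cmod_def)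
      finally have "(1 - (cmod (Complex x \<eta>))\<^sup>2) powr (-e) \<le> (l * (l - \<bar>x\<bar>)) powr (-e)"
        using x l e by (intro powr_mono2') auto
      also have "\<dots> = l powr (-e) * (l - \<bar>x\<bar>) powr (-e)" using x l by (simp add: powr_mult)
      finally have A: "(1 - (cmod (Complex x \<eta>))\<^sup>2) powr (-e) \<le> l powr (-e) * (l - \<bar>x\<bar>) powr (-e)" .
      have "\<bar>\<eta>\<bar> / 2 \<le> cmod (1 - of_real c * Complex x \<eta>)"
      proof (cases "c \<ge> 1/2")
        case True
        have "\<bar>\<eta>\<bar> / 2 \<le> c * \<bar>\<eta>\<bar>" using True mult_right_mono[of "1/2" c "\<bar>\<eta>\<bar>"] by simp
        also have "\<dots> = \<bar>Im (1 - of_real c * Complex x \<eta>)\<bar>" using c by (simp add: abs_mult)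
        finally show ?thesis using abs_Im_le_cmod order_trans by blast
      next
        case False
        have "cmod (of_real c * Complex x \<eta>) \<le> (1/2) * 1"
          unfolding norm_mult using False c inD by (intro mult_mono) auto
        then have "1/2 \<le> cmod (1 - of_real c * Complex x \<eta>)"
          using norm_triangle_ineq2[of 1 "of_real c * Complex x \<eta>"] by simp
        then show ?thesis using \<open>\<bar>\<eta>\<bar> < 1\<close> by simp
      qed
      then have "cmod (1 - of_real c * Complex x \<eta>) powr (-e) \<le> (\<bar>\<eta>\<bar> / 2) powr (-e)"
        using \<eta> e by (intro powr_mono2') auto
      also have "\<dots> = 2 powr e * \<bar>\<eta>\<bar> powr (-e)" by (simp add: powr_divide powr_minus_divide)
      finally have B: "cmod (1 - of_real c * Complex x \<eta>) powr (-e) \<le> 2 powr e * \<bar>\<eta>\<bar> powr (-e)" .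
      have "(1 - (cmod (Complex x \<eta>))\<^sup>2) powr (-e) * cmod (1 - of_real c * Complex x \<eta>) powr (-e) \<le>
        (l powr (-e) * (l - \<bar>x\<bar>) powr (-e)) * (2 powr e * \<bar>\<eta>\<bar> powr (-e))"
        by (intro mult_mono A B) auto
      also have "\<dots> = M * (l - \<bar>x\<bar>) powr (-e)" by (simp add: M_def)
      finally have "ennreal ((1 - (cmod (Complex x \<eta>))\<^sup>2) powr (-e) * cmod (1 - of_real c * Complex x \<eta>) powr (-e)) \<le> ennreal M * ennreal ((l - \<bar>x\<bar>) powr (-e))"
        using M by (simp add: ennreal_leI flip: ennreal_mult)
      moreover have "indicator {-l<..<l} x = (1::ennreal)" using x by (auto simp: indicator_def)
      ultimately show ?thesis using inD by simp
    qed
    have "(\<integral>\<^sup>+x. ennreal ((1 - (cmod (Complex x \<eta>))\<^sup>2) powr (-e) * cmod (1 - of_real c * Complex x \<eta>) powr (-e)) * indicator (ball 0 1) (Complex x \<eta>) \<partial>lborel)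
      \<le> (\<integral>\<^sup>+x. ennreal M * (ennreal ((l - \<bar>x\<bar>) powr (-e)) * indicator {-l<..<l} x) \<partial>lborel)"
      by (intro nn_integral_mono pt)
    also have "\<dots> = ennreal M * (\<integral>\<^sup>+x\<in>{-l<..<l}. ennreal ((l - \<bar>x\<bar>) powr (-e)) \<partial>lborel)"
      by (intro nn_integral_cmult) measurable
    also have "\<dots> \<le> ennreal M * ennreal (2 * (l powr (1 - e) / (1 - e)))"
      by (intro mult_left_mono nn_integral_powr_both_ends e l) auto
    also have "\<dots> = ennreal (M * (2 * (l powr (1 - e) / (1 - e))))"
      using M e by (simp flip: ennreal_mult)
    also have "\<dots> \<le> ennreal (K * (\<bar>\<eta>\<bar> powr (-e) + (1 - \<bar>\<eta>\<bar>) powr (-e)))"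
    proof (rule ennreal_leI)
      have "\<bar>\<eta>\<bar> * \<bar>\<eta>\<bar> \<le> \<bar>\<eta>\<bar> * 1" using True by (intro mult_left_mono) auto
      then have "1 - \<bar>\<eta>\<bar> \<le> 1 - \<eta>\<^sup>2" by (simp add: power2_eq_square)
      also have "1 - \<eta>\<^sup>2 = l * l" using l2 by (simp add: power2_eq_square)
      also have "\<dots> \<le> l * 1" using l by (intro mult_left_mono) auto
      finally have "1 - \<bar>\<eta>\<bar> \<le> l" by simp
      then have "l powr (-e) \<le> (1 - \<bar>\<eta>\<bar>) powr (-e)" using True e by (intro powr_mono2') auto
      moreover have "l powr (1 - e) \<le> 1" using l e by (intro powr_le1) auto
      ultimately have "l powr (-e) * l powr (1 - e) \<le> (1 - \<bar>\<eta>\<bar>) powr (-e) * 1" by (intro mult_mono) auto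
      then have "\<bar>\<eta>\<bar> powr (-e) * (l powr (-e) * l powr (1 - e)) \<le> \<bar>\<eta>\<bar> powr (-e) * (1 - \<bar>\<eta>\<bar>) powr (-e)" by (intro mult_left_mono) auto
      also have "\<dots> \<le> 2 powr e * (\<bar>\<eta>\<bar> powr (-e) + (1 - \<bar>\<eta>\<bar>) powr (-e))"
      proof -
        have h: "(1/2::real) powr (-e) = 2 powr e" by (simp add: powr_divide powr_minus_divide)
        show ?thesis
        proof (cases "\<bar>\<eta>\<bar> \<le> 1/2")
          case True
          then have "(1 - \<bar>\<eta>\<bar>) powr (-e) \<le> (1/2) powr (-e)" using e by (intro powr_mono2') auto
          then have "\<bar>\<eta>\<bar> powr (-e) * (1 - \<bar>\<eta>\<bar>) powr (-e) \<le> \<bar>\<eta>\<bar> powr (-e) * 2 powr e" unfolding h by (intro mult_left_mono) auto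
          also have "\<dots> = 2 powr e * \<bar>\<eta>\<bar> powr (-e)" by (rule mult.commute)
          also have "\<dots> \<le> 2 powr e * (\<bar>\<eta>\<bar> powr (-e) + (1 - \<bar>\<eta>\<bar>) powr (-e))" by (intro mult_left_mono) auto
          finally show ?thesis .
        next
          case False
          then have "\<bar>\<eta>\<bar> powr (-e) \<le> (1/2) powr (-e)" using e by (intro powr_mono2') auto
          then have "\<bar>\<eta>\<bar> powr (-e) * (1 - \<bar>\<eta>\<bar>) powr (-e) \<le> 2 powr e * (1 - \<bar>\<eta>\<bar>) powr (-e)" unfolding h by (intro mult_right_mono) auto
          also have "\<dots> \<le> 2 powr e * (\<bar>\<eta>\<bar> powr (-e) + (1 - \<bar>\<eta>\<bar>) powr (-e))" by (intro mult_left_mono) auto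
          finally show ?thesis .
        qed
      qed
      finally have fin: "\<bar>\<eta>\<bar> powr (-e) * (l powr (-e) * l powr (1 - e)) \<le> 2 powr e * (\<bar>\<eta>\<bar> powr (-e) + (1 - \<bar>\<eta>\<bar>) powr (-e))" .
      have "M * (2 * (l powr (1 - e) / (1 - e))) = (2 * 2 powr e / (1 - e)) * (\<bar>\<eta>\<bar> powr (-e) * (l powr (-e) * l powr (1 - e)))"
        by (simp add: M_def mult_ac)
      also have "\<dots> \<le> (2 * 2 powr e / (1 - e)) * (2 powr e * (\<bar>\<eta>\<bar> powr (-e) + (1 - \<bar>\<eta>\<bar>) powr (-e)))"
        using e by (intro mult_left_mono fin) auto
      also have "\<dots> = K * (\<bar>\<eta>\<bar> powr (-e) + (1 - \<bar>\<eta>\<bar>) powr (-e))"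
      proof -
        have "(2::real) powr (1 + 2 * e) = 2 powr (1 + e + e)" by (rule arg_cong) simp
        also have "\<dots> = 2 * 2 powr e * 2 powr e" by (simp only: powr_add) simp
        finally have "2 powr (1 + 2 * e) = 2 * 2 powr e * 2 powr e" .
        then show ?thesis unfolding K_def by simp
      qed
      finally show "M * (2 * (l powr (1 - e) / (1 - e))) \<le> K * (\<bar>\<eta>\<bar> powr (-e) + (1 - \<bar>\<eta>\<bar>) powr (-e))" .
    qed
    also have "\<dots> = ennreal K * (ennreal (\<bar>\<eta>\<bar> powr (-e)) * indicator {-1<..<1} \<eta> + ennreal ((1 - \<bar>\<eta>\<bar>) powr (-e)) * indicator {-1<..<1} \<eta>)"
      using True K by (simp add: ennreal_mult abs_less_iff)
    finally show ?thesis .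
  qed
  have "(\<integral>\<^sup>+y\<in>ball 0 1. ennreal ((1 - (cmod y)\<^sup>2) powr (-e) * cmod (1 - of_real c * y) powr (-e)) \<partial>lborel) =
    (\<integral>\<^sup>+\<eta>. (\<integral>\<^sup>+x. ennreal ((1 - (cmod (Complex x \<eta>))\<^sup>2) powr (-e) * cmod (1 - of_real c * Complex x \<eta>) powr (-e)) * indicator (ball 0 1) (Complex x \<eta>) \<partial>lborel) \<partial>lborel)"
    by (rule nn_integral_complex_prod) (measurable, simp add: borel_open)
  also have "\<dots> \<le> (\<integral>\<^sup>+\<eta>. ennreal K * (ennreal (\<bar>\<eta>\<bar> powr (-e)) * indicator {-1<..<1} \<eta> + ennreal ((1 - \<bar>\<eta>\<bar>) powr (-e)) * indicator {-1<..<1} \<eta>) \<partial>lborel)"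
    \<comment> \<open>The line \<open>\<eta> = 0\<close> is excluded since there the convention \<open>0 powr (-e) = 0\<close> can make the bound fail.\<close>
    by (rule nn_integral_mono_AE, use AE_lborel_singleton[of 0] in eventually_elim) (rule inner)
  also have "\<dots> = ennreal K * ((\<integral>\<^sup>+\<eta>\<in>{-1<..<1}. ennreal (\<bar>\<eta>\<bar> powr (-e)) \<partial>lborel) + (\<integral>\<^sup>+\<eta>\<in>{-1<..<1}. ennreal ((1 - \<bar>\<eta>\<bar>) powr (-e)) \<partial>lborel))"
    by (subst nn_integral_cmult) (auto simp: nn_integral_add)
  also have "\<dots> \<le> ennreal K * (ennreal (2 / (1 - e)) + ennreal (2 / (1 - e)))"
    using nn_integral_powr_both_ends[of e 1] e by (intro mult_left_mono add_mono nn_integral_powr_abs) auto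
  also have "\<dots> = ennreal (K * (4 / (1 - e)))"
    using e K by (simp flip: ennreal_mult ennreal_plus add: add_divide_distrib[symmetric])
  finally show ?thesis by (simp add: K_def)
qed

text \<open>A rotation makes \<open>b\<close> real.\<close>

lemma disc_integral:
  fixes e :: real and b :: complex
  assumes e: "0 \<le> e" "e < 1" and b: "cmod b < 1"
  shows "(\<integral>\<^sup>+y\<in>ball 0 1. ennreal ((1 - (cmod y)\<^sup>2) powr (-e) * cmod (1 - cnj b * y) powr (-e)) \<partial>lborel)
    \<le> ennreal (2 powr (1 + 2 * e) / (1 - e) * (4 / (1 - e)))"
proof -
  define u where "u = (if b = 0 then 1 else b / of_real (cmod b))"
  have u: "cmod u = 1" by (simp add: u_def norm_divide)
  then have u0: "u \<noteq> 0" by auto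
  have "cnj b * u = of_real (cmod b)"
  proof (cases "b = 0")
    case False
    have "cnj b * b = of_real (cmod b) * of_real (cmod b)"
      using complex_norm_square[of b] by (simp add: power2_eq_square mult.commute)
    then show ?thesis using False by (simp add: u_def)
  qed (simp add: u_def)
  then have bu: "cnj b * (u * y) = of_real (cmod b) * y" for y by (simp flip: mult.assoc)
  have "(\<integral>\<^sup>+y\<in>ball 0 (cmod u * 1). ennreal ((1 - (cmod y)\<^sup>2) powr (-e) * cmod (1 - cnj b * y) powr (-e)) \<partial>lborel)
    = (\<integral>\<^sup>+y\<in>ball 0 1. ennreal ((1 - (cmod (u * y))\<^sup>2) powr (-e) * cmod (1 - cnj b * (u * y)) powr (-e)) * ennreal ((cmod u)\<^sup>2) \<partial>lborel)"
    by (rule nn_integral_complex_scale[OF u0]) measurable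
  also have "\<dots> = (\<integral>\<^sup>+y\<in>ball 0 1. ennreal ((1 - (cmod y)\<^sup>2) powr (-e) * cmod (1 - of_real (cmod b) * y) powr (-e)) \<partial>lborel)"
    unfolding bu by (simp add: norm_mult u)
  also have "\<dots> \<le> ennreal (2 powr (1 + 2 * e) / (1 - e) * (4 / (1 - e)))"
    by (rule disc_integral_real) (use e b in auto)
  finally show ?thesis by (simp add: u)
qed

text \<open>Since \<open>|1 - cnj b y| \<ge> (1 - |y|\<^sup>2)/2\<close>, the power \<open>(s + t)/2\<close> of the former can be traded against the
  latter. Both exponents then become \<open>-(s - t)/2\<close>, which is larger than \<open>-1\<close>.\<close>

lemma ex_Forelli_Rudin_bound:
  fixes s t :: real
  assumes st: "0 \<le> s + t" "s < t + 2"
  shows "\<exists>C\<ge>0. \<forall>b. cmod b < 1 \<longrightarrow>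
    (\<integral>\<^sup>+y\<in>ball 0 1. ennreal ((1 - (cmod y)\<^sup>2) powr t * cmod (1 - cnj b * y) powr (-s)) \<partial>lborel) \<le> ennreal C"
proof -
  define e0 where "e0 = (s - t) / 2"
  define s1 where "s1 = (s + t) / 2"
  define e where "e = max 0 e0"
  have e: "0 \<le> e" "e < 1" "e0 < 1" "s1 \<ge> 0" using st by (auto simp: e_def e0_def s1_def field_simps)
  define D where "D = 2 powr s1 * 2 powr \<bar>e0\<bar>"
  define C where "C = D * (2 powr (1 + 2 * e) / (1 - e) * (4 / (1 - e)))"
  have D: "D \<ge> 0" by (simp add: D_def)
  have "(\<integral>\<^sup>+y\<in>ball 0 1. ennreal ((1 - (cmod y)\<^sup>2) powr t * cmod (1 - cnj b * y) powr (-s)) \<partial>lborel) \<le> ennreal C"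
    if b: "cmod b < 1" for b
  proof -
    have pt: "(1 - (cmod y)\<^sup>2) powr t * cmod (1 - cnj b * y) powr (-s) \<le> D * ((1 - (cmod y)\<^sup>2) powr (-e) * cmod (1 - cnj b * y) powr (-e))"
      if y: "cmod y < 1" for y
    proof -
      define X where "X = 1 - (cmod y)\<^sup>2"
      define Y where "Y = cmod (1 - cnj b * y)"
      have X: "0 < X" "X \<le> 1" using y by (auto simp: X_def abs_square_less_1)
      have Y: "0 < Y" using one_minus_cnj_mult_nonzero[OF b y] by (simp add: Y_def)
      have Y2: "Y \<le> 2"
      proof -
        have "cmod (cnj b * y) \<le> 1 * 1" unfolding norm_mult using b y by (intro mult_mono) auto
        then show ?thesis using norm_triangle_ineq4[of 1 "cnj b * y"] by (simp add: Y_def)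
      qed
      have XY: "X / 2 \<le> Y"
      proof -
        have "X = (1 - cmod y) * (1 + cmod y)" by (simp add: X_def power2_eq_square algebra_simps)
        also have "\<dots> \<le> (1 - cmod y) * 2" using y by (intro mult_left_mono) auto
        finally show ?thesis using one_minus_norm_le_cmod[of b y] b by (simp add: Y_def)
      qed
      have "Y powr (-s1) \<le> (X / 2) powr (-s1)" using XY X e by (intro powr_mono2') auto
      also have "\<dots> = 2 powr s1 * X powr (-s1)" using X by (simp add: powr_divide powr_minus_divide)
      finally have 1: "Y powr (-s1) \<le> 2 powr s1 * X powr (-s1)" .
      have "X powr t * Y powr (-s) = X powr t * Y powr (-s1) * Y powr (-e0)"
        by (simp add: s1_def e0_def flip: powr_add mult.assoc) (simp add: mult.assoc field_simps flip: powr_add)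
      also have "\<dots> \<le> X powr t * (2 powr s1 * X powr (-s1)) * Y powr (-e0)"
        by (intro mult_right_mono mult_left_mono 1) auto
      also have "\<dots> = 2 powr s1 * (X powr (-e0) * Y powr (-e0))"
      proof -
        have "t + - s1 = - e0" by (simp add: s1_def e0_def field_simps)
        then have "X powr t * X powr (-s1) = X powr (-e0)" unfolding powr_add[symmetric] by (rule arg_cong)
        then show ?thesis by (simp add: mult_ac)
      qed
      also have "X powr (-e0) * Y powr (-e0) \<le> 2 powr \<bar>e0\<bar> * (X powr (-e) * Y powr (-e))"
      proof (cases "e0 \<ge> 0")
        case True
        have "1 * (X powr (-e) * Y powr (-e)) \<le> 2 powr \<bar>e0\<bar> * (X powr (-e) * Y powr (-e))"
          by (intro mult_right_mono) (auto intro: ge_one_powr_ge_zero)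
        then show ?thesis using True by (simp add: e_def)
      next
        case False
        have "X powr (-e0) * Y powr (-e0) \<le> 1 * 2 powr (-e0)"
          using False X Y Y2 by (intro mult_mono powr_le1 powr_mono2) auto
        then show ?thesis using False X Y by (simp add: e_def)
      qed
      finally show ?thesis unfolding X_def Y_def D_def by (simp add: mult.assoc mult_left_mono)
    qed
    have "(\<integral>\<^sup>+y\<in>ball 0 1. ennreal ((1 - (cmod y)\<^sup>2) powr t * cmod (1 - cnj b * y) powr (-s)) \<partial>lborel) \<le>
      (\<integral>\<^sup>+y. ennreal D * (ennreal ((1 - (cmod y)\<^sup>2) powr (-e) * cmod (1 - cnj b * y) powr (-e)) * indicator (ball 0 1) y) \<partial>lborel)"
      by (intro nn_integral_mono) (auto split: split_indicator simp: D pt ennreal_leI simp flip: ennreal_mult)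
    also have "\<dots> = ennreal D * (\<integral>\<^sup>+y\<in>ball 0 1. ennreal ((1 - (cmod y)\<^sup>2) powr (-e) * cmod (1 - cnj b * y) powr (-e)) \<partial>lborel)"
      by (rule nn_integral_cmult) (measurable, simp add: borel_open)
    also have "\<dots> \<le> ennreal D * ennreal (2 powr (1 + 2 * e) / (1 - e) * (4 / (1 - e)))"
      by (intro mult_left_mono disc_integral e b) auto
    also have "\<dots> = ennreal C" using D e by (simp add: C_def flip: ennreal_mult)
    finally show ?thesis .
  qed
  moreover have "C \<ge> 0" using D e by (simp add: C_def)
  ultimately show ?thesis by blast
qed


lemma one_minus_cnj_mult_le_2:
  fixes b y :: complex
  assumes "cmod b \<le> 1" "cmod y \<le> 1"
  shows "cmod (1 - cnj b * y) \<le> 2"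
proof -
  have "cmod (cnj b * y) \<le> 1 * 1" unfolding norm_mult using assms by (intro mult_mono) auto
  then show ?thesis using norm_triangle_ineq4[of 1 "cnj b * y"] by simp
qed

text \<open>The Moebius substitution with parameter \<open>c\<close> produces the factor \<open>(1 - |c|\<^sup>2)^(t + 2 - s)\<close> and
  turns the exponent \<open>-s\<close> of \<open>|1 - cnj c x|\<close> into \<open>s - 2 t - 4\<close>; this is nonnegative, so that factor is
  bounded and no singularity at \<open>c\<close> remains.\<close>

lemma ex_Forelli_Rudin_growth:
  fixes s t :: real
  assumes t: "-1 < t" "t \<le> 0" and s: "2 * t + 4 \<le> s"
  shows "\<exists>C\<ge>0. \<forall>c. cmod c < 1 \<longrightarrow>
    (\<integral>\<^sup>+x\<in>ball 0 1. ennreal ((1 - (cmod x)\<^sup>2) powr t * cmod (1 - cnj c * x) powr (-s)) \<partial>lborel)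
      \<le> ennreal (C * (1 - (cmod c)\<^sup>2) powr (t + 2 - s))"
proof -
  define C0 where "C0 = 2 powr (1 + 2 * (-t)) / (1 - (-t)) * (4 / (1 - (-t)))"
  have C0: "C0 \<ge> 0" using t by (simp add: C0_def)
  define D where "D = 2 powr (s - 2 * t - 4)"
  have D: "D \<ge> 0" by (simp add: D_def)
  have "(\<integral>\<^sup>+x\<in>ball 0 1. ennreal ((1 - (cmod x)\<^sup>2) powr t * cmod (1 - cnj c * x) powr (-s)) \<partial>lborel)
      \<le> ennreal (D * C0 * (1 - (cmod c)\<^sup>2) powr (t + 2 - s))" if c: "cmod c < 1" for c
  proof -
    define A where "A = 1 - (cmod c)\<^sup>2"
    have A: "A > 0" using c by (simp add: A_def abs_square_less_1)
    define F where "F = (\<lambda>x. ennreal ((1 - (cmod x)\<^sup>2) powr t * cmod (1 - cnj c * x) powr (-s)))"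
    have F: "F \<in> borel_measurable borel" unfolding F_def by measurable
    have pt: "F (mobius c y) * ennreal ((1 - (cmod c)\<^sup>2)\<^sup>2 / (cmod (1 - cnj c * y)) ^ 4)
      \<le> ennreal (D * A powr (t + 2 - s)) * ennreal ((1 - (cmod y)\<^sup>2) powr (- (-t)) * cmod (1 - cnj 0 * y) powr (- (-t)))"
      if y: "cmod y < 1" for y
    proof -
      define X where "X = 1 - (cmod y)\<^sup>2"
      define Y where "Y = cmod (1 - cnj c * y)"
      have X: "0 < X" using y by (auto simp: X_def abs_square_less_1)
      have Y: "0 < Y" using one_minus_cnj_mult_nonzero[OF c y] by (simp add: Y_def)
      have Y2: "Y \<le> 2" unfolding Y_def using c y by (intro one_minus_cnj_mult_le_2) auto
      have m1: "1 - (cmod (mobius c y))\<^sup>2 = A * X / Y\<^sup>2"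
        unfolding one_minus_cmod_mobius[OF c y] A_def X_def Y_def ..
      have m2: "cmod (1 - cnj c * mobius c y) = A / Y"
        using A unfolding one_minus_cnj_mult_mobius[OF c y] A_def[symmetric] Y_def by (simp add: norm_divide del: of_real_diff)
      have e1: "(A * X / Y\<^sup>2) powr t = A powr t * X powr t * Y powr (- 2 * t)"
        using A X Y by (simp add: powr_divide powr_mult powr_square powr_minus_divide)
      have e2: "(A / Y) powr (-s) = A powr (-s) * Y powr s"
        using A Y by (simp add: powr_divide powr_minus_divide)
      have e3: "A\<^sup>2 / Y ^ 4 = A powr 2 * Y powr (-4)"
        using A Y by (simp add: powr_minus_divide)
      have "(A * X / Y\<^sup>2) powr t * (A / Y) powr (-s) * (A\<^sup>2 / Y ^ 4) =
         (A powr t * A powr (-s) * A powr 2) * X powr t * (Y powr (- 2 * t) * Y powr s * Y powr (-4))"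
        unfolding e1 e2 e3 by (simp only: mult_ac)
      also have "\<dots> = A powr (t + 2 - s) * X powr t * Y powr (s - 2 * t - 4)"
        unfolding powr_add[symmetric] by (simp add: algebra_simps)
      also have "\<dots> \<le> A powr (t + 2 - s) * X powr t * D"
        unfolding D_def using s Y Y2 by (intro mult_left_mono powr_mono2) auto
      finally have *: "(A * X / Y\<^sup>2) powr t * (A / Y) powr (-s) * (A\<^sup>2 / Y ^ 4) \<le> D * A powr (t + 2 - s) * X powr t"
        by (simp only: mult_ac)
      show ?thesis unfolding F_def m1 m2 A_def[symmetric] Y_def[symmetric] X_def[symmetric]
        using D ennreal_leI[OF *] by (simp flip: ennreal_mult)
    qed
    have "(\<integral>\<^sup>+x\<in>ball 0 1. F x \<partial>lborel) =
       (\<integral>\<^sup>+x\<in>ball 0 1. F (mobius c x) * ennreal ((1 - (cmod c)\<^sup>2)\<^sup>2 / (cmod (1 - cnj c * x)) ^ 4) \<partial>lborel)"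
      by (rule nn_integral_mobius[OF c F])
    also have "\<dots> \<le> (\<integral>\<^sup>+y. ennreal (D * A powr (t + 2 - s)) * (ennreal ((1 - (cmod y)\<^sup>2) powr (- (-t)) * cmod (1 - cnj 0 * y) powr (- (-t))) * indicator (ball 0 1) y) \<partial>lborel)"
      by (intro nn_integral_mono) (use pt in \<open>auto split: split_indicator\<close>)
    also have "\<dots> = ennreal (D * A powr (t + 2 - s)) * (\<integral>\<^sup>+y\<in>ball 0 1. ennreal ((1 - (cmod y)\<^sup>2) powr (- (-t)) * cmod (1 - cnj 0 * y) powr (- (-t))) \<partial>lborel)"
      by (rule nn_integral_cmult) (measurable, simp add: borel_open)
    also have "\<dots> \<le> ennreal (D * A powr (t + 2 - s)) * ennreal C0"
      unfolding C0_def by (intro mult_left_mono disc_integral) (use t in auto)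
    also have "\<dots> = ennreal (D * C0 * A powr (t + 2 - s))" using D C0 by (simp add: mult_ac flip: ennreal_mult)
    finally show ?thesis by (simp add: F_def A_def)
  qed
  then show ?thesis using D C0 by (intro exI[of _ "D * C0"]) auto
qed

lemma one_plus_square_powr_integral_finite:
  fixes k :: real
  assumes k: "1 < k"
  shows "(\<integral>\<^sup>+x. ennreal ((1 + x\<^sup>2) powr (-k/2)) \<partial>lborel) < \<infinity>"
proof -
  define I where "I = - (1 powr (-k+1)) / (-k+1)"
  have I: "(\<integral>\<^sup>+x\<in>{1..}. ennreal (x powr (-k)) \<partial>lborel) = ennreal I"
    unfolding I_def by (rule nn_integral_has_integral_lebesgue'[OF _ has_integral_powr_to_inf]) (use k in auto)
  have I2: "(\<integral>\<^sup>+x\<in>{1..}. ennreal (x powr (-k)) \<partial>lborel) =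
     (\<integral>\<^sup>+x. ennreal ((0 + (-1) * x) powr (-k)) * indicator {1..} (0 + (-1) * x) \<partial>lborel)"
    by (subst nn_integral_real_affine[where c = "-1" and t = 0]) auto
  have pt: "ennreal ((1 + x\<^sup>2) powr (-k/2)) \<le> indicator {-1..1} x + (ennreal (x powr (-k)) * indicator {1..} x + ennreal ((0 + (-1) * x) powr (-k)) * indicator {1..} (0 + (-1) * x))" for x
  proof (cases "\<bar>x\<bar> \<le> 1")
    case True
    have "(1 + x\<^sup>2) powr (-k/2) \<le> 1 powr (-k/2)" using k by (intro powr_mono2') auto
    then have "ennreal ((1 + x\<^sup>2) powr (-k/2)) \<le> indicator {-1..1} x" using True by (auto simp: abs_le_iff indicator_def)
    then show ?thesis by (rule order_trans) simp
  next
    case False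
    have "(1 + x\<^sup>2) powr (-k/2) \<le> (\<bar>x\<bar>\<^sup>2) powr (-k/2)" using k False by (intro powr_mono2') auto
    also have "\<dots> = \<bar>x\<bar> powr (-k)" by (subst powr_square) auto
    finally have *: "(1 + x\<^sup>2) powr (-k/2) \<le> \<bar>x\<bar> powr (-k)" .
    show ?thesis
    proof (cases "x > 0")
      case True
      have "ennreal ((1 + x\<^sup>2) powr (-k/2)) \<le> ennreal (x powr (-k)) * indicator {1..} x" using * False True by (simp add: ennreal_leI)
      then show ?thesis by (rule order_trans) (simp add: add.assoc add_increasing add_increasing2)
    next
      case neg: False
      have "ennreal ((1 + x\<^sup>2) powr (-k/2)) \<le> ennreal ((0 + (-1) * x) powr (-k)) * indicator {1..} (0 + (-1) * x)"
        using * False neg by (auto simp: ennreal_leI)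
      then show ?thesis by (rule order_trans) (simp add: add.assoc add_increasing add_increasing2)
    qed
  qed
  have "(\<integral>\<^sup>+x. ennreal ((1 + x\<^sup>2) powr (-k/2)) \<partial>lborel) \<le> (\<integral>\<^sup>+x. indicator {-1..1} x + (ennreal (x powr (-k)) * indicator {1..} x + ennreal ((0 + (-1) * x) powr (-k)) * indicator {1..} (0 + (-1) * x)) \<partial>lborel)"
    by (intro nn_integral_mono pt)
  also have "\<dots> = (\<integral>\<^sup>+x. indicator {-1..1::real} x \<partial>lborel) + (\<integral>\<^sup>+x. ennreal (x powr (-k)) * indicator {1..} x + ennreal ((0 + (-1) * x) powr (-k)) * indicator {1..} (0 + (-1) * x) \<partial>lborel)"
    by (rule nn_integral_add) measurable
  also have "(\<integral>\<^sup>+x. ennreal (x powr (-k)) * indicator {1..} x + ennreal ((0 + (-1) * x) powr (-k)) * indicator {1..} (0 + (-1) * x) \<partial>lborel) =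
      (\<integral>\<^sup>+x\<in>{1..}. ennreal (x powr (-k)) \<partial>lborel) + (\<integral>\<^sup>+x. ennreal ((0 + (-1) * x) powr (-k)) * indicator {1..} (0 + (-1) * x) \<partial>lborel)"
    by (rule nn_integral_add) measurable
  also have "(\<integral>\<^sup>+x. indicator {-1..1::real} x \<partial>lborel) + ((\<integral>\<^sup>+x\<in>{1..}. ennreal (x powr (-k)) \<partial>lborel) + (\<integral>\<^sup>+x. ennreal ((0 + (-1) * x) powr (-k)) * indicator {1..} (0 + (-1) * x) \<partial>lborel)) = 2 + (ennreal I + ennreal I)" 
  proof -
    have "(\<integral>\<^sup>+x. indicator {-1..1::real} x \<partial>lborel) = 2" by (subst nn_integral_indicator) auto
    then show ?thesis unfolding I2[symmetric] I by simp
  qed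
  also have "\<dots> < \<infinity>" by (simp add: less_top)
  finally show ?thesis .
qed

text \<open>Scaling by \<open>sqrt \<delta>\<close> gives the power of \<open>\<delta>\<close>. The remaining integral over the plane is finite
  because \<open>(1 + |y|\<^sup>2)\<^sup>2\<close> dominates the product of the two one-dimensional factors.\<close>

lemma ex_plane_integral_bound:
  fixes k :: real
  assumes k: "1 < k"
  shows "\<exists>C\<ge>0. \<forall>\<delta>>0. (\<integral>\<^sup>+y\<in>ball 0 1. ennreal ((\<delta> + (cmod y)\<^sup>2) powr (-k)) \<partial>lborel) \<le> ennreal (C * \<delta> powr (1 - k))"
proof -
  define J where "J = (\<integral>\<^sup>+x. ennreal ((1 + x\<^sup>2) powr (-k/2)) \<partial>lborel)"
  have J: "J < \<infinity>" unfolding J_def by (rule one_plus_square_powr_integral_finite[OF k])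
  have "(\<integral>\<^sup>+y. ennreal ((1 + (cmod y)\<^sup>2) powr (-k)) \<partial>lborel) = (\<integral>\<^sup>+\<eta>. (\<integral>\<^sup>+x. ennreal ((1 + (cmod (Complex x \<eta>))\<^sup>2) powr (-k)) \<partial>lborel) \<partial>lborel)"
    by (rule nn_integral_complex_prod) measurable
  also have "\<dots> \<le> (\<integral>\<^sup>+\<eta>. (\<integral>\<^sup>+x. ennreal ((1 + \<eta>\<^sup>2) powr (-k/2)) * ennreal ((1 + x\<^sup>2) powr (-k/2)) \<partial>lborel) \<partial>lborel)"
  proof (intro nn_integral_mono)
    fix x \<eta> :: real
    have p: "0 < (1 + \<eta>\<^sup>2) * (1 + x\<^sup>2)" by (intro mult_pos_pos) (auto simp: add_pos_nonneg)
    have "(1 + \<eta>\<^sup>2) * (1 + x\<^sup>2) \<le> (1 + (cmod (Complex x \<eta>))\<^sup>2) * (1 + (cmod (Complex x \<eta>))\<^sup>2)"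
      by (intro mult_mono) (auto simp: cmod_power2)
    then have "((1 + (cmod (Complex x \<eta>))\<^sup>2)\<^sup>2) powr (-k/2) \<le> ((1 + \<eta>\<^sup>2) * (1 + x\<^sup>2)) powr (-k/2)"
      using k p by (intro powr_mono2') (auto simp: power2_eq_square)
    also have "((1 + (cmod (Complex x \<eta>))\<^sup>2)\<^sup>2) powr (-k/2) = (1 + (cmod (Complex x \<eta>))\<^sup>2) powr (-k)"
      by (subst powr_square) auto
    finally show "ennreal ((1 + (cmod (Complex x \<eta>))\<^sup>2) powr (-k)) \<le> ennreal ((1 + \<eta>\<^sup>2) powr (-k/2)) * ennreal ((1 + x\<^sup>2) powr (-k/2))"
      by (simp add: powr_mult ennreal_leI flip: ennreal_mult)
  qed
  also have "\<dots> = (\<integral>\<^sup>+\<eta>. ennreal ((1 + \<eta>\<^sup>2) powr (-k/2)) * J \<partial>lborel)"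
    unfolding J_def by (subst nn_integral_cmult) auto
  also have "\<dots> = J * J" unfolding J_def by (subst nn_integral_multc) auto
  also have "\<dots> < \<infinity>" using J by (simp add: ennreal_mult_less_top)
  finally have fin: "(\<integral>\<^sup>+y. ennreal ((1 + (cmod y)\<^sup>2) powr (-k)) \<partial>lborel) < \<infinity>" .
  define C where "C = enn2real (\<integral>\<^sup>+y. ennreal ((1 + (cmod y)\<^sup>2) powr (-k)) \<partial>lborel)"
  have C: "(\<integral>\<^sup>+y. ennreal ((1 + (cmod y)\<^sup>2) powr (-k)) \<partial>lborel) = ennreal C" "C \<ge> 0"
    using fin by (auto simp: C_def)
  have "(\<integral>\<^sup>+y\<in>ball 0 1. ennreal ((\<delta> + (cmod y)\<^sup>2) powr (-k)) \<partial>lborel) \<le> ennreal (C * \<delta> powr (1 - k))" if \<delta>: "\<delta> > 0" for \<delta>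
  proof -
    define m where "m = complex_of_real (sqrt \<delta>)"
    have m: "m \<noteq> 0" "cmod m = sqrt \<delta>" using \<delta> by (auto simp: m_def)
    have r: "cmod m * (1 / sqrt \<delta>) = 1" using \<delta> m by simp
    have "(\<integral>\<^sup>+y\<in>ball 0 (cmod m * (1 / sqrt \<delta>)). ennreal ((\<delta> + (cmod y)\<^sup>2) powr (-k)) \<partial>lborel) =
      (\<integral>\<^sup>+y\<in>ball 0 (1 / sqrt \<delta>). ennreal ((\<delta> + (cmod (m * y))\<^sup>2) powr (-k)) * ennreal ((cmod m)\<^sup>2) \<partial>lborel)"
      by (rule nn_integral_complex_scale[OF m(1)]) measurable
    also have "\<dots> \<le> (\<integral>\<^sup>+y. ennreal (\<delta> powr (1 - k)) * ennreal ((1 + (cmod y)\<^sup>2) powr (-k)) \<partial>lborel)"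
    proof (intro nn_integral_mono)
      fix y :: complex
      have "\<delta> + (cmod (m * y))\<^sup>2 = \<delta> * (1 + (cmod y)\<^sup>2)" using \<delta> m by (simp add: norm_mult power_mult_distrib algebra_simps)
      then have "(\<delta> + (cmod (m * y))\<^sup>2) powr (-k) * (cmod m)\<^sup>2 = \<delta> powr (-k) * \<delta> powr 1 * (1 + (cmod y)\<^sup>2) powr (-k)"
        using \<delta> m by (simp add: powr_mult mult_ac)
      also have "\<dots> = \<delta> powr (1 - k) * (1 + (cmod y)\<^sup>2) powr (-k)" unfolding powr_add[symmetric] by simp
      finally have "ennreal ((\<delta> + (cmod (m * y))\<^sup>2) powr (-k)) * ennreal ((cmod m)\<^sup>2) = ennreal (\<delta> powr (1 - k)) * ennreal ((1 + (cmod y)\<^sup>2) powr (-k))"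
        by (simp flip: ennreal_mult)
      then show "ennreal ((\<delta> + (cmod (m * y))\<^sup>2) powr (-k)) * ennreal ((cmod m)\<^sup>2) * indicator (ball 0 (1 / sqrt \<delta>)) y \<le> ennreal (\<delta> powr (1 - k)) * ennreal ((1 + (cmod y)\<^sup>2) powr (-k))"
        by (auto simp: indicator_def)
    qed
    also have "\<dots> = ennreal (\<delta> powr (1 - k)) * (\<integral>\<^sup>+y. ennreal ((1 + (cmod y)\<^sup>2) powr (-k)) \<partial>lborel)"
      by (rule nn_integral_cmult) measurable
    also have "\<dots> = ennreal (C * \<delta> powr (1 - k))" unfolding C(1) using C(2) by (simp add: mult.commute flip: ennreal_mult)
    finally show ?thesis unfolding r .
  qed
  then show ?thesis using C(2) by blast
qed

text \<open>With \<open>A = |a|\<^sup>2\<close> and \<open>r = |y|\<^sup>2\<close>, the coupling term below is at least a multiple of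
  \<open>(1 - |a|\<^sup>2) + |y|\<^sup>2\<close>.\<close>

lemma one_minus_product_lower:
  fixes \<alpha> A r :: real
  assumes \<alpha>: "\<alpha> > 0" and A: "0 \<le> A" "A < 1" and r: "0 \<le> r" "r \<le> 1"
  shows "min 1 \<alpha> / 2 * (1 - A + r) \<le> 1 - A * (1 - r) powr \<alpha>"
proof -
  define m where "m = min 1 \<alpha>"
  have m: "0 < m" "m \<le> 1" using \<alpha> by (auto simp: m_def)
  have "m * r \<le> 1 - (1 - r) powr \<alpha>" using one_minus_powr_ge[of "1 - r" \<alpha>] r \<alpha> by (simp add: m_def)
  then have "A * (1 - r) powr \<alpha> \<le> A * (1 - m * r)" using A by (intro mult_left_mono) auto
  moreover have "m / 2 * (1 - A + r) \<le> 1 - A * (1 - m * r)"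
  proof -
    have mr: "0 \<le> m * r" "m * r \<le> 1" using m r by (auto intro: mult_le_one)
    have "(1 - A) * (m * r) \<le> (1 - A + m * r) / 2"
    proof -
      have "(1 - A) * (m * r) \<le> (1 - A) * 1" using mr A by (intro mult_left_mono) auto
      moreover have "(1 - A) * (m * r) \<le> 1 * (m * r)" using mr A by (intro mult_right_mono) auto
      ultimately show ?thesis by simp
    qed
    moreover have "1 - A * (1 - m * r) = (1 - A + m * r) - (1 - A) * (m * r)" by (simp add: algebra_simps)
    moreover have "m / 2 * (1 - A + r) = (m * (1 - A) + m * r) / 2" by (simp add: algebra_simps)
    moreover have "m * (1 - A) \<le> 1 * (1 - A)" using m A by (intro mult_right_mono) auto
    ultimately show ?thesis by simp
  qed
  ultimately show ?thesis by (simp add: m_def)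
qed

text \<open>Near the origin the first two factors are bounded and the two-dimensional integral of the
  last one gains one power of \<open>1 - |a|\<^sup>2\<close>; this is where \<open>k > 1\<close> enters. Near the boundary the last factor
  is bounded and the first two form a Forelli--Rudin integral.\<close>

lemma ex_coupled_integral_bound:
  fixes \<alpha> s t k :: real
  assumes \<alpha>: "\<alpha> > 0" and k: "1 < k" and st: "0 \<le> s + t" "s < t + 2" and s: "0 \<le> s"
  shows "\<exists>C\<ge>0. \<forall>a b. cmod a < 1 \<longrightarrow> cmod b < 1 \<longrightarrow>
    (\<integral>\<^sup>+y\<in>ball 0 1. ennreal ((1 - (cmod y)\<^sup>2) powr t * cmod (1 - cnj b * y) powr (-s) * (1 - (cmod a)\<^sup>2 * (1 - (cmod y)\<^sup>2) powr \<alpha>) powr (-k)) \<partial>lborel)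
    \<le> ennreal (C * (1 - (cmod a)\<^sup>2) powr (1 - k))"
proof -
  obtain C1 where C1: "C1 \<ge> 0" "\<And>\<delta>. \<delta> > 0 \<Longrightarrow> (\<integral>\<^sup>+y\<in>ball 0 1. ennreal ((\<delta> + (cmod y)\<^sup>2) powr (-k)) \<partial>lborel) \<le> ennreal (C1 * \<delta> powr (1 - k))"
    using ex_plane_integral_bound[OF k] by blast
  obtain C2 where C2: "C2 \<ge> 0" "\<And>b. cmod b < 1 \<Longrightarrow> (\<integral>\<^sup>+y\<in>ball 0 1. ennreal ((1 - (cmod y)\<^sup>2) powr t * cmod (1 - cnj b * y) powr (-s)) \<partial>lborel) \<le> ennreal C2"
    using ex_Forelli_Rudin_bound[OF st] by blast
  define m where "m = (min 1 \<alpha> / 2) powr (-k)"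
  have m: "m \<ge> 0" by (simp add: m_def)
  define D1 where "D1 = 2 powr \<bar>t\<bar> * 4 powr s"
  define D2 where "D2 = 2 powr k"
  have D: "D1 \<ge> 0" "D2 \<ge> 0" by (auto simp: D1_def D2_def)
  have "(\<integral>\<^sup>+y\<in>ball 0 1. ennreal ((1 - (cmod y)\<^sup>2) powr t * cmod (1 - cnj b * y) powr (-s) * (1 - (cmod a)\<^sup>2 * (1 - (cmod y)\<^sup>2) powr \<alpha>) powr (-k)) \<partial>lborel)
    \<le> ennreal (m * (D1 * C1 + D2 * C2) * (1 - (cmod a)\<^sup>2) powr (1 - k))" if a: "cmod a < 1" and b: "cmod b < 1" for a b
  proof -
    define \<delta> where "\<delta> = 1 - (cmod a)\<^sup>2"
    have \<delta>: "0 < \<delta>" "\<delta> \<le> 1" using a by (auto simp: \<delta>_def abs_square_less_1)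
    have pt: "(1 - (cmod y)\<^sup>2) powr t * cmod (1 - cnj b * y) powr (-s) * (1 - (cmod a)\<^sup>2 * (1 - (cmod y)\<^sup>2) powr \<alpha>) powr (-k)
      \<le> m * D1 * (\<delta> + (cmod y)\<^sup>2) powr (-k) + m * D2 * ((1 - (cmod y)\<^sup>2) powr t * cmod (1 - cnj b * y) powr (-s))"
      if y: "cmod y < 1" for y
    proof -
      define r where "r = (cmod y)\<^sup>2"
      define Y where "Y = cmod (1 - cnj b * y)"
      define H where "H = (1 - r) powr t * Y powr (-s)"
      have H: "H \<ge> 0" by (simp add: H_def)
      have r: "0 \<le> r" "r < 1" using y by (auto simp: r_def abs_square_less_1)
      have "(1 - (cmod a)\<^sup>2 * (1 - r) powr \<alpha>) powr (-k) \<le> (min 1 \<alpha> / 2 * (\<delta> + r)) powr (-k)"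
      proof (rule powr_mono2')
        show "0 < min 1 \<alpha> / 2 * (\<delta> + r)" using \<alpha> \<delta> r by (intro mult_pos_pos) auto
        show "min 1 \<alpha> / 2 * (\<delta> + r) \<le> 1 - (cmod a)\<^sup>2 * (1 - r) powr \<alpha>"
          unfolding \<delta>_def using a r by (intro one_minus_product_lower \<alpha>) (auto simp: abs_square_less_1)
      qed (use k in auto)
      also have "\<dots> = m * (\<delta> + r) powr (-k)" unfolding m_def using \<alpha> \<delta> r by (subst powr_mult) auto
      finally have 1: "(1 - (cmod a)\<^sup>2 * (1 - r) powr \<alpha>) powr (-k) \<le> m * (\<delta> + r) powr (-k)" .
      have Yr: "(1 - r) / 2 \<le> Y"
      proof -
        have "1 - r = (1 - cmod y) * (1 + cmod y)" by (simp add: r_def power2_eq_square algebra_simps)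
        also have "\<dots> \<le> (1 - cmod y) * 2" using y by (intro mult_left_mono) auto
        finally show ?thesis using one_minus_norm_le_cmod[of b y] b by (simp add: Y_def)
      qed
      have 2: "H * (\<delta> + r) powr (-k) \<le> D1 * (\<delta> + r) powr (-k) + D2 * H"
      proof (cases "r \<le> 1/2")
        case True
        have "(1 - r) powr t \<le> 2 powr \<bar>t\<bar>"
        proof (cases "t \<ge> 0")
          case True
          then have "(1 - r) powr t \<le> 1" using r by (intro powr_le1) auto
          also have "1 \<le> 2 powr \<bar>t\<bar>" by (intro ge_one_powr_ge_zero) auto
          finally show ?thesis .
        next
          case False
          then have "(1 - r) powr t \<le> (1/2) powr t" using r \<open>r \<le> 1/2\<close> by (intro powr_mono2') auto
          also have "\<dots> = 2 powr \<bar>t\<bar>" using False by (simp add: powr_divide powr_minus_divide)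
          finally show ?thesis .
        qed
        moreover have "Y powr (-s) \<le> (1/4) powr (-s)" using Yr True s by (intro powr_mono2') auto
        moreover have "(1/4::real) powr (-s) = 4 powr s" by (simp add: powr_divide powr_minus_divide)
        ultimately have "H \<le> D1" unfolding H_def D1_def by (intro mult_mono) auto
        then have "H * (\<delta> + r) powr (-k) \<le> D1 * (\<delta> + r) powr (-k)" by (intro mult_right_mono) auto
        moreover have "0 \<le> D2 * H" using D H by simp
        ultimately show ?thesis by simp
      next
        case False
        have "(\<delta> + r) powr (-k) \<le> (1/2) powr (-k)" using False \<delta> k by (intro powr_mono2') auto
        also have "(1/2::real) powr (-k) = D2" by (simp add: D2_def powr_divide powr_minus_divide)
        finally have "H * (\<delta> + r) powr (-k) \<le> H * D2" using H by (intro mult_left_mono) auto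
        moreover have "0 \<le> D1 * (\<delta> + r) powr (-k)" using D by simp
        ultimately show ?thesis by (simp add: mult.commute)
      qed
      have "H * (1 - (cmod a)\<^sup>2 * (1 - r) powr \<alpha>) powr (-k) \<le> H * (m * (\<delta> + r) powr (-k))"
        using 1 H by (intro mult_left_mono) auto
      also have "\<dots> = m * (H * (\<delta> + r) powr (-k))" by simp
      also have "\<dots> \<le> m * (D1 * (\<delta> + r) powr (-k) + D2 * H)" using 2 m by (intro mult_left_mono) auto
      finally show ?thesis unfolding H_def r_def Y_def by (simp add: distrib_left mult.assoc)
    qed
    have "(\<integral>\<^sup>+y\<in>ball 0 1. ennreal ((1 - (cmod y)\<^sup>2) powr t * cmod (1 - cnj b * y) powr (-s) * (1 - (cmod a)\<^sup>2 * (1 - (cmod y)\<^sup>2) powr \<alpha>) powr (-k)) \<partial>lborel)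
      \<le> (\<integral>\<^sup>+y. ennreal (m * D1) * (ennreal ((\<delta> + (cmod y)\<^sup>2) powr (-k)) * indicator (ball 0 1) y) +
          ennreal (m * D2) * (ennreal ((1 - (cmod y)\<^sup>2) powr t * cmod (1 - cnj b * y) powr (-s)) * indicator (ball 0 1) y) \<partial>lborel)"
      by (intro nn_integral_mono) (use m D pt in \<open>auto split: split_indicator intro!: ennreal_leI simp flip: ennreal_mult ennreal_plus\<close>)
    also have "\<dots> = ennreal (m * D1) * (\<integral>\<^sup>+y\<in>ball 0 1. ennreal ((\<delta> + (cmod y)\<^sup>2) powr (-k)) \<partial>lborel) +
          ennreal (m * D2) * (\<integral>\<^sup>+y\<in>ball 0 1. ennreal ((1 - (cmod y)\<^sup>2) powr t * cmod (1 - cnj b * y) powr (-s)) \<partial>lborel)"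
    proof -
      have [measurable]: "(\<lambda>y::complex. indicator (ball 0 1) y :: ennreal) \<in> borel_measurable borel"
        by (intro borel_measurable_indicator borel_open open_ball)
      show ?thesis by (simp add: nn_integral_add nn_integral_cmult)
    qed
    also have "\<dots> \<le> ennreal (m * D1) * ennreal (C1 * \<delta> powr (1 - k)) + ennreal (m * D2) * ennreal C2"
      by (intro add_mono mult_left_mono C1(2) C2(2) \<delta> b) auto
    also have "\<dots> = ennreal (m * D1 * (C1 * \<delta> powr (1 - k)) + m * D2 * C2)"
      using m D C1(1) C2(1) by (simp flip: ennreal_mult ennreal_plus)
    also have "\<dots> \<le> ennreal (m * (D1 * C1 + D2 * C2) * \<delta> powr (1 - k))"
    proof (rule ennreal_leI)
      have "\<delta> powr 0 \<le> \<delta> powr (1 - k)" using \<delta> k by (intro powr_mono') auto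
      then have "1 \<le> \<delta> powr (1 - k)" using \<delta> by simp
      then have "m * D2 * C2 * 1 \<le> m * D2 * C2 * \<delta> powr (1 - k)" using m D C2(1) by (intro mult_left_mono) auto
      then show "m * D1 * (C1 * \<delta> powr (1 - k)) + m * D2 * C2 \<le> m * (D1 * C1 + D2 * C2) * \<delta> powr (1 - k)"
        by (simp add: algebra_simps)
    qed
    finally show ?thesis by (simp add: \<delta>_def)
  qed
  moreover have "m * (D1 * C1 + D2 * C2) \<ge> 0" using m D C1(1) C2(1) by simp
  ultimately show ?thesis by blast
qed

section \<open>The weighted estimate for a single kernel function\<close>

text \<open>Integrate Young's inequality for \<open>f/A\<close> and \<open>g/B\<close>.\<close>

lemma nn_integral_Holder_bound:
  fixes f g :: "'a \<Rightarrow> real" and A B p q :: real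
  assumes pq: "p > 1" "q > 1" "1/p + 1/q = 1" and A: "A > 0" and B: "B > 0"
    and [measurable]: "f \<in> borel_measurable M" "g \<in> borel_measurable M"
    and nn: "\<And>x. 0 \<le> f x" "\<And>x. 0 \<le> g x"
    and f: "(\<integral>\<^sup>+x. ennreal (f x powr p) \<partial>M) \<le> ennreal (A powr p)"
    and g: "(\<integral>\<^sup>+x. ennreal (g x powr q) \<partial>M) \<le> ennreal (B powr q)"
  shows "(\<integral>\<^sup>+x. ennreal (f x * g x) \<partial>M) \<le> ennreal (A * B)"
proof -
  define c where "c = A * B / p / A powr p"
  define d where "d = A * B / q / B powr q"
  have cd: "c \<ge> 0" "d \<ge> 0" using A B pq by (auto simp: c_def d_def)
  have pt: "f x * g x \<le> c * f x powr p + d * g x powr q" for x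
  proof -
    have "(f x / A) * (g x / B) \<le> (f x / A) powr p / p + (g x / B) powr q / q"
      using pq A B nn by (intro Youngs_inequality) auto
    then have "A * B * ((f x / A) * (g x / B)) \<le> A * B * ((f x / A) powr p / p + (g x / B) powr q / q)"
      using A B by (intro mult_left_mono) auto
    also have "A * B * ((f x / A) * (g x / B)) = f x * g x" using A B by simp
    also have "A * B * ((f x / A) powr p / p + (g x / B) powr q / q) = c * f x powr p + d * g x powr q"
      using A B nn by (simp add: powr_divide c_def d_def distrib_left mult_ac)
    finally show ?thesis .
  qed
  have "(\<integral>\<^sup>+x. ennreal (f x * g x) \<partial>M) \<le> (\<integral>\<^sup>+x. ennreal c * ennreal (f x powr p) + ennreal d * ennreal (g x powr q) \<partial>M)"
    by (intro nn_integral_mono) (use cd pt in \<open>auto intro!: ennreal_leI simp flip: ennreal_mult ennreal_plus\<close>)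
  also have "\<dots> = ennreal c * (\<integral>\<^sup>+x. ennreal (f x powr p) \<partial>M) + ennreal d * (\<integral>\<^sup>+x. ennreal (g x powr q) \<partial>M)"
    by (simp add: nn_integral_add nn_integral_cmult)
  also have "\<dots> \<le> ennreal c * ennreal (A powr p) + ennreal d * ennreal (B powr q)"
    by (intro add_mono mult_left_mono f g) auto
  also have "\<dots> = ennreal (c * A powr p + d * B powr q)"
    using cd by (simp flip: ennreal_mult ennreal_plus)
  also have "c * A powr p + d * B powr q = A * B * (1/p + 1/q)"
    using A B by (simp add: c_def d_def distrib_left)
  finally show ?thesis by (simp add: pq)
qed

lemma disc_map_in_U_dom:
  assumes "\<alpha> > 0" "cmod a < 1" "w \<in> U_dom \<alpha>"
  shows "disc_map \<alpha> a w \<in> U_dom \<alpha>"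
proof -
  have w: "cmod (fst w) < 1" "cmod (snd w) < sqrt (1 - cmod (fst w) powr (2/\<alpha>))"
    using mem_U_dom_1[of \<alpha> "fst w" "snd w"] assms by auto
  have "cmod (disc_factor \<alpha> a (fst w)) * cmod (snd w) < cmod (disc_factor \<alpha> a (fst w)) * sqrt (1 - cmod (fst w) powr (2/\<alpha>))"
    using w cmod_disc_factor_radius(2)[OF assms(1,2) w(1)] by simp
  then show ?thesis
    unfolding disc_map_eq mem_U_dom_1[OF assms(1)] cmod_disc_factor_radius(1)[OF assms(1,2) w(1)]
    using cmod_mobius_less_one[OF assms(2) w(1)] by (simp add: norm_mult)
qed

text \<open>The modulus of \<open>f\<^sub>\<alpha>\<close> is the relative radius in the fibre, which the automorphisms preserve.\<close>

lemma cmod_f_alpha_aut_map: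
  assumes "cmod b < 1" "cmod (snd v) < 1"
  shows "cmod (f_alpha \<alpha> (aut_map \<alpha> b v)) = cmod (f_alpha \<alpha> v)"
proof -
  define c where "c = cmod (aut_factor \<alpha> b (snd v))"
  have p: "0 < 1 - (cmod (snd v))\<^sup>2" "0 < 1 - (cmod b)\<^sup>2" using assms by (simp_all add: abs_square_less_1)
  have "c > 0" unfolding c_def using one_minus_cnj_mult_nonzero[OF assms] assms by (auto simp: aut_factor_def abs_square_eq_1)
  then show ?thesis
    unfolding f_alpha_def aut_map_eq fst_conv snd_conv norm_divide norm_mult norm_of_real
      cmod_aut_factor_radius[OF assms, symmetric] c_def[symmetric] using p by (simp add: abs_mult)
qed

text \<open>The Jacobian of the disc map as a function of the image point, up to constants: at the image of
  \<open>u\<close> under the Moebius transformation it equals \<open>(1 - |a|\<^sup>2)^(3/2) / |1 - cnj a u|\<^sup>3\<close>.\<close>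

definition disc_weight :: "complex \<Rightarrow> complex \<Rightarrow> real" where
  "disc_weight a x = (1 - (cmod a)\<^sup>2) powr (-3/2) * cmod (1 - cnj a * x) ^ 3"

text \<open>The multiplier of the disc map is, up to constants, the square root of the derivative of the
  Moebius transformation, so the Jacobian is comparable to the power \<open>3/2\<close> of that derivative.\<close>

lemma ex_jacobian_disc_map_lower:
  assumes \<alpha>: "\<alpha> > 0"
  shows "\<exists>c>0. \<forall>a u. cmod a < 1 \<longrightarrow> u \<in> U_dom \<alpha> \<longrightarrow>
    c * disc_weight a (fst (disc_map \<alpha> a u)) \<le> cmod (jacobian (disc_map \<alpha> a) u)"
proof -
  define c0 where "c0 = min 1 (1/\<alpha>) / max 1 (1/\<alpha>)"
  have c0: "c0 > 0" using \<alpha> by (simp add: c0_def)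
  have "sqrt c0 * disc_weight a (fst (disc_map \<alpha> a u)) \<le> cmod (jacobian (disc_map \<alpha> a) u)"
    if a: "cmod a < 1" and u: "u \<in> U_dom \<alpha>" for a u
  proof -
    define x where "x = fst u"
    define y where "y = mobius a x"
    have x: "cmod x < 1" using U_dom_bounds[OF \<alpha> u] by (simp add: x_def)
    have y: "cmod y < 1" unfolding y_def by (rule cmod_mobius_less_one[OF a x])
    define A where "A = 1 - (cmod a)\<^sup>2"
    define Y where "Y = cmod (1 - cnj a * x)"
    define m where "m = cmod (disc_factor \<alpha> a x)"
    have A: "A > 0" using a by (simp add: A_def abs_square_less_1)
    have Y: "Y > 0" using one_minus_cnj_mult_nonzero[OF a x] by (simp add: Y_def)
    have dw: "disc_weight a y = A powr (3/2) / Y ^ 3"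
    proof -
      have "cmod (1 - cnj a * y) = A / Y"
        using A unfolding y_def one_minus_cnj_mult_mobius[OF a x] A_def[symmetric] Y_def by (simp add: norm_divide del: of_real_diff)
      then have "disc_weight a y = A powr (-3/2) * A powr 3 / Y ^ 3" using A by (simp add: disc_weight_def A_def[symmetric] power_divide)
      also have "A powr (-3/2) * A powr 3 = A powr (3/2)" unfolding powr_add[symmetric] by simp
      finally show ?thesis .
    qed
    have J: "cmod (jacobian (disc_map \<alpha> a) u) = A / Y\<^sup>2 * m"
      using jacobian_disc_map[OF a, of u \<alpha>] x cmod_deriv_mobius[OF a x] by (simp add: norm_mult x_def[symmetric] A_def Y_def m_def)
    have X: "0 < 1 - (cmod x)\<^sup>2" using x by (simp add: abs_square_less_1)
    have mm: "m\<^sup>2 * (1 - cmod x powr (2/\<alpha>)) = 1 - cmod y powr (2/\<alpha>)"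
    proof -
      have px: "cmod x powr (2/\<alpha>) < 1" "cmod y powr (2/\<alpha>) < 1" using x y \<alpha> by (simp_all add: powr_less_one_iff)
      have "(m * sqrt (1 - cmod x powr (2/\<alpha>)))\<^sup>2 = (sqrt (1 - cmod y powr (2/\<alpha>)))\<^sup>2"
        unfolding m_def y_def cmod_disc_factor_radius(1)[OF \<alpha> a x] ..
      then show ?thesis using px by (simp add: power_mult_distrib)
    qed
    have lo: "min 1 (1/\<alpha>) * (1 - (cmod y)\<^sup>2) \<le> 1 - cmod y powr (2/\<alpha>)"
      using one_minus_powr_ge[of "(cmod y)\<^sup>2" "1/\<alpha>"] y \<alpha> powr_square[of "cmod y" "1/\<alpha>"] by (simp add: abs_square_le_1)
    have hi: "1 - cmod x powr (2/\<alpha>) \<le> max 1 (1/\<alpha>) * (1 - (cmod x)\<^sup>2)"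
      using one_minus_powr_le[of "(cmod x)\<^sup>2" "1/\<alpha>"] x \<alpha> powr_square[of "cmod x" "1/\<alpha>"] by (simp add: abs_square_le_1)
    have "min 1 (1/\<alpha>) * (A * (1 - (cmod x)\<^sup>2) / Y\<^sup>2) \<le> m\<^sup>2 * (max 1 (1/\<alpha>) * (1 - (cmod x)\<^sup>2))"
    proof -
      have "min 1 (1/\<alpha>) * (A * (1 - (cmod x)\<^sup>2) / Y\<^sup>2) \<le> m\<^sup>2 * (1 - cmod x powr (2/\<alpha>))"
        using lo unfolding mm y_def one_minus_cmod_mobius[OF a x] A_def Y_def .
      also have "\<dots> \<le> m\<^sup>2 * (max 1 (1/\<alpha>) * (1 - (cmod x)\<^sup>2))" by (intro mult_left_mono hi) auto
      finally show ?thesis .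
    qed
    then have "(min 1 (1/\<alpha>) * (A / Y\<^sup>2)) * (1 - (cmod x)\<^sup>2) \<le> (m\<^sup>2 * max 1 (1/\<alpha>)) * (1 - (cmod x)\<^sup>2)" by (simp add: mult_ac)
    then have "min 1 (1/\<alpha>) * (A / Y\<^sup>2) \<le> m\<^sup>2 * max 1 (1/\<alpha>)" by (rule mult_right_le_imp_le) (rule X)
    moreover have "0 < max 1 (1/\<alpha>)" by (simp add: less_max_iff_disj)
    ultimately have "min 1 (1/\<alpha>) * (A / Y\<^sup>2) / max 1 (1/\<alpha>) \<le> m\<^sup>2" by (simp only: pos_divide_le_eq)
    then have m2: "c0 * (A / Y\<^sup>2) \<le> m\<^sup>2" by (simp add: c0_def mult.commute)
    have A3: "(A powr (3/2))\<^sup>2 = A ^ 3" using A by (simp add: power2_eq_square flip: powr_add)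
    show ?thesis
    proof (rule power2_le_imp_le)
      have "(sqrt c0 * disc_weight a (fst (disc_map \<alpha> a u)))\<^sup>2 = c0 * ((A powr (3/2))\<^sup>2 / (Y ^ 3)\<^sup>2)"
        using c0 dw by (simp add: disc_map_eq x_def[symmetric] y_def[symmetric] power_mult_distrib power_divide)
      also have "\<dots> = (A / Y\<^sup>2)\<^sup>2 * (c0 * (A / Y\<^sup>2))"
        unfolding A3 using Y by (simp add: power2_eq_square power3_eq_cube mult_ac)
      also have "\<dots> \<le> (A / Y\<^sup>2)\<^sup>2 * m\<^sup>2" by (intro mult_left_mono m2) auto
      also have "\<dots> = (cmod (jacobian (disc_map \<alpha> a) u))\<^sup>2" unfolding J by (simp only: power_mult_distrib)
      finally show "(sqrt c0 * disc_weight a (fst (disc_map \<alpha> a u)))\<^sup>2 \<le> (cmod (jacobian (disc_map \<alpha> a) u))\<^sup>2" .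
    qed simp
  qed
  then show ?thesis using c0 by (intro exI[of _ "sqrt c0"]) auto
qed

text \<open>The fourth root of the reproducing kernel on the diagonal, up to constants.\<close>

definition schur_weight :: "real \<Rightarrow> c2 \<Rightarrow> real" where
  "schur_weight \<alpha> w = (1 - (cmod (snd w))\<^sup>2) powr (- (2 + \<alpha>) / 4) * (1 - (cmod (f_alpha \<alpha> w))\<^sup>2) powr (- 3/4)"

text \<open>The Schur weight composed with the automorphism, times its Jacobian, without the power of
  \<open>1 - |b|\<^sup>2\<close> that factors out.\<close>

definition pulled_weight :: "real \<Rightarrow> complex \<Rightarrow> c2 \<Rightarrow> real" where
  "pulled_weight \<alpha> b v = cmod (1 - cnj b * snd v) powr (- (2 + \<alpha>) / 2) * (1 - (cmod (snd v))\<^sup>2) powr (- (2 + \<alpha>) / 4) *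
     (1 - (cmod (f_alpha \<alpha> v))\<^sup>2) powr (- 3/4)"

lemma f_alpha_measurable[measurable]: "f_alpha \<alpha> \<in> borel_measurable borel"
  unfolding f_alpha_def[abs_def] borel_prod[symmetric] by measurable

lemma schur_weight_measurable[measurable]: "schur_weight \<alpha> \<in> borel_measurable borel"
proof -
  have [measurable]: "f_alpha \<alpha> \<in> borel_measurable (borel \<Otimes>\<^sub>M borel)" unfolding borel_prod by measurable
  show ?thesis unfolding schur_weight_def[abs_def] borel_prod[symmetric] by measurable
qed

lemma pulled_weight_measurable[measurable]: "pulled_weight \<alpha> b \<in> borel_measurable borel"
proof -
  have [measurable]: "f_alpha \<alpha> \<in> borel_measurable (borel \<Otimes>\<^sub>M borel)" unfolding borel_prod by measurable
  show ?thesis unfolding pulled_weight_def[abs_def] borel_prod[symmetric] by measurable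
qed

lemma schur_weight_aut_map:
  assumes \<alpha>: "\<alpha> > 0" and b: "cmod b < 1" and v: "v \<in> U_dom \<alpha>"
  shows "schur_weight \<alpha> (aut_map \<alpha> b v) * cmod (jacobian (aut_map \<alpha> b) v) = (1 - (cmod b)\<^sup>2) powr ((2 + \<alpha>) / 4) * pulled_weight \<alpha> b v"
proof -
  have v2: "cmod (snd v) < 1" using U_dom_bounds[OF \<alpha> v] by simp
  define B where "B = 1 - (cmod b)\<^sup>2"
  define X where "X = 1 - (cmod (snd v))\<^sup>2"
  define Y where "Y = cmod (1 - cnj b * snd v)"
  have p: "B > 0" "X > 0" using b v2 by (auto simp: B_def X_def abs_square_less_1)
  have Y: "Y > 0" using one_minus_cnj_mult_nonzero[OF b v2] by (simp add: Y_def)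
  have s: "snd (aut_map \<alpha> b v) = mobius b (snd v)" by (simp add: aut_map_eq)
  have e1: "(B * X / Y\<^sup>2) powr (- (2 + \<alpha>) / 4) = B powr (- (2 + \<alpha>) / 4) * X powr (- (2 + \<alpha>) / 4) * Y powr ((2 + \<alpha>) / 2)"
  proof -
    have "2 * (- (2 + \<alpha>) / 4) = - ((2 + \<alpha>) / 2)" by (simp add: field_simps)
    then have "(Y\<^sup>2) powr (- (2 + \<alpha>) / 4) = Y powr (- ((2 + \<alpha>) / 2))"
      using powr_square[of Y "- (2 + \<alpha>) / 4"] Y by (simp only: less_imp_le)
    then show ?thesis using p Y unfolding powr_minus_divide by (simp add: powr_divide powr_mult)
  qed
  have e2: "B powr (1 + \<alpha>/2) / Y powr (2 + \<alpha>) = B powr (1 + \<alpha>/2) * Y powr (- (2 + \<alpha>))"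
    unfolding powr_minus_divide by simp
  have "(B * X / Y\<^sup>2) powr (- (2 + \<alpha>) / 4) * (B powr (1 + \<alpha>/2) / Y powr (2 + \<alpha>)) =
     (B powr (- (2 + \<alpha>) / 4) * B powr (1 + \<alpha>/2)) * X powr (- (2 + \<alpha>) / 4) * (Y powr ((2 + \<alpha>) / 2) * Y powr (- (2 + \<alpha>)))"
    unfolding e1 e2 by (simp only: mult_ac)
  also have "B powr (- (2 + \<alpha>) / 4) * B powr (1 + \<alpha>/2) = B powr ((2 + \<alpha>) / 4)"
    unfolding powr_add[symmetric] by (rule arg_cong[where f = "\<lambda>e. B powr e"]) (simp add: field_simps)
  also have "Y powr ((2 + \<alpha>) / 2) * Y powr (- (2 + \<alpha>)) = Y powr (- (2 + \<alpha>) / 2)"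
    unfolding powr_add[symmetric] by (rule arg_cong[where f = "\<lambda>e. Y powr e"]) (simp add: field_simps)
  finally have eq: "(B * X / Y\<^sup>2) powr (- (2 + \<alpha>) / 4) * (B powr (1 + \<alpha>/2) / Y powr (2 + \<alpha>)) = B powr ((2 + \<alpha>) / 4) * X powr (- (2 + \<alpha>) / 4) * Y powr (- (2 + \<alpha>) / 2)" .
  show ?thesis
    using arg_cong[OF eq, of "\<lambda>t. t * (1 - (cmod (f_alpha \<alpha> v))\<^sup>2) powr (- 3/4)"]
    unfolding schur_weight_def pulled_weight_def s one_minus_cmod_mobius[OF b v2] cmod_jacobian_aut_map[OF b v2]
      cmod_f_alpha_aut_map[OF b v2] B_def[symmetric] X_def[symmetric] Y_def[symmetric]
    by (simp only: mult_ac)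
qed

text \<open>On the fibre over \<open>y\<close> put \<open>v\<^sub>1 = R x\<close>, where \<open>R\<close> is the radius of the fibre; then
  \<open>f\<^sub>\<alpha>(v) = x\<close>. The inner integral is the growing Forelli--Rudin integral with parameter \<open>a R\<close>, the
  outer one the coupled integral. The exponent of \<open>1 - |a|\<^sup>2\<close> adds up as
  \<open>3(2 - q)/2 + 1 - (4 - 9q/4) = 3q/4\<close>.\<close>

lemma ex_weight_integral_bound:
  fixes \<alpha> q :: real
  assumes \<alpha>: "\<alpha> > 0" and q: "1 < q" "q < 4/3"
  shows "\<exists>C>0. \<forall>a b. cmod a < 1 \<longrightarrow> cmod b < 1 \<longrightarrow>
    (\<integral>\<^sup>+v\<in>U_dom \<alpha>. ennreal (pulled_weight \<alpha> b v powr q * disc_weight a (fst v) powr (- (2 - q))) \<partial>lborel)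
    \<le> ennreal (C * (1 - (cmod a)\<^sup>2) powr (3 * q / 4))"
proof -
  define \<tau> where "\<tau> = - 3 * q / 4"
  define \<sigma> where "\<sigma> = 6 - 3 * q"
  define k where "k = 4 - 9 * q / 4"
  define s where "s = (2 + \<alpha>) * q / 2"
  define t where "t = \<alpha> - (2 + \<alpha>) * q / 4"
  have k: "1 < k" "\<tau> + 2 - \<sigma> = - k" using q by (auto simp: k_def \<tau>_def \<sigma>_def field_simps)
  obtain C1 where C1: "C1 \<ge> 0" "\<And>c. cmod c < 1 \<Longrightarrow> (\<integral>\<^sup>+x\<in>ball 0 1. ennreal ((1 - (cmod x)\<^sup>2) powr \<tau> * cmod (1 - cnj c * x) powr (-\<sigma>)) \<partial>lborel)
      \<le> ennreal (C1 * (1 - (cmod c)\<^sup>2) powr (\<tau> + 2 - \<sigma>))"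
    using ex_Forelli_Rudin_growth[of \<tau> \<sigma>] q by (auto simp: \<tau>_def \<sigma>_def)
  have st: "0 \<le> s + t" "s < t + 2" "0 \<le> s"
  proof -
    have "(2 + \<alpha>) * q \<ge> 0" using \<alpha> q by simp
    then show "0 \<le> s + t" "0 \<le> s" using \<alpha> by (auto simp: s_def t_def field_simps)
    have "(2 + \<alpha>) * (3 * q / 4) < (2 + \<alpha>) * 1" using \<alpha> q by (intro mult_strict_left_mono) auto
    then show "s < t + 2" by (simp add: s_def t_def field_simps)
  qed
  obtain C2 where C2: "C2 \<ge> 0" "\<And>a b. cmod a < 1 \<Longrightarrow> cmod b < 1 \<Longrightarrow>
    (\<integral>\<^sup>+y\<in>ball 0 1. ennreal ((1 - (cmod y)\<^sup>2) powr t * cmod (1 - cnj b * y) powr (-s) * (1 - (cmod a)\<^sup>2 * (1 - (cmod y)\<^sup>2) powr \<alpha>) powr (-k)) \<partial>lborel)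
    \<le> ennreal (C2 * (1 - (cmod a)\<^sup>2) powr (1 - k))"
    using ex_coupled_integral_bound[OF \<alpha> k(1) st] by blast
  have "(\<integral>\<^sup>+v\<in>U_dom \<alpha>. ennreal (pulled_weight \<alpha> b v powr q * disc_weight a (fst v) powr (- (2 - q))) \<partial>lborel)
    \<le> ennreal ((C1 * C2 + 1) * (1 - (cmod a)\<^sup>2) powr (3 * q / 4))" if a: "cmod a < 1" and b: "cmod b < 1" for a b
  proof -
    define A where "A = 1 - (cmod a)\<^sup>2"
    have A: "A > 0" using a by (simp add: A_def abs_square_less_1)
    define F where "F = (\<lambda>v. ennreal (pulled_weight \<alpha> b v powr q * disc_weight a (fst v) powr (- (2 - q))))"
    define E where "E = 3 * (2 - q) / 2"
    have mdw: "(\<lambda>v::c2. disc_weight a (fst v)) \<in> borel_measurable borel"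
      unfolding disc_weight_def borel_prod[symmetric] by measurable
    note [measurable] = mdw
    have mF: "F \<in> borel_measurable borel" unfolding F_def by measurable
    then have mF': "F \<in> borel_measurable (borel \<Otimes>\<^sub>M borel)" unfolding borel_prod .
    have inner: "(\<integral>\<^sup>+x. F (x, y) * indicator (ball 0 ((1 - (cmod y)\<^sup>2) powr (\<alpha>/2))) x \<partial>lborel)
       \<le> ennreal (A powr E * C1) * ennreal ((1 - (cmod y)\<^sup>2) powr t * cmod (1 - cnj b * y) powr (-s) * (1 - (cmod a)\<^sup>2 * (1 - (cmod y)\<^sup>2) powr \<alpha>) powr (-k))"
      if y: "cmod y < 1" for y
    proof -
      define X where "X = 1 - (cmod y)\<^sup>2"
      define R where "R = X powr (\<alpha>/2)"
      define Y where "Y = cmod (1 - cnj b * y)"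
      have X: "0 < X" "X \<le> 1" using y by (auto simp: X_def abs_square_less_1)
      have Y: "Y > 0" using one_minus_cnj_mult_nonzero[OF b y] by (simp add: Y_def)
      have R: "0 < R" "R \<le> 1" using X \<alpha> by (auto simp: R_def intro: powr_le1)
      have R2: "R\<^sup>2 = X powr \<alpha>" using X by (simp add: R_def power2_eq_square flip: powr_add)
      have c: "cmod (a * of_real R) < 1" using a R mult_less_le_imp_less[of "cmod a" 1 R 1] by (simp add: norm_mult)
      have cc: "1 - (cmod (a * of_real R))\<^sup>2 = 1 - (cmod a)\<^sup>2 * X powr \<alpha>"
        using R by (simp add: norm_mult power_mult_distrib R2)
      have m: "of_real R \<noteq> (0::complex)" "cmod (of_real R) = R" using R by auto
      have Fx: "F (of_real R * x, y) * ennreal (R\<^sup>2) = ennreal (A powr E * (X powr t * Y powr (-s))) * ennreal ((1 - (cmod x)\<^sup>2) powr \<tau> * cmod (1 - cnj (a * of_real R) * x) powr (-\<sigma>))" if "cmod x < 1" for x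
      proof -
        define Z where "Z = cmod (1 - cnj (a * of_real R) * x)"
        have Z: "Z > 0" unfolding Z_def using one_minus_cnj_mult_nonzero[OF c that] by simp
        define W where "W = 1 - (cmod x)\<^sup>2"
        have W: "W > 0" using that by (simp add: W_def abs_square_less_1)
        have fa: "f_alpha \<alpha> (of_real R * x, y) = x" using R by (simp add: f_alpha_def X_def[symmetric] R_def)
        have pw: "pulled_weight \<alpha> b (of_real R * x, y) = Y powr (- (2 + \<alpha>) / 2) * X powr (- (2 + \<alpha>) / 4) * W powr (- 3/4)"
          by (simp add: pulled_weight_def fa Y_def X_def W_def)
        have dw: "disc_weight a (of_real R * x) = A powr (-3/2) * Z powr 3"
          using Z by (simp add: disc_weight_def A_def Z_def mult.assoc)
        have e1: "(Y powr (- (2 + \<alpha>) / 2) * X powr (- (2 + \<alpha>) / 4) * W powr (- 3/4)) powr q = Y powr (-s) * X powr (- (2 + \<alpha>) * q / 4) * W powr \<tau>"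
        proof -
          have "- (2 + \<alpha>) / 2 * q = - s" "- (2 + \<alpha>) / 4 * q = - (2 + \<alpha>) * q / 4" "- 3 / 4 * q = \<tau>"
            by (simp_all add: s_def \<tau>_def field_simps)
          then show ?thesis by (simp only: powr_mult powr_powr)
        qed
        have e2: "(A powr (-3/2) * Z powr 3) powr (- (2 - q)) = A powr E * Z powr (-\<sigma>)"
        proof -
          have "- 3 / 2 * (- (2 - q)) = E" "3 * (- (2 - q)) = - \<sigma>" by (simp_all add: E_def \<sigma>_def field_simps)
          then show ?thesis by (simp only: powr_mult powr_powr)
        qed
        have "(Y powr (-s) * X powr (- (2 + \<alpha>) * q / 4) * W powr \<tau>) * (A powr E * Z powr (-\<sigma>)) * R\<^sup>2
           = A powr E * ((X powr \<alpha> * X powr (- (2 + \<alpha>) * q / 4)) * Y powr (-s)) * (W powr \<tau> * Z powr (-\<sigma>))"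
          unfolding R2 by (simp only: mult_ac)
        also have "X powr \<alpha> * X powr (- (2 + \<alpha>) * q / 4) = X powr t" unfolding powr_add[symmetric] t_def
          by (rule arg_cong[where f = "\<lambda>e. X powr e"]) (simp add: field_simps)
        finally show ?thesis
          unfolding F_def fst_conv pw dw e1 e2 Z_def[symmetric] W_def[symmetric]
          by (simp flip: ennreal_mult)
      qed
      have "(\<integral>\<^sup>+x\<in>ball 0 (cmod (complex_of_real R) * 1). F (x, y) \<partial>lborel) =
        (\<integral>\<^sup>+x\<in>ball 0 1. F (of_real R * x, y) * ennreal ((cmod (complex_of_real R))\<^sup>2) \<partial>lborel)"
        by (rule nn_integral_complex_scale[OF m(1)]) (use mF' in measurable)
      also have "\<dots> = (\<integral>\<^sup>+x. ennreal (A powr E * (X powr t * Y powr (-s))) * (ennreal ((1 - (cmod x)\<^sup>2) powr \<tau> * cmod (1 - cnj (a * of_real R) * x) powr (-\<sigma>)) * indicator (ball 0 1) x) \<partial>lborel)"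
        by (intro nn_integral_cong) (auto simp: Fx m(2)[simplified] split: split_indicator)
      also have "\<dots> = ennreal (A powr E * (X powr t * Y powr (-s))) * (\<integral>\<^sup>+x\<in>ball 0 1. ennreal ((1 - (cmod x)\<^sup>2) powr \<tau> * cmod (1 - cnj (a * of_real R) * x) powr (-\<sigma>)) \<partial>lborel)"
        by (rule nn_integral_cmult) (measurable, simp add: borel_open)
      also have "\<dots> \<le> ennreal (A powr E * (X powr t * Y powr (-s))) * ennreal (C1 * (1 - (cmod (a * of_real R))\<^sup>2) powr (\<tau> + 2 - \<sigma>))"
        by (intro mult_left_mono C1(2) c) auto
      also have "\<dots> = ennreal (A powr E * C1) * ennreal (X powr t * Y powr (-s) * (1 - (cmod a)\<^sup>2 * X powr \<alpha>) powr (-k))"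
        unfolding cc k(2) using C1(1) by (simp add: mult_ac flip: ennreal_mult)
      finally show ?thesis unfolding m(2) X_def[symmetric] Y_def[symmetric] R_def[symmetric] by simp
    qed
    have "(\<integral>\<^sup>+v\<in>U_dom \<alpha>. F v \<partial>lborel) =
      (\<integral>\<^sup>+y\<in>ball 0 1. (\<integral>\<^sup>+x. F (x, y) * indicator (ball 0 ((1 - (cmod y)\<^sup>2) powr (\<alpha>/2))) x \<partial>lborel) \<partial>lborel)"
      by (rule nn_integral_U_dom_2[OF \<alpha> mF])
    also have "\<dots> \<le> (\<integral>\<^sup>+y. ennreal (A powr E * C1) * (ennreal ((1 - (cmod y)\<^sup>2) powr t * cmod (1 - cnj b * y) powr (-s) * (1 - (cmod a)\<^sup>2 * (1 - (cmod y)\<^sup>2) powr \<alpha>) powr (-k)) * indicator (ball 0 1) y) \<partial>lborel)"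
      by (intro nn_integral_mono) (use inner in \<open>auto split: split_indicator\<close>)
    also have "\<dots> = ennreal (A powr E * C1) * (\<integral>\<^sup>+y\<in>ball 0 1. ennreal ((1 - (cmod y)\<^sup>2) powr t * cmod (1 - cnj b * y) powr (-s) * (1 - (cmod a)\<^sup>2 * (1 - (cmod y)\<^sup>2) powr \<alpha>) powr (-k)) \<partial>lborel)"
      by (rule nn_integral_cmult) (measurable, simp add: borel_open)
    also have "\<dots> \<le> ennreal (A powr E * C1) * ennreal (C2 * A powr (1 - k))"
      unfolding A_def by (intro mult_left_mono C2(2) a b) auto
    also have "\<dots> = ennreal (C1 * C2 * (A powr E * A powr (1 - k)))"
      using C1(1) C2(1) by (simp add: mult_ac flip: ennreal_mult)
    also have "A powr E * A powr (1 - k) = A powr (3 * q / 4)"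
      unfolding powr_add[symmetric] E_def k_def by (rule arg_cong[where f = "\<lambda>e. A powr e"]) (simp add: field_simps)
    also have "ennreal (C1 * C2 * A powr (3 * q / 4)) \<le> ennreal ((C1 * C2 + 1) * A powr (3 * q / 4))"
      by (intro ennreal_leI mult_right_mono) auto
    finally show ?thesis by (simp add: F_def A_def)
  qed
  then show ?thesis using C1(1) C2(1) by (intro exI[of _ "C1 * C2 + 1"]) (auto simp: add_nonneg_pos)
qed

text \<open>For \<open>f = T k\<^sub>z\<close> the right-hand side is, by the bound for the norm of \<open>K\<^sub>z\<close>, at most a multiple of
  the Schur weight at \<open>z\<close> divided by that norm.\<close>

lemma ex_test_estimate:
  fixes \<alpha> p :: real
  assumes \<alpha>: "\<alpha> > 0" and p: "p > 4"
  shows "\<exists>C\<ge>0. \<forall>f z M. f \<in> borel_measurable borel \<longrightarrow> z \<in> U_dom \<alpha> \<longrightarrow> M > 0 \<longrightarrow>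
    (\<integral>\<^sup>+w\<in>U_dom \<alpha>. ennreal (cmod (V_op \<alpha> (f_alpha \<alpha> z) (U_op \<alpha> z f) w) powr p) \<partial>lborel) \<le> ennreal (M powr p) \<longrightarrow>
    (\<integral>\<^sup>+w\<in>U_dom \<alpha>. ennreal (cmod (f w) * schur_weight \<alpha> w) \<partial>lborel)
      \<le> ennreal (C * M * ((1 - (cmod (snd z))\<^sup>2) powr ((2 + \<alpha>) / 4) * (1 - (cmod (f_alpha \<alpha> z))\<^sup>2) powr (3/4)))"
proof -
  \<comment> \<open>The exponent conjugate to \<open>p\<close>; the condition \<open>p > 4\<close> becomes \<open>q < 4/3\<close>.\<close>
  define q where "q = p / (p - 1)"
  have q: "1 < q" "q < 4/3" using p by (auto simp: q_def field_simps)
  have pq: "1/p + 1/q = 1" using p by (simp add: q_def field_simps)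
  obtain C0 where C0: "C0 > 0" "\<And>a b. cmod a < 1 \<Longrightarrow> cmod b < 1 \<Longrightarrow>
    (\<integral>\<^sup>+v\<in>U_dom \<alpha>. ennreal (pulled_weight \<alpha> b v powr q * disc_weight a (fst v) powr (- (2 - q))) \<partial>lborel)
    \<le> ennreal (C0 * (1 - (cmod a)\<^sup>2) powr (3 * q / 4))"
    using ex_weight_integral_bound[OF \<alpha> q] by blast
  obtain c where c: "c > 0" "\<And>a u. cmod a < 1 \<Longrightarrow> u \<in> U_dom \<alpha> \<Longrightarrow>
    c * disc_weight a (fst (disc_map \<alpha> a u)) \<le> cmod (jacobian (disc_map \<alpha> a) u)"
    using ex_jacobian_disc_map_lower[OF \<alpha>] by blast
  define c1 where "c1 = c powr (- (p - 2) / p)"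
  define C where "C = c1 * C0 powr (1/q)"
  have c1: "c1 > 0" using c by (simp add: c1_def)
  have C: "C \<ge> 0" using c1 by (simp add: C_def)
  have "(\<integral>\<^sup>+w\<in>U_dom \<alpha>. ennreal (cmod (f w) * schur_weight \<alpha> w) \<partial>lborel)
      \<le> ennreal (C * M * ((1 - (cmod (snd z))\<^sup>2) powr ((2 + \<alpha>) / 4) * (1 - (cmod (f_alpha \<alpha> z))\<^sup>2) powr (3/4)))"
    if f[measurable]: "f \<in> borel_measurable borel" and z: "z \<in> U_dom \<alpha>" and M: "M > 0"
      and V: "(\<integral>\<^sup>+w\<in>U_dom \<alpha>. ennreal (cmod (V_op \<alpha> (f_alpha \<alpha> z) (U_op \<alpha> z f) w) powr p) \<partial>lborel) \<le> ennreal (M powr p)" for f z M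
  proof -
    define a where "a = f_alpha \<alpha> z"
    define b where "b = snd z"
    have a: "cmod a < 1" unfolding a_def by (rule f_alpha_less_one[OF \<alpha> z])
    have b: "cmod b < 1" unfolding b_def by (rule U_dom_bounds[OF \<alpha> z])
    define A where "A = 1 - (cmod a)\<^sup>2"
    define B where "B = 1 - (cmod b)\<^sup>2"
    have A: "A > 0" using a by (simp add: A_def abs_square_less_1)
    define g where "g = (\<lambda>v::c2. cmod (f (aut_map \<alpha> b v)) * (cmod (aut_factor \<alpha> b (snd v)) * ((1 - (cmod b)\<^sup>2) / (cmod (1 - cnj b * snd v))\<^sup>2)))"
    have gU: "g v = cmod (U_op \<alpha> z f v)" if "v \<in> U_dom \<alpha>" for v
      using U_dom_bounds[OF \<alpha> that] unfolding g_def U_op_def b_def[symmetric] 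
      by (simp add: jacobian_aut_map[OF b] norm_mult cmod_deriv_mobius[OF b])
    have mf: "(\<lambda>v. cmod (f (aut_map \<alpha> b v))) \<in> borel_measurable borel"
      by (rule measurable_compose[OF measurable_compose[OF aut_map_measurable f]]) measurable
    have mJ: "(\<lambda>v::c2. cmod (aut_factor \<alpha> b (snd v)) * ((1 - (cmod b)\<^sup>2) / (cmod (1 - cnj b * snd v))\<^sup>2)) \<in> borel_measurable borel"
      unfolding borel_prod[symmetric] by measurable
    have [measurable]: "g \<in> borel_measurable borel" unfolding g_def
      by (intro borel_measurable_times mf mJ)
    have g0: "g v \<ge> 0" for v
      unfolding g_def using b by (intro mult_nonneg_nonneg divide_nonneg_nonneg) (auto simp: abs_square_le_1)
    define D where "D = (\<lambda>v::c2. disc_weight a (fst v))"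
    have [measurable]: "D \<in> borel_measurable borel"
      unfolding D_def disc_weight_def borel_prod[symmetric] by measurable
    have D: "D v > 0" if "v \<in> U_dom \<alpha>" for v
      using one_minus_cnj_mult_nonzero[OF a, of "fst v"] U_dom_bounds[OF \<alpha> that] A by (simp add: D_def disc_weight_def A_def[symmetric])
    have D0: "D v \<ge> 0" for v by (simp add: D_def disc_weight_def)

    \<comment> \<open>The automorphism absorbs one Jacobian factor into \<open>g = |U\<^sub>z f|\<close> and one into the pulled back weight.\<close>
    have step1: "(\<integral>\<^sup>+w\<in>U_dom \<alpha>. ennreal (cmod (f w) * schur_weight \<alpha> w) \<partial>lborel) =
      ennreal (B powr ((2 + \<alpha>) / 4)) * (\<integral>\<^sup>+v\<in>U_dom \<alpha>. ennreal (g v * pulled_weight \<alpha> b v) \<partial>lborel)"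
    proof -
      have "(\<integral>\<^sup>+w\<in>U_dom \<alpha>. ennreal (cmod (f w) * schur_weight \<alpha> w) \<partial>lborel) =
        (\<integral>\<^sup>+v\<in>U_dom \<alpha>. ennreal (cmod (f (aut_map \<alpha> b v)) * schur_weight \<alpha> (aut_map \<alpha> b v)) * ennreal ((cmod (jacobian (aut_map \<alpha> b) v))\<^sup>2) \<partial>lborel)"
        by (rule nn_integral_aut_map[OF \<alpha> b]) measurable
      also have "\<dots> = (\<integral>\<^sup>+v. ennreal (B powr ((2 + \<alpha>) / 4)) * (ennreal (g v * pulled_weight \<alpha> b v) * indicator (U_dom \<alpha>) v) \<partial>lborel)"
      proof (intro nn_integral_cong)
        fix v
        show "ennreal (cmod (f (aut_map \<alpha> b v)) * schur_weight \<alpha> (aut_map \<alpha> b v)) * ennreal ((cmod (jacobian (aut_map \<alpha> b) v))\<^sup>2) * indicator (U_dom \<alpha>) v =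
          ennreal (B powr ((2 + \<alpha>) / 4)) * (ennreal (g v * pulled_weight \<alpha> b v) * indicator (U_dom \<alpha>) v)"
        proof (cases "v \<in> U_dom \<alpha>")
          case True
          have sw: "0 \<le> schur_weight \<alpha> (aut_map \<alpha> b v)" "0 \<le> pulled_weight \<alpha> b v" by (auto simp: schur_weight_def pulled_weight_def)
          have "cmod (f (aut_map \<alpha> b v)) * schur_weight \<alpha> (aut_map \<alpha> b v) * (cmod (jacobian (aut_map \<alpha> b) v))\<^sup>2 =
            (cmod (f (aut_map \<alpha> b v)) * cmod (jacobian (aut_map \<alpha> b) v)) * (schur_weight \<alpha> (aut_map \<alpha> b v) * cmod (jacobian (aut_map \<alpha> b) v))"
            by (simp add: power2_eq_square)
          also have "\<dots> = g v * (B powr ((2 + \<alpha>) / 4) * pulled_weight \<alpha> b v)"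
            by (simp only: schur_weight_aut_map[OF \<alpha> b True] B_def gU[OF True] U_op_def norm_mult flip: b_def)
          finally show ?thesis using True sw g0[of v] by (simp add: mult_ac flip: ennreal_mult)
        qed simp
      qed
      also have "\<dots> = ennreal (B powr ((2 + \<alpha>) / 4)) * (\<integral>\<^sup>+v\<in>U_dom \<alpha>. ennreal (g v * pulled_weight \<alpha> b v) \<partial>lborel)"
        using \<alpha> by (intro nn_integral_cmult) measurable
      finally show ?thesis .
    qed

    \<comment> \<open>Substituting the disc map, \<open>D^(p-2)\<close> is at most a multiple of the power \<open>p - 2\<close> of the Jacobian; with the two powers of the substitution rule this completes \<open>|V U f|^p\<close>.\<close>
    have step2: "(\<integral>\<^sup>+v\<in>U_dom \<alpha>. ennreal (g v powr p * D v powr (p - 2)) \<partial>lborel) \<le> ennreal ((c1 * M) powr p)"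
    proof -
      have "(\<integral>\<^sup>+v\<in>U_dom \<alpha>. ennreal (g v powr p * D v powr (p - 2)) \<partial>lborel) =
        (\<integral>\<^sup>+u\<in>U_dom \<alpha>. ennreal (g (disc_map \<alpha> a u) powr p * D (disc_map \<alpha> a u) powr (p - 2)) * ennreal ((cmod (jacobian (disc_map \<alpha> a) u))\<^sup>2) \<partial>lborel)"
        by (rule nn_integral_disc_map[OF \<alpha> a]) measurable
      also have "\<dots> \<le> (\<integral>\<^sup>+u. ennreal (c powr (- (p - 2))) * (ennreal (cmod (V_op \<alpha> a (U_op \<alpha> z f) u) powr p) * indicator (U_dom \<alpha>) u) \<partial>lborel)"
      proof (intro nn_integral_mono)
        fix u
        show "ennreal (g (disc_map \<alpha> a u) powr p * D (disc_map \<alpha> a u) powr (p - 2)) * ennreal ((cmod (jacobian (disc_map \<alpha> a) u))\<^sup>2) * indicator (U_dom \<alpha>) u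
          \<le> ennreal (c powr (- (p - 2))) * (ennreal (cmod (V_op \<alpha> a (U_op \<alpha> z f) u) powr p) * indicator (U_dom \<alpha>) u)"
        proof (cases "u \<in> U_dom \<alpha>")
          case True
          define J where "J = cmod (jacobian (disc_map \<alpha> a) u)"
          have u': "disc_map \<alpha> a u \<in> U_dom \<alpha>" by (rule disc_map_in_U_dom[OF \<alpha> a True])
          have cJ: "c * D (disc_map \<alpha> a u) \<le> J" unfolding J_def D_def by (rule c(2)[OF a True])
          have J: "J > 0" using cJ c(1) D[OF u'] by (meson less_le_trans mult_pos_pos)
          have "D (disc_map \<alpha> a u) \<le> J / c" using cJ c(1) by (simp add: field_simps)
          then have "D (disc_map \<alpha> a u) powr (p - 2) \<le> (J / c) powr (p - 2)"
            using D0 p by (intro powr_mono2) auto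
          also have "\<dots> = c powr (- (p - 2)) * J powr (p - 2)"
            using c(1) J unfolding powr_minus_divide by (simp add: powr_divide)
          finally have "D (disc_map \<alpha> a u) powr (p - 2) * J\<^sup>2 \<le> c powr (- (p - 2)) * J powr (p - 2) * J\<^sup>2"
            by (intro mult_right_mono) auto
          also have "\<dots> = c powr (- (p - 2)) * J powr p"
          proof -
            have "J powr (p - 2) * J powr 2 = J powr p" unfolding powr_add[symmetric] by simp
            then show ?thesis using J by (simp add: mult.assoc)
          qed
          finally have "g (disc_map \<alpha> a u) powr p * (D (disc_map \<alpha> a u) powr (p - 2) * J\<^sup>2) \<le> g (disc_map \<alpha> a u) powr p * (c powr (- (p - 2)) * J powr p)"
            by (intro mult_left_mono) auto
          also have "\<dots> = c powr (- (p - 2)) * cmod (V_op \<alpha> a (U_op \<alpha> z f) u) powr p"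
            unfolding V_op_def norm_mult gU[OF u'] J_def by (simp add: powr_mult)
          finally show ?thesis using True unfolding J_def
            by (simp add: ennreal_leI mult.assoc flip: ennreal_mult)
        qed simp
      qed
      also have "\<dots> = ennreal (c powr (- (p - 2))) * (\<integral>\<^sup>+u\<in>U_dom \<alpha>. ennreal (cmod (V_op \<alpha> a (U_op \<alpha> z f) u) powr p) \<partial>lborel)"
      proof (rule nn_integral_cmult)
        define Vm where "Vm = (\<lambda>u::c2. g (disc_map \<alpha> a u) * (cmod (disc_factor \<alpha> a (fst u)) * ((1 - (cmod a)\<^sup>2) / (cmod (1 - cnj a * fst u))\<^sup>2)))"
        have mj: "(\<lambda>u::c2. cmod (disc_factor \<alpha> a (fst u)) * ((1 - (cmod a)\<^sup>2) / (cmod (1 - cnj a * fst u))\<^sup>2)) \<in> borel_measurable borel"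
          unfolding borel_prod[symmetric] by measurable
        have [measurable]: "Vm \<in> borel_measurable borel" unfolding Vm_def
          by (intro borel_measurable_times measurable_compose[OF disc_map_measurable] mj) measurable
        have "cmod (V_op \<alpha> a (U_op \<alpha> z f) u) = Vm u" if "u \<in> U_dom \<alpha>" for u
          using U_dom_bounds[OF \<alpha> that] unfolding V_op_def Vm_def gU[OF disc_map_in_U_dom[OF \<alpha> a that]]
          by (simp add: jacobian_disc_map[OF a] norm_mult cmod_deriv_mobius[OF a])
        then have "(\<lambda>u. ennreal (cmod (V_op \<alpha> a (U_op \<alpha> z f) u) powr p) * indicator (U_dom \<alpha>) u) = (\<lambda>u. ennreal (Vm u powr p) * indicator (U_dom \<alpha>) u)"
          by (auto simp: fun_eq_iff split: split_indicator)
        moreover have "(\<lambda>u. ennreal (Vm u powr p) * indicator (U_dom \<alpha>) u) \<in> borel_measurable lborel" using \<alpha> by measurable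
        ultimately show "(\<lambda>u. ennreal (cmod (V_op \<alpha> a (U_op \<alpha> z f) u) powr p) * indicator (U_dom \<alpha>) u) \<in> borel_measurable lborel" by simp
      qed
      also have "\<dots> \<le> ennreal (c powr (- (p - 2))) * ennreal (M powr p)"
        using V unfolding a_def by (intro mult_left_mono) auto
      also have "\<dots> = ennreal ((c1 * M) powr p)"
        using p c(1) M by (simp add: c1_def powr_mult powr_powr flip: ennreal_mult)
      finally show ?thesis .
    qed

    \<comment> \<open>Holder is applied to \<open>g D^r\<close> and the weight times \<open>D^(-r)\<close>; the power \<open>r\<close> is chosen so that \<open>r p = p - 2\<close>.\<close>
    define r where "r = (p - 2) / p"
    have rp: "r * p = p - 2" "r * q = 2 - q"
      using p by (auto simp: r_def q_def field_simps)
    define N where "N = C0 powr (1/q) * A powr (3/4)"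
    have N: "N > 0" using C0 A by (simp add: N_def)
    define P where "P = (\<lambda>v. g v * D v powr r * indicator (U_dom \<alpha>) v)"
    define Q where "Q = (\<lambda>v. pulled_weight \<alpha> b v * D v powr (-r) * indicator (U_dom \<alpha>) v)"
    have pw0: "0 \<le> pulled_weight \<alpha> b v" for v by (auto simp: pulled_weight_def)
    have "(\<integral>\<^sup>+v. ennreal (P v * Q v) \<partial>lborel) \<le> ennreal (c1 * M * N)"
    proof (rule nn_integral_Holder_bound[of p q])
      show "p > 1" "q > 1" "1/p + 1/q = 1" "c1 * M > 0" "N > 0" using p q pq c1 M N by auto
      show "P \<in> borel_measurable lborel" "Q \<in> borel_measurable lborel" unfolding P_def Q_def using \<alpha> by measurable
      show "0 \<le> P v" "0 \<le> Q v" for v using g0 pw0 by (auto simp: P_def Q_def)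
      have "(\<integral>\<^sup>+v. ennreal (P v powr p) \<partial>lborel) = (\<integral>\<^sup>+v\<in>U_dom \<alpha>. ennreal (g v powr p * D v powr (p - 2)) \<partial>lborel)"
        by (intro nn_integral_cong) (use p g0 in \<open>auto simp: P_def powr_mult powr_powr rp split: split_indicator\<close>)
      then show "(\<integral>\<^sup>+v. ennreal (P v powr p) \<partial>lborel) \<le> ennreal ((c1 * M) powr p)" using step2 by simp
      have "(\<integral>\<^sup>+v. ennreal (Q v powr q) \<partial>lborel) = (\<integral>\<^sup>+v\<in>U_dom \<alpha>. ennreal (pulled_weight \<alpha> b v powr q * disc_weight a (fst v) powr (- (2 - q))) \<partial>lborel)"
        by (intro nn_integral_cong) (use q pw0 in \<open>auto simp: Q_def D_def powr_mult powr_powr rp split: split_indicator\<close>)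
      also have "\<dots> \<le> ennreal (C0 * A powr (3 * q / 4))" unfolding A_def by (rule C0(2)[OF a b])
      also have "C0 * A powr (3 * q / 4) = N powr q" using q C0(1) by (simp add: N_def powr_mult powr_powr)
      finally show "(\<integral>\<^sup>+v. ennreal (Q v powr q) \<partial>lborel) \<le> ennreal (N powr q)" .
    qed
    moreover have "(\<integral>\<^sup>+v. ennreal (P v * Q v) \<partial>lborel) = (\<integral>\<^sup>+v\<in>U_dom \<alpha>. ennreal (g v * pulled_weight \<alpha> b v) \<partial>lborel)"
    proof (intro nn_integral_cong)
      fix v
      show "ennreal (P v * Q v) = ennreal (g v * pulled_weight \<alpha> b v) * indicator (U_dom \<alpha>) v"
      proof (cases "v \<in> U_dom \<alpha>")
        case True
        have "D v powr r * D v powr (-r) = 1" using D[OF True] by (simp flip: powr_add)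
        then have "P v * Q v = g v * pulled_weight \<alpha> b v" using True by (simp add: P_def Q_def mult_ac)
        then show ?thesis using True by simp
      qed (simp add: P_def Q_def)
    qed
    ultimately have "(\<integral>\<^sup>+v\<in>U_dom \<alpha>. ennreal (g v * pulled_weight \<alpha> b v) \<partial>lborel) \<le> ennreal (c1 * M * N)" by simp
    then have "(\<integral>\<^sup>+w\<in>U_dom \<alpha>. ennreal (cmod (f w) * schur_weight \<alpha> w) \<partial>lborel) \<le> ennreal (B powr ((2 + \<alpha>) / 4)) * ennreal (c1 * M * N)"
      unfolding step1 by (rule mult_left_mono) simp
    also have "\<dots> = ennreal (C * M * (B powr ((2 + \<alpha>) / 4) * A powr (3/4)))"
      using c1 M N by (simp add: C_def N_def mult_ac flip: ennreal_mult)
    finally show ?thesis unfolding A_def B_def a_def b_def .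
  qed
  then show ?thesis using C by blast
qed

section \<open>The Schur test and the extension of the operator\<close>

text \<open>Approximate the second argument by simple functions converging to the identity; continuity
  passes to the limit. It applies to \<open>(z, w) \<mapsto> T K\<^sub>z(w)\<close>, which is holomorphic in \<open>w\<close> and, because of
  the adjoint, antiholomorphic in \<open>z\<close>.\<close>

lemma Caratheodory_function_measurable:
  fixes H :: "'a \<Rightarrow> 'b::{metric_space, second_countable_topology} \<Rightarrow> complex"
  assumes U: "open U" and m: "\<And>w. (\<lambda>z. H z w) \<in> borel_measurable M"
    and c: "\<And>z. continuous_on U (H z)" and z: "\<And>z w. w \<notin> U \<Longrightarrow> H z w = 0"
  shows "(\<lambda>x. H (fst x) (snd x)) \<in> borel_measurable (M \<Otimes>\<^sub>M borel)"
proof -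
  obtain s where s: "\<And>i. simple_function borel (s i)" "\<And>w::'b. (\<lambda>i. s i w) \<longlonglongrightarrow> w"
    using borel_measurable_implies_sequence_metric[of "\<lambda>w::'b. w" borel undefined] by auto
  have [measurable]: "U \<in> sets borel" using U by (rule borel_open)
  have 1: "(\<lambda>x. H (fst x) (s i (snd x))) \<in> borel_measurable (M \<Otimes>\<^sub>M borel)" for i
  proof (rule measurable_compose_countable'[where f = "\<lambda>w x. H (fst x) w" and g = "\<lambda>x. s i (snd x)" and I = "range (s i)"])
    show "(\<lambda>x. H (fst x) w) \<in> borel_measurable (M \<Otimes>\<^sub>M borel)" for w
      by (rule measurable_compose[OF measurable_fst m])
    show "(\<lambda>x. s i (snd x)) \<in> M \<Otimes>\<^sub>M borel \<rightarrow>\<^sub>M count_space (range (s i))"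
      using simple_functionD(1)[OF s(1)[of i]] simple_functionD(2)[OF s(1)[of i]]
      by (intro measurable_compose[OF measurable_snd]) (auto simp: measurable_count_space_eq2)
    show "countable (range (s i))" using simple_functionD(1)[OF s(1)[of i]] by (simp add: countable_finite)
  qed
  show ?thesis
  proof (rule borel_measurable_LIMSEQ_metric)
    show "(\<lambda>x. indicator U (snd x) * H (fst x) (s i (snd x))) \<in> borel_measurable (M \<Otimes>\<^sub>M borel)" for i
      by (intro borel_measurable_times 1) measurable
    show "(\<lambda>i. indicator U (snd x) * H (fst x) (s i (snd x))) \<longlonglongrightarrow> H (fst x) (snd x)" for x
    proof (cases "snd x \<in> U")
      case True
      have "isCont (H (fst x)) (snd x)" using c[of "fst x"] U True by (simp add: continuous_on_eq_continuous_at)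
      then have "(\<lambda>i. H (fst x) (s i (snd x))) \<longlonglongrightarrow> H (fst x) (snd x)" by (rule isCont_tendsto_compose[OF _ s(2)])
      then show ?thesis using True by simp
    qed (simp add: z)
  qed
qed

text \<open>Cauchy--Schwarz for the factorisation \<open>F N = (F sqrt (N/h)) (sqrt (N h))\<close>, followed by Tonelli's
  theorem.\<close>

lemma Schur_test:
  fixes N :: "'a \<Rightarrow> 'a \<Rightarrow> real" and F h :: "'a \<Rightarrow> real"
  assumes M: "sigma_finite_measure M"
    and N[measurable]: "(\<lambda>x. N (fst x) (snd x)) \<in> borel_measurable (M \<Otimes>\<^sub>M M)"
    and [measurable]: "F \<in> borel_measurable M" "h \<in> borel_measurable M"
    and nn: "\<And>z w. 0 \<le> N z w" "\<And>z. 0 \<le> F z" "\<And>z. 0 < h z" "C \<ge> 0"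
    and col: "\<And>w. (\<integral>\<^sup>+z. ennreal (N z w * h z) \<partial>M) \<le> ennreal (C * h w)"
    and row: "\<And>z. (\<integral>\<^sup>+w. ennreal (N z w * h w) \<partial>M) \<le> ennreal (C * h z)"
  shows "(\<integral>\<^sup>+w. (\<integral>\<^sup>+z. ennreal (F z * N z w) \<partial>M)\<^sup>2 \<partial>M) \<le> ennreal (C\<^sup>2) * (\<integral>\<^sup>+z. ennreal ((F z)\<^sup>2) \<partial>M)"
proof -
  interpret sigma_finite_measure M by fact
  interpret P: pair_sigma_finite M M ..
  have Nw[measurable]: "(\<lambda>z. N z w) \<in> borel_measurable M" if "w \<in> space M" for w
    using measurable_compose[OF measurable_Pair2' N, of w] that by simp
  have pt: "(\<integral>\<^sup>+z. ennreal (F z * N z w) \<partial>M)\<^sup>2 \<le> (\<integral>\<^sup>+z. ennreal (C * h w) * ennreal ((F z)\<^sup>2 * N z w / h z) \<partial>M)" if w: "w \<in> space M" for w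
  proof -
    note [measurable] = Nw[OF w]
    have "ennreal (F z * N z w) = ennreal (F z * sqrt (N z w / h z)) * ennreal (sqrt (N z w * h z))" for z
    proof -
      have "sqrt (N z w / h z) * sqrt (N z w * h z) = N z w"
        using nn(1)[of z w] nn(3)[of z] by (simp add: real_sqrt_mult[symmetric])
      then have "F z * N z w = (F z * sqrt (N z w / h z)) * sqrt (N z w * h z)" by (simp add: mult.assoc)
      show ?thesis unfolding \<open>F z * N z w = _\<close>
        using nn(1)[of z w] nn(2)[of z] nn(3)[of z] by (intro ennreal_mult) auto
    qed
    then have "(\<integral>\<^sup>+z. ennreal (F z * N z w) \<partial>M)\<^sup>2 = (\<integral>\<^sup>+z. ennreal (F z * sqrt (N z w / h z)) * ennreal (sqrt (N z w * h z)) \<partial>M)\<^sup>2" by simp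
    also have "\<dots> \<le> (\<integral>\<^sup>+z. (ennreal (F z * sqrt (N z w / h z)))\<^sup>2 \<partial>M) * (\<integral>\<^sup>+z. (ennreal (sqrt (N z w * h z)))\<^sup>2 \<partial>M)"
      by (rule Cauchy_Schwarz_nn_integral) measurable
    also have "(\<integral>\<^sup>+z. (ennreal (F z * sqrt (N z w / h z)))\<^sup>2 \<partial>M) = (\<integral>\<^sup>+z. ennreal ((F z)\<^sup>2 * N z w / h z) \<partial>M)"
    proof (intro nn_integral_cong)
      fix z
      show "(ennreal (F z * sqrt (N z w / h z)))\<^sup>2 = ennreal ((F z)\<^sup>2 * N z w / h z)"
        using nn(1)[of z w] nn(2)[of z] nn(3)[of z] by (subst ennreal_power) (auto simp: power_mult_distrib)
    qed
    also have "(\<integral>\<^sup>+z. (ennreal (sqrt (N z w * h z)))\<^sup>2 \<partial>M) = (\<integral>\<^sup>+z. ennreal (N z w * h z) \<partial>M)"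
    proof (intro nn_integral_cong)
      fix z
      show "(ennreal (sqrt (N z w * h z)))\<^sup>2 = ennreal (N z w * h z)"
        using nn(1)[of z w] nn(3)[of z] by (subst ennreal_power) auto
    qed
    also have "(\<integral>\<^sup>+z. ennreal ((F z)\<^sup>2 * N z w / h z) \<partial>M) * (\<integral>\<^sup>+z. ennreal (N z w * h z) \<partial>M) \<le> (\<integral>\<^sup>+z. ennreal ((F z)\<^sup>2 * N z w / h z) \<partial>M) * ennreal (C * h w)"
      by (intro mult_left_mono col) auto
    also have "\<dots> = (\<integral>\<^sup>+z. ennreal (C * h w) * ennreal ((F z)\<^sup>2 * N z w / h z) \<partial>M)"
      by (subst nn_integral_cmult) (auto simp: mult.commute)
    finally show ?thesis .
  qed
  have "(\<integral>\<^sup>+w. (\<integral>\<^sup>+z. ennreal (F z * N z w) \<partial>M)\<^sup>2 \<partial>M) \<le> (\<integral>\<^sup>+w. (\<integral>\<^sup>+z. ennreal (C * h w) * ennreal ((F z)\<^sup>2 * N z w / h z) \<partial>M) \<partial>M)"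
    by (intro nn_integral_mono pt)
  also have "\<dots> = (\<integral>\<^sup>+z. (\<integral>\<^sup>+w. ennreal (C * h w) * ennreal ((F z)\<^sup>2 * N z w / h z) \<partial>M) \<partial>M)"
    by (rule P.Fubini') (simp add: case_prod_unfold)
  also have "\<dots> \<le> (\<integral>\<^sup>+z. ennreal (C\<^sup>2) * ennreal ((F z)\<^sup>2) \<partial>M)"
  proof (intro nn_integral_mono)
    fix z assume z: "z \<in> space M"
    have [measurable]: "(\<lambda>w. N z w) \<in> borel_measurable M"
      using measurable_compose[OF measurable_Pair1' N, of z] z by simp
    have "(\<integral>\<^sup>+w. ennreal (C * h w) * ennreal ((F z)\<^sup>2 * N z w / h z) \<partial>M) = (\<integral>\<^sup>+w. ennreal (C * (F z)\<^sup>2 / h z) * ennreal (N z w * h w) \<partial>M)"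
    proof (intro nn_integral_cong)
      fix w
      show "ennreal (C * h w) * ennreal ((F z)\<^sup>2 * N z w / h z) = ennreal (C * (F z)\<^sup>2 / h z) * ennreal (N z w * h w)"
        using nn(1)[of z w] nn(3)[of w] nn(3)[of z] nn(4) by (simp add: mult_ac flip: ennreal_mult)
    qed
    also have "\<dots> = ennreal (C * (F z)\<^sup>2 / h z) * (\<integral>\<^sup>+w. ennreal (N z w * h w) \<partial>M)"
      by (rule nn_integral_cmult) measurable
    also have "\<dots> \<le> ennreal (C * (F z)\<^sup>2 / h z) * ennreal (C * h z)" by (intro mult_left_mono row) auto
    also have "\<dots> = ennreal (C\<^sup>2) * ennreal ((F z)\<^sup>2)"
      using nn(3)[of z] nn(4) by (simp add: power2_eq_square mult_ac flip: ennreal_mult)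
    finally show "(\<integral>\<^sup>+w. ennreal (C * h w) * ennreal ((F z)\<^sup>2 * N z w / h z) \<partial>M) \<le> ennreal (C\<^sup>2) * ennreal ((F z)\<^sup>2)" .
  qed
  also have "\<dots> = ennreal (C\<^sup>2) * (\<integral>\<^sup>+z. ennreal ((F z)\<^sup>2) \<partial>M)" by (rule nn_integral_cmult) measurable
  finally show ?thesis .
qed

lemma normalized_kernel_facts:
  assumes \<alpha>: "\<alpha> > 0" and z: "z \<in> U_dom \<alpha>"
  shows "normalized_kernel \<alpha> z \<in> bergman_space \<alpha>"
    and "normalized_kernel \<alpha> z \<in> kernel_span \<alpha>"
    and "f \<in> bergman_space \<alpha> \<Longrightarrow> f z = of_real (l2_norm \<alpha> (bergman_kernel \<alpha> z)) * l2_inner \<alpha> f (normalized_kernel \<alpha> z)"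
proof -
  define n where "n = l2_norm \<alpha> (bergman_kernel \<alpha> z)"
  have n: "n > 0" unfolding n_def by (rule l2_norm_kernel_pos[OF \<alpha> z])
  have eq: "normalized_kernel \<alpha> z = (\<lambda>w. of_real (1 / n) * bergman_kernel \<alpha> z w)"
    by (auto simp: normalized_kernel_def n_def fun_eq_iff)
  show "normalized_kernel \<alpha> z \<in> bergman_space \<alpha>" unfolding eq
    by (intro bergman_scale[OF \<alpha>] bergman_kernel_props[OF \<alpha> z])
  show "normalized_kernel \<alpha> z \<in> kernel_span \<alpha>"
    unfolding kernel_span_def complex_span_def
    by (intro CollectI exI[of _ "{normalized_kernel \<alpha> z}"] exI[of _ "\<lambda>_. 1"]) (use z in auto)
  show "f z = of_real (l2_norm \<alpha> (bergman_kernel \<alpha> z)) * l2_inner \<alpha> f (normalized_kernel \<alpha> z)" if "f \<in> bergman_space \<alpha>"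
  proof -
    have "l2_inner \<alpha> f (normalized_kernel \<alpha> z) = of_real (1 / n) * f z"
      unfolding eq l2_inner_scale_right bergman_kernel_props(2)[OF \<alpha> z that] by simp
    then show ?thesis using n by (simp add: n_def)
  qed
qed

lemma kernel_span_scale:
  assumes "f \<in> kernel_span \<alpha>"
  shows "(\<lambda>w. c * f w) \<in> kernel_span \<alpha>"
proof -
  obtain A d where A: "finite A" "A \<subseteq> normalized_kernel \<alpha> ` U_dom \<alpha>" "f = (\<lambda>w. \<Sum>g\<in>A. d g * g w)"
    using assms unfolding kernel_span_def complex_span_def by blast
  then show ?thesis unfolding kernel_span_def complex_span_def
    by (intro CollectI exI[of _ A] exI[of _ "\<lambda>g. c * d g"]) (simp add: sum_distrib_left mult.assoc)
qed

lemma linear_on_kernel_span_sum: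
  assumes lin: "complex_linear_on (kernel_span \<alpha>) T" and A: "finite A" "A \<subseteq> normalized_kernel \<alpha> ` U_dom \<alpha>"
  shows "T (\<lambda>w. \<Sum>g\<in>A. c g * g w) = (\<lambda>w. \<Sum>g\<in>A. c g * T g w)"
  using A
proof (induction A rule: finite_induct)
  case empty
  have 0: "(\<lambda>w. 0) \<in> kernel_span \<alpha>"
    unfolding kernel_span_def complex_span_def by (intro CollectI exI[of _ "{}"]) auto
  then have "\<forall>c. T (\<lambda>w. c * 0) = (\<lambda>w. c * T (\<lambda>w. 0) w)" using lin unfolding complex_linear_on_def by fast
  then have "T (\<lambda>w. 0 * 0) = (\<lambda>w. 0 * T (\<lambda>w. 0) w)" by blast
  then show ?case by simp
next
  case (insert x A)
  have x: "x \<in> kernel_span \<alpha>"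
    unfolding kernel_span_def complex_span_def
    by (intro CollectI exI[of _ "{x}"] exI[of _ "\<lambda>_. 1"]) (use insert in auto)
  have s: "(\<lambda>w. \<Sum>g\<in>A. c g * g w) \<in> kernel_span \<alpha>"
    unfolding kernel_span_def complex_span_def
    by (intro CollectI exI[of _ A] exI[of _ c]) (use insert in auto)
  have cx: "(\<lambda>w. c x * x w) \<in> kernel_span \<alpha>" by (rule kernel_span_scale[OF x])
  have "T (\<lambda>w. c x * x w + (\<Sum>g\<in>A. c g * g w)) = (\<lambda>w. T (\<lambda>w. c x * x w) w + T (\<lambda>w. \<Sum>g\<in>A. c g * g w) w)"
    using lin cx s unfolding complex_linear_on_def by fast
  moreover have "T (\<lambda>w. c x * x w) = (\<lambda>w. c x * T x w)" using lin x unfolding complex_linear_on_def by fast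
  ultimately show ?case using insert by simp
qed

text \<open>The extension is \<open>S f(w) = \<langle>f, T* K\<^sub>w\<rangle>\<close>, an integral operator with kernel
  \<open>H z w = T K\<^sub>z(w)\<close>. The two Schur bounds are the integrals of \<open>H\<close> along its rows and columns.\<close>

lemma bounded_extension_of_Schur_bounds:
  assumes \<alpha>: "\<alpha> > 0"
    and lin: "complex_linear_on (kernel_span \<alpha>) T"
    and T: "T ` kernel_span \<alpha> \<subseteq> bergman_space \<alpha>"
    and Ts: "Tstar ` kernel_span \<alpha> \<subseteq> bergman_space \<alpha>"
    and adj: "\<And>z w. z \<in> U_dom \<alpha> \<Longrightarrow> w \<in> U_dom \<alpha> \<Longrightarrow>
      l2_inner \<alpha> (T (normalized_kernel \<alpha> z)) (normalized_kernel \<alpha> w) =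
      l2_inner \<alpha> (normalized_kernel \<alpha> z) (Tstar (normalized_kernel \<alpha> w))"
    and h[measurable]: "h \<in> borel_measurable borel" and hpos: "\<And>w. w \<in> U_dom \<alpha> \<Longrightarrow> 0 < h w" and C: "C \<ge> 0"
    and bT: "\<And>z. z \<in> U_dom \<alpha> \<Longrightarrow> (\<integral>\<^sup>+w\<in>U_dom \<alpha>. ennreal (l2_norm \<alpha> (bergman_kernel \<alpha> z) * cmod (T (normalized_kernel \<alpha> z) w) * h w) \<partial>lborel) \<le> ennreal (C * h z)"
    and bTs: "\<And>z. z \<in> U_dom \<alpha> \<Longrightarrow> (\<integral>\<^sup>+w\<in>U_dom \<alpha>. ennreal (l2_norm \<alpha> (bergman_kernel \<alpha> z) * cmod (Tstar (normalized_kernel \<alpha> z) w) * h w) \<partial>lborel) \<le> ennreal (C * h z)"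
  shows "\<exists>S. bounded_operator_on_bergman \<alpha> S \<and> (\<forall>f\<in>kernel_span \<alpha>. S f = T f)"
proof -
  define U where "U = U_dom \<alpha>"
  define k where "k = normalized_kernel \<alpha>"
  define n where "n = (\<lambda>z. l2_norm \<alpha> (bergman_kernel \<alpha> z))"
  define H where "H = (\<lambda>z w. if z \<in> U \<and> w \<in> U then of_real (n z) * T (k z) w else 0)"
  define S where "S = (\<lambda>f w. if w \<in> U then of_real (n w) * l2_inner \<alpha> f (Tstar (k w)) else 0)"
  note l2 = bergman_subset_l2[OF \<alpha>]
  have U: "open U" unfolding U_def by (rule open_U_dom[OF \<alpha>])
  have [measurable]: "U \<in> sets borel" using U by (rule borel_open)
  have n0: "n z \<ge> 0" for z by (simp add: n_def l2_norm_nonneg)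
  have kb: "k z \<in> bergman_space \<alpha>" "k z \<in> kernel_span \<alpha>" if "z \<in> U" for z
    using normalized_kernel_facts[OF \<alpha>] that by (auto simp: k_def U_def)
  have Tk: "T (k z) \<in> bergman_space \<alpha>" "Tstar (k z) \<in> bergman_space \<alpha>" if "z \<in> U" for z
    using T Ts kb[OF that] by auto
  have ev: "f z = of_real (n z) * l2_inner \<alpha> f (k z)" if "f \<in> bergman_space \<alpha>" "z \<in> U" for f z
    using normalized_kernel_facts(3)[OF \<alpha>, of z f] that by (simp add: k_def n_def U_def)
  have Hsym: "H z w = of_real (n w) * cnj (Tstar (k w) z)" if z: "z \<in> U" and w: "w \<in> U" for z w
  proof -
    have "T (k z) w = of_real (n w) * l2_inner \<alpha> (k z) (Tstar (k w))"
      using ev[OF Tk(1)[OF z] w] adj[of z w] z w by (simp add: k_def U_def)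
    moreover have "cnj (Tstar (k w) z) = of_real (n z) * l2_inner \<alpha> (k z) (Tstar (k w))"
      using ev[OF Tk(2)[OF w] z] l2_inner_cnj[of \<alpha> "k z" "Tstar (k w)"] by simp
    ultimately show ?thesis using z w by (simp add: H_def)
  qed
  have mH: "(\<lambda>x. H (fst x) (snd x)) \<in> borel_measurable (borel \<Otimes>\<^sub>M borel)"
  proof (rule Caratheodory_function_measurable[OF U])
    show "(\<lambda>z. H z w) \<in> borel_measurable borel" for w
    proof (cases "w \<in> U")
      case True
      have [measurable]: "Tstar (k w) \<in> borel_measurable borel" by (rule bergman_measurable[OF \<alpha> Tk(2)[OF True]])
      have "(\<lambda>z. H z w) = (\<lambda>z. if z \<in> U then of_real (n w) * cnj (Tstar (k w) z) else 0)"
        using Hsym[OF _ True] by (auto simp: fun_eq_iff H_def)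
      then show ?thesis by simp
    qed (simp add: H_def)
    show "continuous_on U (H z)" for z
    proof (cases "z \<in> U")
      case True
      have "continuous_on U (\<lambda>w. of_real (n z) * T (k z) w)"
        using holomorphic2_on_imp_continuous_on[OF bergman_spaceD(1)[OF Tk(1)[OF True]]]
        by (intro continuous_intros) (simp add: U_def)
      then show ?thesis by (rule continuous_on_eq) (use True in \<open>simp add: H_def\<close>)
    qed (simp add: H_def)
    show "H z w = 0" if "w \<notin> U" for z w using that by (simp add: H_def)
  qed
  \<comment> \<open>The Schur test needs a weight that is positive everywhere; off the domain the kernel is zero, so any positive value will do.\<close>
  define h1 where "h1 = (\<lambda>w. if w \<in> U then h w else 1)"
  have h1pos: "0 < h1 w" for w using hpos by (simp add: h1_def U_def)
  have h1m[measurable]: "h1 \<in> borel_measurable borel" unfolding h1_def by measurable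
  have row: "(\<integral>\<^sup>+w. ennreal (cmod (H z w) * h1 w) \<partial>lborel) \<le> ennreal (C * h1 z)" for z
  proof (cases "z \<in> U")
    case True
    have "(\<integral>\<^sup>+w. ennreal (cmod (H z w) * h1 w) \<partial>lborel) = (\<integral>\<^sup>+w\<in>U. ennreal (n z * cmod (T (k z) w) * h w) \<partial>lborel)"
      by (intro nn_integral_cong) (use True n0 in \<open>auto simp: H_def h1_def norm_mult split: split_indicator\<close>)
    then show ?thesis using bT[of z] True by (simp add: n_def k_def U_def h1_def)
  qed (simp add: H_def)
  have col: "(\<integral>\<^sup>+z. ennreal (cmod (H z w) * h1 z) \<partial>lborel) \<le> ennreal (C * h1 w)" for w
  proof (cases "w \<in> U")
    case True
    have "cmod (H z w) * h1 z = n w * cmod (Tstar (k w) z) * h z" if "z \<in> U" for z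
      using that n0 Hsym[OF that True] by (simp add: h1_def norm_mult)
    moreover have "H z w = 0" if "z \<notin> U" for z using that by (simp add: H_def)
    ultimately have "(\<integral>\<^sup>+z. ennreal (cmod (H z w) * h1 z) \<partial>lborel) = (\<integral>\<^sup>+z\<in>U. ennreal (n w * cmod (Tstar (k w) z) * h z) \<partial>lborel)"
      by (intro nn_integral_cong) (auto split: split_indicator)
    then show ?thesis using bTs[of w] True by (simp add: n_def k_def U_def h1_def)
  qed (simp add: H_def)
  have mHl[measurable]: "(\<lambda>x. H (fst x) (snd x)) \<in> borel_measurable (lborel \<Otimes>\<^sub>M lborel)"
    using mH by (simp cong: measurable_cong_sets)
  have mHs[measurable]: "(\<lambda>x. H (snd x) (fst x)) \<in> borel_measurable (borel \<Otimes>\<^sub>M borel)"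
    using measurable_pair_swap[OF mH] by (simp add: case_prod_unfold)

  have S_int: "S f w = (LINT z|lborel. f z * H z w)" if f: "f \<in> bergman_space \<alpha>" for f w
  proof (cases "w \<in> U")
    case True
    have "S f w = of_real (n w) * (LINT z|lborel. indicator U z *\<^sub>R (f z * cnj (Tstar (k w) z)))"
      using True by (simp add: S_def l2_inner_def set_lebesgue_integral_def U_def)
    also have "\<dots> = (LINT z|lborel. of_real (n w) * (indicator U z *\<^sub>R (f z * cnj (Tstar (k w) z))))"
      by (rule integral_mult_right_zero[symmetric])
    also have "\<dots> = (LINT z|lborel. f z * H z w)"
    proof (intro Bochner_Integration.integral_cong refl)
      fix z
      show "of_real (n w) * (indicator U z *\<^sub>R (f z * cnj (Tstar (k w) z))) = f z * H z w"
        using Hsym[OF _ True, of z] by (cases "z \<in> U") (auto simp: H_def)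
    qed
    finally show ?thesis .
  qed (simp add: S_def H_def)

  have main: "S f \<in> bergman_space \<alpha> \<and> l2_norm \<alpha> (S f) \<le> C * l2_norm \<alpha> f" if f: "f \<in> bergman_space \<alpha>" for f
  proof -
    have fm[measurable]: "f \<in> borel_measurable borel" by (rule bergman_measurable[OF \<alpha> f])
    have f0: "f z = 0" if "z \<notin> U" for z using bergman_spaceD(3)[OF f] that by (simp add: U_def)
    have nf: "(\<integral>\<^sup>+z. ennreal ((cmod (f z))\<^sup>2) \<partial>lborel) = ennreal ((l2_norm \<alpha> f)\<^sup>2)"
    proof -
      have "(\<integral>\<^sup>+z. ennreal ((cmod (f z))\<^sup>2) \<partial>lborel) = (\<integral>\<^sup>+z\<in>U_dom \<alpha>. ennreal ((cmod (f z))\<^sup>2) \<partial>lborel)"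
        by (intro nn_integral_cong) (use f0 in \<open>auto simp: U_def split: split_indicator\<close>)
      then show ?thesis by (simp add: bergman_nn_integral[OF \<alpha> f])
    qed
    define G where "G = (\<lambda>w. \<integral>\<^sup>+z. ennreal (cmod (f z) * cmod (H z w)) \<partial>lborel)"
    have G2: "(\<integral>\<^sup>+w. (G w)\<^sup>2 \<partial>lborel) \<le> ennreal ((C * l2_norm \<alpha> f)\<^sup>2)"
    proof -
      have "(\<integral>\<^sup>+w. (G w)\<^sup>2 \<partial>lborel) \<le> ennreal (C\<^sup>2) * (\<integral>\<^sup>+z. ennreal ((cmod (f z))\<^sup>2) \<partial>lborel)"
        unfolding G_def
        by (rule Schur_test[where h = h1]) (use h1pos C row col in \<open>auto intro: sigma_finite_lborel\<close>)
      then show ?thesis unfolding nf by (simp add: power_mult_distrib flip: ennreal_mult)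
    qed
    have mG[measurable]: "G \<in> borel_measurable borel"
    proof -
      have "(\<lambda>w. \<integral>\<^sup>+z. ennreal (cmod (f z) * cmod (H z w)) \<partial>lborel) \<in> borel_measurable lborel"
        by (rule lborel.borel_measurable_nn_integral) (use mHl in \<open>measurable\<close>)
      then show ?thesis by (simp add: G_def)
    qed
    have SG: "ennreal (cmod (S f w)) \<le> G w" for w
    proof -
      have "ennreal (norm (LINT z|lborel. f z * H z w)) \<le> (\<integral>\<^sup>+z. ennreal (norm (f z * H z w)) \<partial>lborel)"
      proof (cases "integrable lborel (\<lambda>z. f z * H z w)")
        case True then show ?thesis by (rule integral_norm_bound_ennreal)
      qed (simp add: not_integrable_integral_eq)
      then show ?thesis by (simp add: S_int[OF f] G_def norm_mult)
    qed
    have mS[measurable]: "S f \<in> borel_measurable borel"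
    proof -
      have "(\<lambda>w. LINT z|lborel. f z * H z w) \<in> borel_measurable lborel"
        by (rule lborel.borel_measurable_lebesgue_integral) (use mHl in measurable)
      moreover have "S f = (\<lambda>w. LINT z|lborel. f z * H z w)" using S_int[OF f] by blast
      ultimately show ?thesis by simp
    qed
    have nS: "(\<integral>\<^sup>+w. ennreal ((cmod (S f w))\<^sup>2) \<partial>lborel) \<le> ennreal ((C * l2_norm \<alpha> f)\<^sup>2)"
    proof -
      have "(\<integral>\<^sup>+w. ennreal ((cmod (S f w))\<^sup>2) \<partial>lborel) \<le> (\<integral>\<^sup>+w. (G w)\<^sup>2 \<partial>lborel)"
        by (intro nn_integral_mono) (auto simp: ennreal_power[symmetric] intro!: power_mono SG)
      then show ?thesis using G2 by (rule order_trans)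
    qed
    have nSU: "(\<integral>\<^sup>+w\<in>U_dom \<alpha>. ennreal ((cmod (S f w))\<^sup>2) \<partial>lborel) \<le> ennreal ((C * l2_norm \<alpha> f)\<^sup>2)"
      by (rule order_trans[OF _ nS], intro nn_integral_mono) (auto split: split_indicator)
    have SL2: "S f \<in> l2_space \<alpha>"
    proof -
      have "integrable lborel (\<lambda>w. indicator (U_dom \<alpha>) w *\<^sub>R (cmod (S f w))\<^sup>2)"
      proof (rule integrableI_bounded)
        have "(\<integral>\<^sup>+w. ennreal (norm (indicator (U_dom \<alpha>) w *\<^sub>R (cmod (S f w))\<^sup>2)) \<partial>lborel) = (\<integral>\<^sup>+w\<in>U_dom \<alpha>. ennreal ((cmod (S f w))\<^sup>2) \<partial>lborel)"
          by (intro nn_integral_cong) (auto split: split_indicator)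
        also have "\<dots> < \<infinity>" using nSU by (auto simp: less_top[symmetric] top_unique)
        finally show "(\<integral>\<^sup>+w. ennreal (norm (indicator (U_dom \<alpha>) w *\<^sub>R (cmod (S f w))\<^sup>2)) \<partial>lborel) < \<infinity>" .
      qed (use \<alpha> in measurable)
      then show ?thesis by (simp add: l2_space_def set_integrable_def)
    qed
    have bd: "l2_norm \<alpha> (S f) \<le> C * l2_norm \<alpha> f"
    proof (rule power2_le_imp_le)
      show "(l2_norm \<alpha> (S f))\<^sup>2 \<le> (C * l2_norm \<alpha> f)\<^sup>2"
        using nSU unfolding l2_nn_integral[OF SL2] by simp
      show "0 \<le> C * l2_norm \<alpha> f" using C by (simp add: l2_norm_nonneg)
    qed
    \<comment> \<open>So far \<open>S f\<close> is only square integrable; it is now identified with an element \<open>g\<close> of the Bergman space.\<close>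
    have "\<exists>g\<in>bergman_space \<alpha>. \<forall>u\<in>bergman_space \<alpha>. l2_inner \<alpha> u (S f) = l2_inner \<alpha> u g"
    proof (rule bergman_Riesz[OF \<alpha>])
      show "l2_inner \<alpha> (\<lambda>w. u w + t * v w) (S f) = l2_inner \<alpha> u (S f) + t * l2_inner \<alpha> v (S f)"
        if "u \<in> bergman_space \<alpha>" "v \<in> bergman_space \<alpha>" for u v t
        by (intro l2_inner_lincomb_left[OF \<alpha>] l2 that SL2)
      show "cmod (l2_inner \<alpha> u (S f)) \<le> l2_norm \<alpha> (S f) * l2_norm \<alpha> u" if "u \<in> bergman_space \<alpha>" for u
        using l2_Cauchy_Schwarz[OF \<alpha> l2[OF that] SL2] by (simp add: mult.commute)
    qed
    then obtain g where g: "g \<in> bergman_space \<alpha>" "\<And>u. u\<in>bergman_space \<alpha> \<Longrightarrow> l2_inner \<alpha> u (S f) = l2_inner \<alpha> u g" by blast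
    have "g w = S f w" if w: "w \<in> U" for w
    proof -
      define K where "K = bergman_kernel \<alpha> w"
      have K: "K \<in> bergman_space \<alpha>" "\<And>f. f \<in> bergman_space \<alpha> \<Longrightarrow> l2_inner \<alpha> f K = f w"
        using bergman_kernel_props[OF \<alpha>] w by (auto simp: K_def U_def)
      have Km[measurable]: "K \<in> borel_measurable borel" by (rule bergman_measurable[OF \<alpha> K(1)])
      have K0: "K u = 0" if "u \<notin> U" for u using bergman_spaceD(3)[OF K(1)] that by (simp add: U_def)
      have "g w = l2_inner \<alpha> (S f) K"
        using K(2)[OF g(1)] g(2)[OF K(1)] l2_inner_cnj[of \<alpha> g K] l2_inner_cnj[of \<alpha> "S f" K] by simp
      also have "\<dots> = (LINT u|lborel. S f u * cnj (K u))"
        unfolding l2_inner_def set_lebesgue_integral_def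
        by (intro Bochner_Integration.integral_cong) (use K0 in \<open>auto simp: U_def split: split_indicator\<close>)
      also have "\<dots> = (LINT u|lborel. (LINT z|lborel. f z * H z u * cnj (K u)))"
        by (simp add: S_int[OF f])
      also have "\<dots> = (LINT z|lborel. (LINT u|lborel. f z * H z u * cnj (K u)))"
      proof -
        have mP: "(\<lambda>x. f (fst x) * H (fst x) (snd x) * cnj (K (snd x))) \<in> borel_measurable (lborel \<Otimes>\<^sub>M lborel)"
          by (intro borel_measurable_times borel_measurable_cnj mHl) measurable
        have "integrable (lborel \<Otimes>\<^sub>M lborel) (\<lambda>x. f (fst x) * H (fst x) (snd x) * cnj (K (snd x)))"
        proof (rule integrableI_bounded[OF mP])
          have "(\<integral>\<^sup>+x. ennreal (norm (f (fst x) * H (fst x) (snd x) * cnj (K (snd x)))) \<partial>(lborel \<Otimes>\<^sub>M lborel)) =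
            (\<integral>\<^sup>+u. (\<integral>\<^sup>+z. ennreal (norm (f z * H z u * cnj (K u))) \<partial>lborel) \<partial>lborel)"
            using mP by (subst lborel_pair.nn_integral_snd[symmetric]) (auto simp: case_prod_unfold)
          also have "\<dots> = (\<integral>\<^sup>+u. G u * ennreal (cmod (K u)) \<partial>lborel)"
          proof (intro nn_integral_cong)
            fix u
            have m: "(\<lambda>z. H z u) \<in> borel_measurable borel"
              using measurable_compose[OF measurable_Pair2' mHl, of u] by simp
            have "(\<integral>\<^sup>+z. ennreal (norm (f z * H z u * cnj (K u))) \<partial>lborel) = (\<integral>\<^sup>+z. ennreal (cmod (f z) * cmod (H z u)) * ennreal (cmod (K u)) \<partial>lborel)"
              by (intro nn_integral_cong) (simp add: norm_mult flip: ennreal_mult)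
            also have "\<dots> = G u * ennreal (cmod (K u))" unfolding G_def
              using m by (intro nn_integral_multc) measurable
            finally show "(\<integral>\<^sup>+z. ennreal (norm (f z * H z u * cnj (K u))) \<partial>lborel) = G u * ennreal (cmod (K u))" .
          qed
          finally have e: "(\<integral>\<^sup>+x. ennreal (norm (f (fst x) * H (fst x) (snd x) * cnj (K (snd x)))) \<partial>(lborel \<Otimes>\<^sub>M lborel)) = (\<integral>\<^sup>+u. G u * ennreal (cmod (K u)) \<partial>lborel)" .
          have "(\<integral>\<^sup>+u. G u * ennreal (cmod (K u)) \<partial>lborel)\<^sup>2 \<le> (\<integral>\<^sup>+u. (G u)\<^sup>2 \<partial>lborel) * (\<integral>\<^sup>+u. (ennreal (cmod (K u)))\<^sup>2 \<partial>lborel)"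
            by (rule Cauchy_Schwarz_nn_integral) measurable
          also have "(\<integral>\<^sup>+u. (ennreal (cmod (K u)))\<^sup>2 \<partial>lborel) = (\<integral>\<^sup>+u\<in>U_dom \<alpha>. ennreal ((cmod (K u))\<^sup>2) \<partial>lborel)"
            by (intro nn_integral_cong) (use K0 in \<open>auto simp: ennreal_power U_def split: split_indicator\<close>)
          also have "\<dots> = ennreal ((l2_norm \<alpha> K)\<^sup>2)" by (rule bergman_nn_integral[OF \<alpha> K(1)])
          also have "(\<integral>\<^sup>+u. (G u)\<^sup>2 \<partial>lborel) * ennreal ((l2_norm \<alpha> K)\<^sup>2) \<le> ennreal ((C * l2_norm \<alpha> f)\<^sup>2) * ennreal ((l2_norm \<alpha> K)\<^sup>2)"
            by (intro mult_right_mono G2) auto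
          also have "\<dots> < \<infinity>" by (simp flip: ennreal_mult)
          finally have "(\<integral>\<^sup>+u. G u * ennreal (cmod (K u)) \<partial>lborel)\<^sup>2 < \<infinity>" .
          then have "(\<integral>\<^sup>+u. G u * ennreal (cmod (K u)) \<partial>lborel) < \<infinity>"
            by (auto simp: power2_eq_square less_top[symmetric] ennreal_mult_eq_top_iff)
          then show "(\<integral>\<^sup>+x. ennreal (norm (f (fst x) * H (fst x) (snd x) * cnj (K (snd x)))) \<partial>(lborel \<Otimes>\<^sub>M lborel)) < \<infinity>"
            unfolding e .
        qed
        then have "integrable (lborel \<Otimes>\<^sub>M lborel) (\<lambda>(z, u). f z * H z u * cnj (K u))" by (simp add: case_prod_unfold)
        then show ?thesis by (rule lborel_pair.Fubini_integral)
      qed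
      also have "\<dots> = (LINT z|lborel. f z * H z w)"
      proof (intro Bochner_Integration.integral_cong refl)
        fix z
        show "(LINT u|lborel. f z * H z u * cnj (K u)) = f z * H z w"
        proof (cases "z \<in> U")
          case True
          have "(LINT u|lborel. f z * H z u * cnj (K u)) = (LINT u|lborel. (f z * of_real (n z)) * (indicator U u *\<^sub>R (T (k z) u * cnj (K u))))"
            by (intro Bochner_Integration.integral_cong) (use True K0 in \<open>auto simp: H_def split: split_indicator\<close>)
          also have "\<dots> = (f z * of_real (n z)) * l2_inner \<alpha> (T (k z)) K"
            unfolding l2_inner_def set_lebesgue_integral_def U_def by (rule integral_mult_right_zero)
          also have "\<dots> = f z * H z w" using K(2)[OF Tk(1)[OF True]] True w by (simp add: H_def)
          finally show ?thesis .
        qed (simp add: f0)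
      qed
      also have "\<dots> = S f w" by (rule S_int[OF f, symmetric])
      finally show ?thesis .
    qed
    moreover have "g w = S f w" if "w \<notin> U" for w
      using bergman_spaceD(3)[OF g(1)] that by (simp add: U_def S_def)
    ultimately have "g = S f" by blast
    then show ?thesis using g(1) bd by simp
  qed

  have "bounded_operator_on_bergman \<alpha> S"
    unfolding bounded_operator_on_bergman_def
  proof (intro conjI)
    show "S ` bergman_space \<alpha> \<subseteq> bergman_space \<alpha>" using main by blast
    show "\<exists>C. \<forall>f\<in>bergman_space \<alpha>. l2_norm \<alpha> (S f) \<le> C * l2_norm \<alpha> f" using main by blast
    show "complex_linear_on (bergman_space \<alpha>) S"
      unfolding complex_linear_on_def
    proof (intro conjI ballI allI)
      fix f g assume fg: "f \<in> bergman_space \<alpha>" "g \<in> bergman_space \<alpha>"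
      show "S (\<lambda>w. f w + g w) = (\<lambda>w. S f w + S g w)"
      proof
        fix w
        show "S (\<lambda>w. f w + g w) w = S f w + S g w"
          using l2_inner_lincomb_left[OF \<alpha> l2[OF fg(1)] l2[OF fg(2)] l2[OF Tk(2)], of w 1]
          by (simp add: S_def distrib_left)
      qed
    next
      fix f c assume "f \<in> bergman_space \<alpha>"
      show "S (\<lambda>w. c * f w) = (\<lambda>w. c * S f w)"
        by (auto simp: S_def l2_inner_scale_left fun_eq_iff)
    qed
  qed
  moreover have "S f = T f" if f: "f \<in> kernel_span \<alpha>" for f
  proof -
    obtain A c where A: "finite A" "A \<subseteq> k ` U" "f = (\<lambda>w. \<Sum>g\<in>A. c g * g w)"
      using f unfolding kernel_span_def complex_span_def k_def U_def by blast
    have Sk: "S (k z) = T (k z)" if z: "z \<in> U" for z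
    proof
      fix w
      show "S (k z) w = T (k z) w"
      proof (cases "w \<in> U")
        case True
        then show ?thesis using ev[OF Tk(1)[OF z] True] adj[of z w] z by (simp add: S_def k_def U_def)
      next
        case False
        then show ?thesis using bergman_spaceD(3)[OF Tk(1)[OF z]] by (simp add: S_def U_def)
      qed
    qed
    have "A \<subseteq> k ` U \<Longrightarrow> (\<lambda>w. \<Sum>g\<in>A. c g * g w) \<in> bergman_space \<alpha> \<and> S (\<lambda>w. \<Sum>g\<in>A. c g * g w) = (\<lambda>w. \<Sum>g\<in>A. c g * T g w)"
      using A(1)
    proof (induction A rule: finite_induct)
      case empty
      have "l2_inner \<alpha> (\<lambda>w. 0) v = 0" for v by (simp add: l2_inner_def)
      then show ?case by (simp add: zero_in_bergman S_def fun_eq_iff)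
    next
      case (insert x A)
      then obtain z where z: "z \<in> U" "x = k z" by auto
      have s: "(\<lambda>w. \<Sum>g\<in>A. c g * g w) \<in> bergman_space \<alpha>" "S (\<lambda>w. \<Sum>g\<in>A. c g * g w) = (\<lambda>w. \<Sum>g\<in>A. c g * T g w)"
        using insert by auto
      have e: "(\<lambda>w. \<Sum>g\<in>insert x A. c g * g w) = (\<lambda>w. (\<Sum>g\<in>A. c g * g w) + c x * k z w)"
        using insert z by (simp add: add.commute)
      have "S (\<lambda>w. (\<Sum>g\<in>A. c g * g w) + c x * k z w) w = S (\<lambda>w. \<Sum>g\<in>A. c g * g w) w + c x * S (k z) w" for w
        using l2_inner_lincomb_left[OF \<alpha> l2[OF s(1)] l2[OF kb(1)[OF z(1)]] l2[OF Tk(2)], of w "c x"]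
        by (simp add: S_def distrib_left)
      then have "S (\<lambda>w. \<Sum>g\<in>insert x A. c g * g w) = (\<lambda>w. \<Sum>g\<in>insert x A. c g * T g w)"
        unfolding e s(2) Sk[OF z(1)] using insert.hyps by (intro ext) (simp add: z(2)[symmetric] add.commute)
      then show ?case unfolding e by (simp add: bergman_lincomb[OF \<alpha> s(1) kb(1)[OF z(1)]])
    qed
    then have "S f = (\<lambda>w. \<Sum>g\<in>A. c g * T g w)" using A by simp
    also have "\<dots> = T f"
      using linear_on_kernel_span_sum[OF lin A(1), of c] A(2,3) by (simp add: k_def U_def)
    finally show ?thesis .
  qed
  ultimately show ?thesis by blast
qed

lemma lp_norm_le_imp_nn_integral_le:
  assumes p: "p > 0" and M: "M \<ge> 0" and le: "lp_norm \<alpha> p f \<le> ennreal M"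
  shows "(\<integral>\<^sup>+w\<in>U_dom \<alpha>. ennreal (cmod (f w) powr p) \<partial>lborel) \<le> ennreal (M powr p)"
proof -
  define I where "I = (\<integral>\<^sup>+w\<in>U_dom \<alpha>. ennreal (cmod (f w) powr p) \<partial>lborel)"
  have l: "lp_norm \<alpha> p f = (if I = \<infinity> then \<infinity> else ennreal (enn2real I powr (1 / p)))"
    by (simp add: lp_norm_def I_def Let_def)
  have fin: "I \<noteq> \<infinity>"
  proof
    assume "I = \<infinity>"
    then have "\<infinity> \<le> ennreal M" using l le by simp
    then show False by (simp add: top_unique)
  qed
  then have "ennreal (enn2real I powr (1 / p)) \<le> ennreal M" using l le by simp
  then have "enn2real I powr (1 / p) \<le> M" using M by simp
  then have "(enn2real I powr (1 / p)) powr p \<le> M powr p" using p by (intro powr_mono2) auto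
  then have "enn2real I \<le> M powr p" using p by (simp add: powr_powr)
  moreover have "I = ennreal (enn2real I)" using fin by (simp add: less_top)
  ultimately show ?thesis unfolding I_def[symmetric] by (metis ennreal_leI)
qed

theorem theorem3p1:
  fixes \<alpha> p :: real
    and T Tstar :: "(complex \<times> complex \<Rightarrow> complex) \<Rightarrow> (complex \<times> complex \<Rightarrow> complex)"
  assumes "\<alpha> > 0" and "\<alpha> \<noteq> 1"
    and "complex_linear_on (kernel_span \<alpha>) T"
    and "T ` kernel_span \<alpha> \<subseteq> bergman_space \<alpha>"
    and "complex_linear_on (kernel_span \<alpha>) Tstar"
    and "Tstar ` kernel_span \<alpha> \<subseteq> bergman_space \<alpha>"
    and "\<And>z w. z \<in> U_dom \<alpha> \<Longrightarrow> w \<in> U_dom \<alpha> \<Longrightarrow>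
      l2_inner \<alpha> (T (normalized_kernel \<alpha> z)) (normalized_kernel \<alpha> w) =
      l2_inner \<alpha> (normalized_kernel \<alpha> z) (Tstar (normalized_kernel \<alpha> w))"
    and "p > 4"
    and "(SUP z\<in>U_dom \<alpha>.
      lp_norm \<alpha> p (V_op \<alpha> (f_alpha \<alpha> z) (U_op \<alpha> z (T (normalized_kernel \<alpha> z))))) < \<infinity>"
    and "(SUP z\<in>U_dom \<alpha>.
      lp_norm \<alpha> p (V_op \<alpha> (f_alpha \<alpha> z) (U_op \<alpha> z (Tstar (normalized_kernel \<alpha> z))))) < \<infinity>"
  shows "\<exists>S. bounded_operator_on_bergman \<alpha> S \<and> (\<forall>f\<in>kernel_span \<alpha>. S f = T f)"
proof -
  note \<alpha> = assms(1) and p = assms(8)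
  obtain C where C: "C \<ge> 0" "\<And>f z M. f \<in> borel_measurable borel \<Longrightarrow> z \<in> U_dom \<alpha> \<Longrightarrow> M > 0 \<Longrightarrow>
    (\<integral>\<^sup>+w\<in>U_dom \<alpha>. ennreal (cmod (V_op \<alpha> (f_alpha \<alpha> z) (U_op \<alpha> z f) w) powr p) \<partial>lborel) \<le> ennreal (M powr p) \<Longrightarrow>
    (\<integral>\<^sup>+w\<in>U_dom \<alpha>. ennreal (cmod (f w) * schur_weight \<alpha> w) \<partial>lborel)
      \<le> ennreal (C * M * ((1 - (cmod (snd z))\<^sup>2) powr ((2 + \<alpha>) / 4) * (1 - (cmod (f_alpha \<alpha> z))\<^sup>2) powr (3/4)))"
    using ex_test_estimate[OF \<alpha> p] by blast
  obtain K where K: "K > 0" "\<And>z. z\<in>U_dom \<alpha> \<Longrightarrow> l2_norm \<alpha> (bergman_kernel \<alpha> z) \<le>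
    K / ((1 - (cmod (snd z))\<^sup>2) powr (1 + \<alpha>/2) * (1 - (cmod (f_alpha \<alpha> z))\<^sup>2) powr (3/2))"
    using ex_kernel_norm_bound[OF \<alpha>] by blast
  have bound: "\<exists>C'\<ge>0. \<forall>z\<in>U_dom \<alpha>. (\<integral>\<^sup>+w\<in>U_dom \<alpha>. ennreal (l2_norm \<alpha> (bergman_kernel \<alpha> z) * cmod (R (normalized_kernel \<alpha> z) w) * schur_weight \<alpha> w) \<partial>lborel) \<le> ennreal (C' * schur_weight \<alpha> z)"
    if R: "R ` kernel_span \<alpha> \<subseteq> bergman_space \<alpha>"
      and sup: "(SUP z\<in>U_dom \<alpha>. lp_norm \<alpha> p (V_op \<alpha> (f_alpha \<alpha> z) (U_op \<alpha> z (R (normalized_kernel \<alpha> z))))) < \<infinity>" (is "?s < \<infinity>")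
    for R
  proof -
    \<comment> \<open>The summand \<open>1\<close> makes the bound positive.\<close>
    define M where "M = enn2real ?s + 1"
    have M: "M > 0" by (simp add: M_def add_nonneg_pos)
    have "(\<integral>\<^sup>+w\<in>U_dom \<alpha>. ennreal (l2_norm \<alpha> (bergman_kernel \<alpha> z) * cmod (R (normalized_kernel \<alpha> z) w) * schur_weight \<alpha> w) \<partial>lborel) \<le> ennreal ((K * C * M) * schur_weight \<alpha> z)"
      if z: "z \<in> U_dom \<alpha>" for z
    proof -
      define f where "f = R (normalized_kernel \<alpha> z)"
      define N where "N = l2_norm \<alpha> (bergman_kernel \<alpha> z)"
      define X where "X = 1 - (cmod (snd z))\<^sup>2"
      define Y where "Y = 1 - (cmod (f_alpha \<alpha> z))\<^sup>2"
      have XY: "X > 0" "Y > 0" using U_dom_bounds[OF \<alpha> z] f_alpha_less_one[OF \<alpha> z] by (auto simp: X_def Y_def abs_square_less_1)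
      have N0: "N \<ge> 0" by (simp add: N_def l2_norm_nonneg)
      have "f \<in> bergman_space \<alpha>" unfolding f_def using R normalized_kernel_facts(2)[OF \<alpha> z] by blast
      then have fm[measurable]: "f \<in> borel_measurable borel" by (rule bergman_measurable[OF \<alpha>])
      have "lp_norm \<alpha> p (V_op \<alpha> (f_alpha \<alpha> z) (U_op \<alpha> z f)) \<le> ?s" unfolding f_def using z by (rule SUP_upper)
      also have "?s = ennreal (enn2real ?s)" using sup by (simp add: less_top)
      also have "\<dots> \<le> ennreal M" by (intro ennreal_leI) (simp add: M_def)
      finally have lp: "lp_norm \<alpha> p (V_op \<alpha> (f_alpha \<alpha> z) (U_op \<alpha> z f)) \<le> ennreal M" .
      have I: "(\<integral>\<^sup>+w\<in>U_dom \<alpha>. ennreal (cmod (f w) * schur_weight \<alpha> w) \<partial>lborel)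
        \<le> ennreal (C * M * (X powr ((2 + \<alpha>) / 4) * Y powr (3/4)))"
        unfolding X_def Y_def
        by (rule C(2)[OF fm z M lp_norm_le_imp_nn_integral_le[OF _ _ lp]]) (use p M in auto)
      have "(\<integral>\<^sup>+w\<in>U_dom \<alpha>. ennreal (N * cmod (f w) * schur_weight \<alpha> w) \<partial>lborel) =
        (\<integral>\<^sup>+w. ennreal N * (ennreal (cmod (f w) * schur_weight \<alpha> w) * indicator (U_dom \<alpha>) w) \<partial>lborel)"
        using N0 by (intro nn_integral_cong) (simp add: ennreal_mult' mult.assoc)
      also have "\<dots> = ennreal N * (\<integral>\<^sup>+w\<in>U_dom \<alpha>. ennreal (cmod (f w) * schur_weight \<alpha> w) \<partial>lborel)"
        using \<alpha> by (intro nn_integral_cmult) measurable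
      also have "\<dots> \<le> ennreal N * ennreal (C * M * (X powr ((2 + \<alpha>) / 4) * Y powr (3/4)))"
        by (intro mult_left_mono I) auto
      also have "\<dots> = ennreal (N * (C * M * (X powr ((2 + \<alpha>) / 4) * Y powr (3/4))))"
        using N0 C(1) M by (simp flip: ennreal_mult)
      also have "\<dots> \<le> ennreal (K * C * M * schur_weight \<alpha> z)"
      proof (rule ennreal_leI)
        have "N * (C * M * (X powr ((2 + \<alpha>) / 4) * Y powr (3/4))) \<le> K / (X powr (1 + \<alpha>/2) * Y powr (3/2)) * (C * M * (X powr ((2 + \<alpha>) / 4) * Y powr (3/4)))"
          using K(2)[OF z] C(1) M unfolding N_def X_def Y_def by (intro mult_right_mono) auto
        also have "\<dots> = K * C * M * ((X powr - (1 + \<alpha>/2) * X powr ((2 + \<alpha>) / 4)) * (Y powr - (3/2) * Y powr (3/4)))"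
          unfolding powr_minus_divide by simp
        also have "X powr - (1 + \<alpha>/2) * X powr ((2 + \<alpha>) / 4) = X powr (- (2 + \<alpha>) / 4)"
          unfolding powr_add[symmetric] by (rule arg_cong[where f = "\<lambda>e. X powr e"]) (simp add: field_simps)
        also have "Y powr - (3/2) * Y powr (3/4) = Y powr (- 3/4)"
          unfolding powr_add[symmetric] by (rule arg_cong[where f = "\<lambda>e. Y powr e"]) simp
        finally show "N * (C * M * (X powr ((2 + \<alpha>) / 4) * Y powr (3/4))) \<le> K * C * M * schur_weight \<alpha> z"
          by (simp add: schur_weight_def X_def Y_def)
      qed
      finally show ?thesis unfolding N_def f_def .
    qed
    moreover have "K * C * M \<ge> 0" using K(1) C(1) M by simp
    ultimately show ?thesis by blast
  qed
  obtain C1 where C1: "C1 \<ge> 0" "\<And>z. z\<in>U_dom \<alpha> \<Longrightarrow> (\<integral>\<^sup>+w\<in>U_dom \<alpha>. ennreal (l2_norm \<alpha> (bergman_kernel \<alpha> z) * cmod (T (normalized_kernel \<alpha> z) w) * schur_weight \<alpha> w) \<partial>lborel) \<le> ennreal (C1 * schur_weight \<alpha> z)"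
    using bound[OF assms(4) assms(9)] by blast
  obtain C2 where C2: "C2 \<ge> 0" "\<And>z. z\<in>U_dom \<alpha> \<Longrightarrow> (\<integral>\<^sup>+w\<in>U_dom \<alpha>. ennreal (l2_norm \<alpha> (bergman_kernel \<alpha> z) * cmod (Tstar (normalized_kernel \<alpha> z) w) * schur_weight \<alpha> w) \<partial>lborel) \<le> ennreal (C2 * schur_weight \<alpha> z)"
    using bound[OF assms(6) assms(10)] by blast
  have pos: "0 < schur_weight \<alpha> z" if "z \<in> U_dom \<alpha>" for z
    using U_dom_bounds[OF \<alpha> that] f_alpha_less_one[OF \<alpha> that] by (auto simp: schur_weight_def abs_square_eq_1)
  show ?thesis
  proof (rule bounded_extension_of_Schur_bounds[OF \<alpha> assms(3,4,6,7) schur_weight_measurable pos, of "C1 + C2"])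
    show "0 \<le> C1 + C2" using C1 C2 by simp
    fix z assume z: "z \<in> U_dom \<alpha>"
    have "ennreal (C1 * schur_weight \<alpha> z) \<le> ennreal ((C1 + C2) * schur_weight \<alpha> z)"
      using C2(1) pos[OF z] by (intro ennreal_leI mult_right_mono) auto
    then show "(\<integral>\<^sup>+w\<in>U_dom \<alpha>. ennreal (l2_norm \<alpha> (bergman_kernel \<alpha> z) * cmod (T (normalized_kernel \<alpha> z) w) * schur_weight \<alpha> w) \<partial>lborel) \<le> ennreal ((C1 + C2) * schur_weight \<alpha> z)"
      using C1(2)[OF z] by (rule order_trans[rotated])
    have "ennreal (C2 * schur_weight \<alpha> z) \<le> ennreal ((C1 + C2) * schur_weight \<alpha> z)"
      using C1(1) pos[OF z] by (intro ennreal_leI mult_right_mono) auto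
    then show "(\<integral>\<^sup>+w\<in>U_dom \<alpha>. ennreal (l2_norm \<alpha> (bergman_kernel \<alpha> z) * cmod (Tstar (normalized_kernel \<alpha> z) w) * schur_weight \<alpha> w) \<partial>lborel) \<le> ennreal ((C1 + C2) * schur_weight \<alpha> z)"
      using C2(2)[OF z] by (rule order_trans[rotated])
  qed
qed

end
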